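(* Let $q$ be a prime power and let $F/\mathbf{F}_q$ be an algebraic function field of one variable with genus $g(F)$. Let $P_1,\ldots,P_n,Q_1,\ldots,Q_L$ be pairwise distinct $\mathbf{F}_q$-rational places of $F/\mathbf{F}_q$, and let $G$ be a divisor of $F/\mathbf{F}_q$ whose support contains none of $P_1,\ldots,P_n,Q_1,\ldots,Q_L$. Assume \[ L = \dim \mathcal{L}(G) - \dim \mathcal{L}(G-Q_1-\cdots-Q_L), \qquad 0=\dim\mathcal{L}(G-P_1-\cdots-P_n). \] Consider the quantum ramp secret sharing scheme with secret space $\bigotimes_{i=1}^L\mathcal{G}_i$ and share space $\bigotimes_{j=1}^n\mathcal{H}_j$ (all $\mathcal{G}_i,\mathcal{H}_j$ being $q$-dimensional with orthonormal basis $\{|a\rangle : a\in\mathbf{F}_q\}$), defined as the complex linear isometric embedding that maps each basis state $|\vec{s}\rangle$, $\vec{s}\in\mathbf{F}_q^L$, to \[ \frac{1}{\sqrt{q^{\dim\mathcal{L}(G-Q_1-\cdots-Q_L)}}}\sum_{\substack{h\in\mathcal{L}(G)\\ (h(Q_1),\ldots,h(Q_L))=\vec{s}}} |h(P_1)\rangle\otimes|h(P_2)\rangle\otimes\cdots\otimes|h(P_n)\rangle , \] where $\mathcal{H}_j$ is the $j$-th share. Then for $I\subset\{1,\ldots,L\}$ and $J\subset\{1,\ldots,n\}$, the scheme is strongly secure with respect to $I$ and $J$ whenever \[ |J| \le |\overline{I}| + \min\{\deg G - L - 2g(F)+1,\; n-1-\deg G\}, \] where $\overline{I}=\{1,\ldots,L\}\setminus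 I$.
   Context: $\mathcal{L}(G)$ denotes the Riemann–Roch space of the divisor $G$ (a finite-dimensional $\mathbf{F}_q$-vector space), and $h(P)$ is the evaluation of $h$ at a rational place $P$. For $I\subseteq\{1,\ldots,L\}$ let $\mathcal{G}_I=\bigotimes_{i\in I}\mathcal{G}_i$ and $\mathcal{G}_{\overline{I}}=\bigotimes_{i\in\overline{I}}\mathcal{G}_i$. Definition (strong security): a quantum ramp secret sharing scheme (an isometric encoding of the secret space into the share space) is strongly secure with respect to $I$ and $J$ if the quantum state $\sigma_J$ of the shares in $\bigotimes_{j\in J}\mathcal{H}_j$ (the reduced state of the encoded secret) is always the same state regardless of the quantum state $\rho_I$, when the whole quantum secret is in the state $\rho_I\otimes\rho_{\overline{I},\mathrm{mix}}$, where $\rho_I$ is an arbitrary state on $\mathcal{G}_I$ and $\rho_{\overline{I},\mathrm{mix}}$ is the fully mixed state on $\mathcal{G}_{\overline{I}}$. *)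

theory Defs
  imports "HOL-Computational_Algebra.Polynomial" "HOL-Library.FuncSet"
begin

section \<open>Algebraic function fields F/K (Stichtenoth), F = UNIV of type 'f, K the constant field\<close>

definition subfield :: "'f::field set \<Rightarrow> bool" where
  "subfield K \<longleftrightarrow> 0 \<in> K \<and> 1 \<in> K \<and>
     (\<forall>a\<in>K. \<forall>b\<in>K. a + b \<in> K \<and> a * b \<in> K \<and> - a \<in> K) \<and> (\<forall>a\<in>K. inverse a \<in> K)"

definition transcendental_over :: "'f::field set \<Rightarrow> 'f \<Rightarrow> bool" where
  "transcendental_over K x \<longleftrightarrow>
     (\<forall>p. set (coeffs p) \<subseteq> K \<longrightarrow> p \<noteq> 0 \<longrightarrow> poly p x \<noteq> 0)"

definition rat_fun_field :: "'f::field set \<Rightarrow> 'f \<Rightarrow> 'f set" where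
  "rat_fun_field K x = {poly a x / poly b x | a b.
      set (coeffs a) \<subseteq> K \<and> set (coeffs b) \<subseteq> K \<and> poly b x \<noteq> 0}"

definition function_field :: "'f::field set \<Rightarrow> bool" where
  "function_field K \<longleftrightarrow> subfield K \<and>
     (\<exists>x. transcendental_over K x \<and>
        (\<exists>B. finite B \<and> (\<forall>z. \<exists>c. (\<forall>b\<in>B. c b \<in> rat_fun_field K x) \<and> z = (\<Sum>b\<in>B. c b * b))))"

text \<open>Valuation rings of F/K; a place P is represented by its valuation ring R_P
  (P itself is max_ideal R_P; this correspondence is bijective).\<close>
definition valuation_ring :: "'f::field set \<Rightarrow> 'f set \<Rightarrow> bool" where
  "valuation_ring K R \<longleftrightarrow> K \<subset> R \<and> R \<noteq> UNIV \<and>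
     (\<forall>a\<in>R. \<forall>b\<in>R. a + b \<in> R \<and> a * b \<in> R \<and> - a \<in> R) \<and>
     (\<forall>z. z \<in> R \<or> inverse z \<in> R)"

definition places :: "'f::field set \<Rightarrow> 'f set set" where
  "places K = {R. valuation_ring K R}"

definition max_ideal :: "'f::field set \<Rightarrow> 'f set" where
  "max_ideal R = {z \<in> R. z = 0 \<or> inverse z \<notin> R}"

definition uniformizer :: "'f::field set \<Rightarrow> 'f \<Rightarrow> bool" where
  "uniformizer R t \<longleftrightarrow> t \<in> R \<and> max_ideal R = {t * a | a. a \<in> R}"

text \<open>Normalized discrete valuation v_P(z), z nonzero.\<close>
definition ord :: "'f::field set \<Rightarrow> 'f \<Rightarrow> int" where
  "ord R z = (THE n::int. \<exists>u. u \<in> R \<and> u \<noteq> 0 \<and> inverse u \<in> R \<and>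
                 z = (SOME t. uniformizer R t) powi n * u)"

definition kdim :: "'f::field set \<Rightarrow> 'f set \<Rightarrow> nat" where
  "kdim K V = (THE d. \<exists>b. (\<forall>i<d. b i \<in> V) \<and>
      (\<forall>c. (\<forall>i<d. c i \<in> K) \<longrightarrow> (\<Sum>i<d. c i * b i) = 0 \<longrightarrow> (\<forall>i<d. c i = 0)) \<and>
      V = {\<Sum>i<d. c i * b i | c. \<forall>i<d. c i \<in> K})"

definition place_degree :: "'f::field set \<Rightarrow> 'f set \<Rightarrow> nat" where
  "place_degree K R = (THE d. \<exists>b. (\<forall>i<d. b i \<in> R) \<and>
      (\<forall>c. (\<forall>i<d. c i \<in> K) \<longrightarrow> (\<Sum>i<d. c i * b i) \<in> max_ideal R \<longrightarrow> (\<forall>i<d. c i = 0)) \<and>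
      (\<forall>z\<in>R. \<exists>c. (\<forall>i<d. c i \<in> K) \<and> z - (\<Sum>i<d. c i * b i) \<in> max_ideal R))"

definition rational_place :: "'f::field set \<Rightarrow> 'f set \<Rightarrow> bool" where
  "rational_place K R \<longleftrightarrow> R \<in> places K \<and> place_degree K R = 1"

definition divisor :: "'f::field set \<Rightarrow> ('f set \<Rightarrow> int) \<Rightarrow> bool" where
  "divisor K D \<longleftrightarrow> finite {R. D R \<noteq> 0} \<and> (\<forall>R. D R \<noteq> 0 \<longrightarrow> R \<in> places K)"

definition div_deg :: "'f::field set \<Rightarrow> ('f set \<Rightarrow> int) \<Rightarrow> int" where
  "div_deg K D = (\<Sum>R\<in>{R. D R \<noteq> 0}. D R * int (place_degree K R))"

definition place_div :: "'f set \<Rightarrow> ('f set \<Rightarrow> int)" where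
  "place_div R = (\<lambda>X. if X = R then 1 else 0)"

definition places_sum :: "(nat \<Rightarrow> 'f set) \<Rightarrow> nat set \<Rightarrow> ('f set \<Rightarrow> int)" where
  "places_sum P S = (\<lambda>X. \<Sum>i\<in>S. place_div (P i) X)"

definition RR_space :: "'f::field set \<Rightarrow> ('f set \<Rightarrow> int) \<Rightarrow> 'f set" where
  "RR_space K A = {z. z = 0 \<or> (\<forall>R\<in>places K. ord R z \<ge> - A R)}"

definition ell :: "'f::field set \<Rightarrow> ('f set \<Rightarrow> int) \<Rightarrow> nat" where
  "ell K A = kdim K (RR_space K A)"

definition genus :: "'f::field set \<Rightarrow> int" where
  "genus K = (GREATEST m. \<exists>A. divisor K A \<and> m = div_deg K A - int (ell K A) + 1)"

text \<open>Evaluation h(P) at a rational place (h in R_P).\<close>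
definition eval_at :: "'f::field set \<Rightarrow> 'f set \<Rightarrow> 'f \<Rightarrow> 'f" where
  "eval_at K R h = (THE a. a \<in> K \<and> h - a \<in> max_ideal R)"

text \<open>An operator on the tensor product of copies of C^K indexed by a set X of positions
  is a matrix indexed by basis vectors, i.e. elements of PiE X (\<lambda>_. K).\<close>
definition density_op :: "'b set \<Rightarrow> ('b \<Rightarrow> 'b \<Rightarrow> complex) \<Rightarrow> bool" where
  "density_op B \<rho> \<longleftrightarrow>
     (\<forall>a\<in>B. \<forall>b\<in>B. \<rho> b a = cnj (\<rho> a b)) \<and>
     (\<forall>v. Im (\<Sum>a\<in>B. \<Sum>b\<in>B. cnj (v a) * \<rho> a b * v b) = 0 \<and>
          Re (\<Sum>a\<in>B. \<Sum>b\<in>B. cnj (v a) * \<rho> a b * v b) \<ge> 0) \<and>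
     (\<Sum>a\<in>B. \<rho> a a) = 1"

definition tensor_mixed ::
  "'f set \<Rightarrow> nat \<Rightarrow> nat set \<Rightarrow> ((nat \<Rightarrow> 'f) \<Rightarrow> (nat \<Rightarrow> 'f) \<Rightarrow> complex) \<Rightarrow>
   (nat \<Rightarrow> 'f) \<Rightarrow> (nat \<Rightarrow> 'f) \<Rightarrow> complex" where
  "tensor_mixed K L I \<rho>I s s' =
     \<rho>I (restrict s I) (restrict s' I) *
     (if (\<forall>i\<in>{1..L} - I. s i = s' i)
      then 1 / of_nat (card K ^ card ({1..L} - I)) else 0)"

definition reduced_state ::
  "'f set \<Rightarrow> nat \<Rightarrow> nat set \<Rightarrow> ((nat \<Rightarrow> 'f) \<Rightarrow> (nat \<Rightarrow> 'f) \<Rightarrow> complex) \<Rightarrow>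
   (nat \<Rightarrow> 'f) \<Rightarrow> (nat \<Rightarrow> 'f) \<Rightarrow> complex" where
  "reduced_state K n J \<sigma> a b =
     (\<Sum>z\<in>PiE ({1..n} - J) (\<lambda>_. K).
        \<sigma> (\<lambda>j. if j \<in> J then a j else z j) (\<lambda>j. if j \<in> J then b j else z j))"

definition strongly_secure ::
  "'f set \<Rightarrow> nat \<Rightarrow> nat \<Rightarrow>
   (((nat \<Rightarrow> 'f) \<Rightarrow> (nat \<Rightarrow> 'f) \<Rightarrow> complex) \<Rightarrow> ((nat \<Rightarrow> 'f) \<Rightarrow> (nat \<Rightarrow> 'f) \<Rightarrow> complex)) \<Rightarrow>
   nat set \<Rightarrow> nat set \<Rightarrow> bool" where
  "strongly_secure K L n enc I J \<longleftrightarrow>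
     (\<forall>\<rho>1 \<rho>2. density_op (PiE I (\<lambda>_. K)) \<rho>1 \<longrightarrow> density_op (PiE I (\<lambda>_. K)) \<rho>2 \<longrightarrow>
        (\<forall>a\<in>PiE J (\<lambda>_. K). \<forall>b\<in>PiE J (\<lambda>_. K).
           reduced_state K n J (enc (tensor_mixed K L I \<rho>1)) a b =
           reduced_state K n J (enc (tensor_mixed K L I \<rho>2)) a b))"

text \<open>Amplitude <y| V |s> of the isometric encoding V.\<close>
definition qrss_amp ::
  "'f::field set \<Rightarrow> ('f set \<Rightarrow> int) \<Rightarrow> (nat \<Rightarrow> 'f set) \<Rightarrow> (nat \<Rightarrow> 'f set) \<Rightarrow> nat \<Rightarrow> nat \<Rightarrow>
   (nat \<Rightarrow> 'f) \<Rightarrow> (nat \<Rightarrow> 'f) \<Rightarrow> complex" where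
  "qrss_amp K G P Q n L s y =
     complex_of_real (1 / sqrt (real (card K ^ ell K (G - places_sum Q {1..L})))) *
     of_nat (card {h \<in> RR_space K G. (\<forall>i\<in>{1..L}. eval_at K (Q i) h = s i) \<and>
                                     (\<forall>j\<in>{1..n}. eval_at K (P j) h = y j)})"

definition qrss_encode ::
  "'f::field set \<Rightarrow> ('f set \<Rightarrow> int) \<Rightarrow> (nat \<Rightarrow> 'f set) \<Rightarrow> (nat \<Rightarrow> 'f set) \<Rightarrow> nat \<Rightarrow> nat \<Rightarrow>
   ((nat \<Rightarrow> 'f) \<Rightarrow> (nat \<Rightarrow> 'f) \<Rightarrow> complex) \<Rightarrow> (nat \<Rightarrow> 'f) \<Rightarrow> (nat \<Rightarrow> 'f) \<Rightarrow> complex" where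
  "qrss_encode K G P Q n L \<rho> y y' =
     (\<Sum>s\<in>PiE {1..L} (\<lambda>_. K). \<Sum>s'\<in>PiE {1..L} (\<lambda>_. K).
        qrss_amp K G P Q n L s y * \<rho> s s' * cnj (qrss_amp K G P Q n L s' y'))"

end

theory Submission
  imports Defs "HOL-Library.Function_Algebras" "HOL-Library.Set_Algebras"
begin

text \<open>
  If two functions of \<open>L(G)\<close> agree at the \<open>Q\<^sub>i\<close> with \<open>i \<notin> I\<close> and at the \<open>P\<^sub>j\<close> with
  \<open>j \<notin> J\<close>, their difference lies in a Riemann--Roch space of negative degree, hence they are equal;
  so tracing out the shares outside \<open>J\<close> leaves only the diagonal of \<open>\<rho>\<^sub>I\<close>.  The weight of a
  diagonal entry is a count of functions with prescribed values, and it is the same for all entries because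
  \<open>L(G)\<close> contains functions that vanish at the \<open>P\<^sub>j\<close>, \<open>j \<in> J\<close>, and take
  arbitrary values at the \<open>Q\<^sub>i\<close>, \<open>i \<in> I\<close>.  Since the trace is 1, \<open>\<rho>\<^sub>I\<close> drops out.

  Such functions exist because \<open>L(A) \<noteq> L(A + R)\<close> for rational \<open>R\<close> and
  \<open>deg A \<ge> 2g - 1\<close>.  Only this consequence of the Riemann--Roch theorem is needed, and it can be had without
  adeles: the place \<open>R\<close> makes the first cohomology of \<open>A\<close> the quotient of \<open>F\<close> by the
  sum of the functions bounded by \<open>A\<close> away from \<open>R\<close> and those bounded by \<open>A\<close> at \<open>R\<close>.
\<close>

section \<open>Linear algebra over subrings and subfields\<close>

definition subring :: "'f::field set \<Rightarrow> bool" where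
  "subring S \<longleftrightarrow> 0 \<in> S \<and> 1 \<in> S \<and> (\<forall>a\<in>S. \<forall>b\<in>S. a + b \<in> S \<and> a * b \<in> S \<and> - a \<in> S)"

lemma
  assumes "subring S"
  shows subring_0: "0 \<in> S"
    and subring_1: "1 \<in> S"
    and subring_add: "a \<in> S \<Longrightarrow> b \<in> S \<Longrightarrow> a + b \<in> S"
    and subring_mult: "a \<in> S \<Longrightarrow> b \<in> S \<Longrightarrow> a * b \<in> S"
    and subring_uminus: "a \<in> S \<Longrightarrow> - a \<in> S"
  using assms unfolding subring_def by blast+

lemma subring_diff: "subring S \<Longrightarrow> a \<in> S \<Longrightarrow> b \<in> S \<Longrightarrow> a - b \<in> S"
  using subring_add[of S a "- b"] subring_uminus[of S b] by simp

lemma subring_sum: "subring S \<Longrightarrow> (\<And>i. i \<in> A \<Longrightarrow> f i \<in> S) \<Longrightarrow> sum f A \<in> S"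
  by (induction A rule: infinite_finite_induct) (auto intro: subring_0 subring_add)

lemma subring_prod: "subring S \<Longrightarrow> (\<And>i. i \<in> A \<Longrightarrow> f i \<in> S) \<Longrightarrow> prod f A \<in> S"
  by (induction A rule: infinite_finite_induct) (auto intro: subring_1 subring_mult)

lemma subring_power: "subring S \<Longrightarrow> a \<in> S \<Longrightarrow> a ^ n \<in> S"
  by (induction n) (auto intro: subring_1 subring_mult)

lemmas subring_closed =
  subring_0 subring_1 subring_add subring_mult subring_uminus subring_diff
  subring_sum subring_prod subring_power

definition submodule :: "'f::field set \<Rightarrow> 'f set \<Rightarrow> bool" where
  "submodule S V \<longleftrightarrow> 0 \<in> V \<and> (\<forall>a\<in>V. \<forall>b\<in>V. a + b \<in> V) \<and> (\<forall>c\<in>S. \<forall>a\<in>V. c * a \<in> V)"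

lemma
  assumes "submodule S V"
  shows submodule_0: "0 \<in> V"
    and submodule_add: "a \<in> V \<Longrightarrow> b \<in> V \<Longrightarrow> a + b \<in> V"
    and submodule_smult: "c \<in> S \<Longrightarrow> a \<in> V \<Longrightarrow> c * a \<in> V"
  using assms unfolding submodule_def by blast+

lemma submodule_sum: "submodule S V \<Longrightarrow> (\<And>i. i \<in> A \<Longrightarrow> f i \<in> V) \<Longrightarrow> sum f A \<in> V"
  by (induction A rule: infinite_finite_induct) (auto intro: submodule_0 submodule_add)

lemma submodule_lincomb:
  "submodule S V \<Longrightarrow> (\<And>i. i \<in> A \<Longrightarrow> b i \<in> V) \<Longrightarrow> (\<And>i. i \<in> A \<Longrightarrow> c i \<in> S) \<Longrightarrow> (\<Sum>i\<in>A. c i * b i) \<in> V"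
  by (auto intro: submodule_sum submodule_smult)

lemma submodule_singleton_0: "submodule S {0}"
  unfolding submodule_def by auto

lemma submodule_subring: "subring T \<Longrightarrow> S \<subseteq> T \<Longrightarrow> submodule S T"
  unfolding submodule_def by (auto intro: subring_closed)

lemma submodule_INT: "(\<And>R. R \<in> T \<Longrightarrow> submodule S (V R)) \<Longrightarrow> submodule S (\<Inter>R\<in>T. V R)"
  unfolding submodule_def by auto

lemma submodule_Int: "submodule S V \<Longrightarrow> submodule S W \<Longrightarrow> submodule S (V \<inter> W)"
  unfolding submodule_def by auto

lemma submodule_set_plus:
  assumes submodule_V: "submodule S V" and submodule_W: "submodule S W"
  shows "submodule S (V + W)"
  unfolding submodule_def
proof (intro conjI ballI)
  show "0 \<in> V + W"
    using set_plus_intro[OF submodule_0[OF submodule_V] submodule_0[OF submodule_W]] by simp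
next
  fix a b assume "a \<in> V + W" "b \<in> V + W"
  then obtain v w v' w' where "a = v + w" "b = v' + w'" "v \<in> V" "w \<in> W" "v' \<in> V" "w' \<in> W"
    by (elim set_plus_elim)
  moreover from this have "a + b = (v + v') + (w + w')"
    by simp
  ultimately show "a + b \<in> V + W"
    using submodule_add[OF submodule_V] submodule_add[OF submodule_W] by (simp only: set_plus_intro)
next
  fix c a assume "c \<in> S" "a \<in> V + W"
  then show "c * a \<in> V + W"
    using submodule_smult[OF submodule_V] submodule_smult[OF submodule_W]
    by (auto elim!: set_plus_elim intro!: set_plus_intro simp: distrib_left)
qed

lemma submodule_times_image: "submodule S V \<Longrightarrow> submodule S ((*) y ` V)"
  unfolding submodule_def
  by (auto simp: image_iff distrib_left[symmetric] mult.left_commute[of _ y])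

definition lincombs :: "'f::field set \<Rightarrow> 'i set \<Rightarrow> ('i \<Rightarrow> 'f) \<Rightarrow> 'f set" where
  "lincombs S A b = {\<Sum>i\<in>A. c i * b i | c. \<forall>i\<in>A. c i \<in> S}"

lemma lincombsI: "(\<And>i. i \<in> A \<Longrightarrow> c i \<in> S) \<Longrightarrow> (\<Sum>i\<in>A. c i * b i) \<in> lincombs S A b"
  unfolding lincombs_def by blast

lemma lincombsE:
  assumes "z \<in> lincombs S A b"
  obtains c where "\<forall>i\<in>A. c i \<in> S" "z = (\<Sum>i\<in>A. c i * b i)"
  using assms unfolding lincombs_def by blast

lemma basis_in_lincombs:
  assumes "subring S" "finite A" "i \<in> A"
  shows "b i \<in> lincombs S A b"
proof -
  have "(\<Sum>j\<in>A. (if j = i then 1 else 0) * b j) = b i"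
    using assms(2,3) by (simp add: if_distrib[of "\<lambda>x. x * _"] cong: if_cong)
  then show ?thesis
    using lincombsI[of A "\<lambda>j. if j = i then 1 else 0" S b] assms(1) by (simp add: subring_closed)
qed

lemma submodule_lincombs:
  assumes "subring S"
  shows "submodule S (lincombs S A b)"
  unfolding submodule_def
proof (intro conjI ballI)
  show "0 \<in> lincombs S A b"
    using lincombsI[of A "\<lambda>_. 0" S b] assms by (simp add: subring_0)
next
  fix u v assume "u \<in> lincombs S A b" "v \<in> lincombs S A b"
  then obtain c d where "\<forall>i\<in>A. c i \<in> S" "\<forall>i\<in>A. d i \<in> S"
    and "u = (\<Sum>i\<in>A. c i * b i)" "v = (\<Sum>i\<in>A. d i * b i)"
    by (elim lincombsE)
  moreover from this have "u + v = (\<Sum>i\<in>A. (c i + d i) * b i)"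
    by (simp add: distrib_right sum.distrib)
  ultimately show "u + v \<in> lincombs S A b"
    using assms by (simp only:) (auto intro!: lincombsI subring_add)
next
  fix k u assume "k \<in> S" "u \<in> lincombs S A b"
  moreover from this obtain c where "\<forall>i\<in>A. c i \<in> S" "u = (\<Sum>i\<in>A. c i * b i)"
    by (elim lincombsE)
  moreover from this have "k * u = (\<Sum>i\<in>A. (k * c i) * b i)"
    by (simp add: sum_distrib_left mult.assoc)
  ultimately show "k * u \<in> lincombs S A b"
    using assms by (simp only:) (auto intro!: lincombsI subring_mult)
qed

definition lin_indep_mod :: "'f::field set \<Rightarrow> 'f set \<Rightarrow> 'i set \<Rightarrow> ('i \<Rightarrow> 'f) \<Rightarrow> bool" where
  "lin_indep_mod S W A b \<longleftrightarrow>
     (\<forall>c. (\<forall>i\<in>A. c i \<in> S) \<longrightarrow> (\<Sum>i\<in>A. c i * b i) \<in> W \<longrightarrow> (\<forall>i\<in>A. c i = 0))"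

abbreviation lin_indep :: "'f::field set \<Rightarrow> 'i set \<Rightarrow> ('i \<Rightarrow> 'f) \<Rightarrow> bool" where
  "lin_indep S \<equiv> lin_indep_mod S {0}"

definition spans_mod :: "'f::field set \<Rightarrow> 'f set \<Rightarrow> 'f set \<Rightarrow> 'i set \<Rightarrow> ('i \<Rightarrow> 'f) \<Rightarrow> bool" where
  "spans_mod S V W A b \<longleftrightarrow>
     (\<forall>z\<in>V. \<exists>c. (\<forall>i\<in>A. c i \<in> S) \<and> z - (\<Sum>i\<in>A. c i * b i) \<in> W)"

definition has_dim :: "'f::field set \<Rightarrow> 'f set \<Rightarrow> 'f set \<Rightarrow> nat \<Rightarrow> bool" where
  "has_dim K V W d \<longleftrightarrow>
     (\<exists>b. (\<forall>i<d. b i \<in> V) \<and> lin_indep_mod K W {..<d} b \<and> spans_mod K V W {..<d} b)"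

lemma lin_indep_modI:
  assumes "\<And>c i. (\<And>j. j \<in> A \<Longrightarrow> c j \<in> S) \<Longrightarrow> (\<Sum>j\<in>A. c j * b j) \<in> W \<Longrightarrow> i \<in> A \<Longrightarrow> c i = 0"
  shows "lin_indep_mod S W A b"
  using assms unfolding lin_indep_mod_def by blast

lemma lin_indep_modD:
  assumes "lin_indep_mod S W A b" "\<And>j. j \<in> A \<Longrightarrow> c j \<in> S" "(\<Sum>j\<in>A. c j * b j) \<in> W" "i \<in> A"
  shows "c i = 0"
  using assms unfolding lin_indep_mod_def by blast

lemma lin_indep_mod_mono:
  "lin_indep_mod S' W' A b \<Longrightarrow> S \<subseteq> S' \<Longrightarrow> W \<subseteq> W' \<Longrightarrow> lin_indep_mod S W A b"
  unfolding lin_indep_mod_def by (meson subsetD)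

lemma lin_indep_mod_reindex:
  assumes bij_h: "bij_betw h B A" and b_indep: "lin_indep_mod S W A b"
  shows "lin_indep_mod S W B (b \<circ> h)"
proof (rule lin_indep_modI)
  fix c i assume c_in_S: "\<And>j. j \<in> B \<Longrightarrow> c j \<in> S" and lincomb_in_W: "(\<Sum>j\<in>B. c j * (b \<circ> h) j) \<in> W"
    and i_in_B: "i \<in> B"
  let ?g = "the_inv_into B h"
  have inv_h: "?g (h j) = j" if "j \<in> B" for j
    using bij_h that by (auto simp: bij_betw_def the_inv_into_f_f)
  have "(\<Sum>j\<in>A. c (?g j) * b j) = (\<Sum>j\<in>B. c (?g (h j)) * b (h j))"
    by (rule sum.reindex_bij_betw[OF bij_h, symmetric])
  also have "\<dots> = (\<Sum>j\<in>B. c j * (b \<circ> h) j)"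
    by (simp add: inv_h)
  finally have "c (?g (h i)) = 0"
    using c_in_S lincomb_in_W i_in_B bij_h bij_betw_apply[OF bij_h]
      bij_betw_apply[OF bij_betw_the_inv_into[OF bij_h]]
    by (intro lin_indep_modD[OF b_indep, of "c \<circ> ?g" "h i", unfolded o_def]) auto
  then show "c i = 0"
    using inv_h i_in_B by simp
qed

lemma spans_mod_0_iff: "spans_mod S V {0} A b \<longleftrightarrow> V \<subseteq> lincombs S A b"
  unfolding spans_mod_def lincombs_def by auto

lemma has_dimI:
  assumes "\<And>i. i < d \<Longrightarrow> b i \<in> V" "lin_indep_mod K W {..<d} b"
    and "\<And>z. z \<in> V \<Longrightarrow> \<exists>c. (\<forall>i<d. c i \<in> K) \<and> z - (\<Sum>i<d. c i * b i) \<in> W"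
  shows "has_dim K V W d"
  unfolding has_dim_def spans_mod_def Ball_def lessThan_iff using assms by blast

lemma has_dimE:
  assumes "has_dim K V W d"
  obtains b where "\<forall>i<d. b i \<in> V" "lin_indep_mod K W {..<d} b"
    and "\<forall>z\<in>V. \<exists>c. (\<forall>i<d. c i \<in> K) \<and> z - (\<Sum>i<d. c i * b i) \<in> W"
  using assms unfolding has_dim_def spans_mod_def Ball_def lessThan_iff by blast

lemma has_dim_self: "submodule K V \<Longrightarrow> has_dim K V V 0"
  unfolding has_dim_def lin_indep_mod_def spans_mod_def by auto

lemma has_dim_0D: "has_dim K V W 0 \<Longrightarrow> V \<subseteq> W"
  unfolding has_dim_def spans_mod_def by auto

lemma has_dim_times_image:
  assumes "y \<noteq> 0" and has_dim_V: "has_dim K V W d"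
  shows "has_dim K ((*) y ` V) ((*) y ` W) d"
proof -
  obtain b where b_in_V: "\<forall>i<d. b i \<in> V" and b_indep: "lin_indep_mod K W {..<d} b"
    and b_spans: "\<forall>z\<in>V. \<exists>c. (\<forall>i<d. c i \<in> K) \<and> z - (\<Sum>i<d. c i * b i) \<in> W"
    using has_dim_V by (rule has_dimE)
  have sum_times: "(\<Sum>i<d. c i * (y * b i)) = y * (\<Sum>i<d. c i * b i)" for c
    by (simp add: sum_distrib_left mult.left_commute)
  have times_mem: "y * a \<in> (*) y ` W \<longleftrightarrow> a \<in> W" for a
    using assms(1) by auto
  show ?thesis
  proof (rule has_dimI[where b = "\<lambda>i. y * b i"])
    show "lin_indep_mod K ((*) y ` W) {..<d} (\<lambda>i. y * b i)"
      using b_indep unfolding lin_indep_mod_def sum_times times_mem .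
    show "\<exists>c. (\<forall>i<d. c i \<in> K) \<and> z - (\<Sum>i<d. c i * (y * b i)) \<in> (*) y ` W" if "z \<in> (*) y ` V" for z
    proof -
      obtain a where "z = y * a" "a \<in> V"
        using \<open>z \<in> (*) y ` V\<close> by blast
      then show ?thesis
        using b_spans unfolding sum_times by (simp add: times_mem flip: right_diff_distrib)
    qed
  qed (use b_in_V in blast)
qed

lemma finite_if_has_dim:
  assumes "finite K" "has_dim K V {0} d"
  shows "finite V"
proof -
  obtain b where b_spans: "\<forall>z\<in>V. \<exists>c. (\<forall>i<d. c i \<in> K) \<and> z - (\<Sum>i<d. c i * b i) \<in> {0}"
    using assms(2) by (rule has_dimE)
  have "V \<subseteq> (\<lambda>c. \<Sum>i<d. c i * b i) ` PiE {..<d} (\<lambda>_. K)"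
  proof
    fix z assume "z \<in> V"
    then obtain c where "\<forall>i<d. c i \<in> K" "z - (\<Sum>i<d. c i * b i) \<in> {0}"
      using b_spans by blast
    then show "z \<in> (\<lambda>c. \<Sum>i<d. c i * b i) ` PiE {..<d} (\<lambda>_. K)"
      by (intro image_eqI[of _ _ "restrict c {..<d}"]) auto
  qed
  then show ?thesis
    using assms(1) by (meson finite_PiE finite_imageI finite_lessThan finite_subset)
qed

lemma sum_lessThan_append:
  fixes b c k :: "nat \<Rightarrow> 'f::field"
  shows "(\<Sum>i<d + e. k i * (if i < d then b i else c (i - d))) =
    (\<Sum>i<d. k i * b i) + (\<Sum>i<e. k (d + i) * c i)"
  by (induction e) (auto simp: algebra_simps)

locale base_field =
  fixes K :: "'f::field set"
  assumes subfield: "subfield K"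
begin

lemma subring_K: "subring K"
  using subfield unfolding subfield_def subring_def by blast

lemmas K_0 = subring_0[OF subring_K]
  and K_1 = subring_1[OF subring_K]
  and K_add = subring_add[OF subring_K]
  and K_mult = subring_mult[OF subring_K]
  and K_uminus = subring_uminus[OF subring_K]
  and K_diff = subring_diff[OF subring_K]
  and K_sum = subring_sum[OF subring_K]

lemma K_inverse: "a \<in> K \<Longrightarrow> inverse a \<in> K"
  using subfield unfolding subfield_def by blast

lemma K_divide: "a \<in> K \<Longrightarrow> b \<in> K \<Longrightarrow> a / b \<in> K"
  by (simp add: divide_inverse K_inverse K_mult)

lemma submodule_uminus: "submodule K V \<Longrightarrow> a \<in> V \<Longrightarrow> - a \<in> V"
  using submodule_smult[of K V "- 1" a] K_1 K_uminus by simp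

lemma submodule_diff: "submodule K V \<Longrightarrow> a \<in> V \<Longrightarrow> b \<in> V \<Longrightarrow> a - b \<in> V"
  using submodule_uminus[of V b] submodule_add[of K V a "- b"] by simp

lemma sum_back_substitution:
  fixes a :: "'i \<Rightarrow> 'k \<Rightarrow> 'f" and c :: "'i \<Rightarrow> 'f" and k :: 'k
  assumes "finite A" "p \<in> A"
  defines "s \<equiv> \<Sum>i\<in>A - {p}. c i * (a i k / a p k)"
  shows "(\<Sum>i\<in>A. (c(p := - s)) i * a i j) = (\<Sum>i\<in>A - {p}. c i * (a i j - a i k / a p k * a p j))"
proof -
  have "(\<Sum>i\<in>A. (c(p := - s)) i * a i j) = - s * a p j + (\<Sum>i\<in>A - {p}. c i * a i j)"
    using assms(1,2) by (simp add: sum.remove)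
  then show ?thesis
    by (simp add: s_def right_diff_distrib sum_subtractf sum_distrib_right mult.assoc)
qed

lemma homogeneous_system_nontrivial_solution:
  fixes a :: "'i \<Rightarrow> 'k \<Rightarrow> 'f"
  assumes "finite B" "finite A" "card B < card A" "\<And>i k. i \<in> A \<Longrightarrow> k \<in> B \<Longrightarrow> a i k \<in> K"
  shows "\<exists>c. (\<forall>i\<in>A. c i \<in> K) \<and> (\<exists>i\<in>A. c i \<noteq> 0) \<and> (\<forall>k\<in>B. (\<Sum>i\<in>A. c i * a i k) = 0)"
  using assms
proof (induction B arbitrary: A a rule: finite_induct)
  case empty
  then show ?case
    using K_1 by (intro exI[of _ "\<lambda>_. 1"]) (auto simp: card_gt_0_iff)
next
  case (insert k B)
  show ?case
  proof (cases "\<forall>i\<in>A. a i k = 0")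
    case True
    have "\<exists>c. (\<forall>i\<in>A. c i \<in> K) \<and> (\<exists>i\<in>A. c i \<noteq> 0) \<and> (\<forall>k\<in>B. (\<Sum>i\<in>A. c i * a i k) = 0)"
      using insert by (intro insert.IH) auto
    then obtain c where "\<forall>i\<in>A. c i \<in> K" "\<exists>i\<in>A. c i \<noteq> 0" "\<forall>k\<in>B. (\<Sum>i\<in>A. c i * a i k) = 0"
      by blast
    then show ?thesis
      using True by (intro exI[of _ c]) auto
  next
    case False
    then obtain p where p_in_A: "p \<in> A" and pivot_nonzero: "a p k \<noteq> 0"
      by blast
    define a' where "a' i j = a i j - a i k / a p k * a p j" for i j
    have "\<exists>c. (\<forall>i\<in>A - {p}. c i \<in> K) \<and> (\<exists>i\<in>A - {p}. c i \<noteq> 0) \<and>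
        (\<forall>j\<in>B. (\<Sum>i\<in>A - {p}. c i * a' i j) = 0)"
      using insert.prems insert.hyps p_in_A pivot_nonzero
      by (intro insert.IH) (auto simp: a'_def intro!: K_diff K_mult K_divide)
    then obtain c where c_in_K: "\<forall>i\<in>A - {p}. c i \<in> K" and c_nonzero: "\<exists>i\<in>A - {p}. c i \<noteq> 0"
      and c_solves: "\<forall>j\<in>B. (\<Sum>i\<in>A - {p}. c i * a' i j) = 0"
      by blast
    define s where "s = (\<Sum>i\<in>A - {p}. c i * (a i k / a p k))"
    have "s \<in> K"
      unfolding s_def using c_in_K insert.prems(3) p_in_A by (intro K_sum K_mult K_divide) auto
    moreover have "(\<Sum>i\<in>A. (c(p := - s)) i * a i j) = (\<Sum>i\<in>A - {p}. c i * a' i j)" for j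
      unfolding s_def a'_def using insert.prems(1) p_in_A by (rule sum_back_substitution)
    then have "\<forall>j\<in>insert k B. (\<Sum>i\<in>A. (c(p := - s)) i * a i j) = 0"
      using c_solves pivot_nonzero by (simp add: a'_def)
    ultimately show ?thesis
      using c_in_K c_nonzero by (intro exI[of _ "c(p := - s)"]) (auto simp: K_uminus)
  qed
qed

lemma card_lin_indep_le_card_spans:
  assumes submodule_W: "submodule K W" and finite_A: "finite A" and finite_B: "finite B"
    and b_indep: "lin_indep_mod K W A b" and b_in_V: "\<And>i. i \<in> A \<Longrightarrow> b i \<in> V"
    and spans: "spans_mod K V W B v"
  shows "card A \<le> card B"
proof (rule ccontr)
  assume card_less: "\<not> card A \<le> card B"
  have "\<forall>i\<in>A. \<exists>c. (\<forall>j\<in>B. c j \<in> K) \<and> b i - (\<Sum>j\<in>B. c j * v j) \<in> W"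
    using spans b_in_V unfolding spans_mod_def by blast
  then obtain a where a_in_K: "\<And>i j. i \<in> A \<Longrightarrow> j \<in> B \<Longrightarrow> a i j \<in> K"
    and expansion_in_W: "\<And>i. i \<in> A \<Longrightarrow> b i - (\<Sum>j\<in>B. a i j * v j) \<in> W"
    by (metis bchoice)
  obtain c where c_in_K: "\<forall>i\<in>A. c i \<in> K" and c_nonzero: "\<exists>i\<in>A. c i \<noteq> 0"
    and c_solves: "\<forall>j\<in>B. (\<Sum>i\<in>A. c i * a i j) = 0"
    using homogeneous_system_nontrivial_solution[OF finite_B finite_A, of a] a_in_K card_less by auto
  have "(\<Sum>i\<in>A. \<Sum>j\<in>B. c i * a i j * v j) = (\<Sum>j\<in>B. (\<Sum>i\<in>A. c i * a i j) * v j)"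
    by (subst sum.swap) (simp add: sum_distrib_right)
  then have "(\<Sum>i\<in>A. c i * b i) = (\<Sum>i\<in>A. c i * (b i - (\<Sum>j\<in>B. a i j * v j)))"
    using c_solves by (simp add: right_diff_distrib sum_subtractf sum_distrib_left mult.assoc)
  also have "\<dots> \<in> W"
    using expansion_in_W c_in_K by (intro submodule_lincomb[OF submodule_W]) auto
  finally show False
    using b_indep c_in_K c_nonzero unfolding lin_indep_mod_def by blast
qed

lemma card_lin_indep_le_dim:
  assumes "submodule K W" "has_dim K V W d" "finite A" "\<And>i. i \<in> A \<Longrightarrow> b i \<in> V" "lin_indep_mod K W A b"
  shows "card A \<le> d"
  using assms(2) card_lin_indep_le_card_spans[OF assms(1,3) finite_lessThan assms(5,4)]
  unfolding has_dim_def by (metis card_lessThan)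

lemma has_dim_unique:
  assumes "submodule K W" "has_dim K V W d" "has_dim K V W e"
  shows "d = e"
proof -
  have "d \<le> e" if "has_dim K V W d" "has_dim K V W e" for d e
    using that(1) card_lin_indep_le_dim[OF assms(1) that(2), of "{..<d}"]
    unfolding has_dim_def by (metis card_lessThan finite_lessThan lessThan_iff)
  then show ?thesis
    using assms(2,3) by (intro antisym)
qed

lemma lin_indep_mod_extend:
  assumes submodule_W: "submodule K W" and b_indep: "lin_indep_mod K W {..<d} b"
    and notin: "\<And>c. (\<And>i. i < d \<Longrightarrow> c i \<in> K) \<Longrightarrow> z - (\<Sum>i<d. c i * b i) \<notin> W"
  shows "lin_indep_mod K W {..<Suc d} (b(d := z))"
proof (rule lin_indep_modI)
  fix c i assume c_in_K: "\<And>j. j \<in> {..<Suc d} \<Longrightarrow> c j \<in> K"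
    and lincomb_in_W: "(\<Sum>j<Suc d. c j * (b(d := z)) j) \<in> W" and i_less_Suc_d: "i \<in> {..<Suc d}"
  have relation_in_W: "(\<Sum>j<d. c j * b j) + c d * z \<in> W"
    using lincomb_in_W by simp
  have "c d = 0"
  proof (rule ccontr)
    assume nonzero: "c d \<noteq> 0"
    have "inverse (c d) * ((\<Sum>j<d. c j * b j) + c d * z) \<in> W"
      using relation_in_W c_in_K by (intro submodule_smult[OF submodule_W] K_inverse) auto
    moreover have "inverse (c d) * ((\<Sum>j<d. c j * b j) + c d * z) =
        z - (\<Sum>j<d. (- inverse (c d) * c j) * b j)"
      using nonzero by (simp add: sum_negf sum_distrib_left algebra_simps)
    moreover have "- inverse (c d) * c j \<in> K" if "j < d" for j
      using c_in_K that by (intro K_mult K_uminus K_inverse) auto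
    ultimately show False
      using notin[of "\<lambda>j. - inverse (c d) * c j"] by simp
  qed
  then show "c i = 0"
    using lin_indep_modD[OF b_indep, of c i] relation_in_W c_in_K i_less_Suc_d by (cases "i = d") auto
qed

lemma has_dim_exists_if_bounded:
  assumes submodule_W: "submodule K W"
    and le_N_if_indep: "\<And>d (b :: nat \<Rightarrow> 'f). (\<And>i. i < d \<Longrightarrow> b i \<in> V) \<Longrightarrow> lin_indep_mod K W {..<d} b \<Longrightarrow> d \<le> N"
  shows "\<exists>d\<le>N. has_dim K V W d"
proof -
  define indep_of_size where
    "indep_of_size d \<longleftrightarrow> (\<exists>b :: nat \<Rightarrow> 'f. (\<forall>i<d. b i \<in> V) \<and> lin_indep_mod K W {..<d} b)" for d
  have le_N: "d \<le> N" if "indep_of_size d" for d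
    using that le_N_if_indep unfolding indep_of_size_def by blast
  have "indep_of_size 0"
    unfolding indep_of_size_def lin_indep_mod_def by auto
  then obtain d where indep_of_size_d: "indep_of_size d" and d_maximal: "\<And>e. indep_of_size e \<Longrightarrow> e \<le> d"
    using le_N by (metis GreatestI_nat Greatest_le_nat)
  then obtain b :: "nat \<Rightarrow> 'f" where b_in_V: "\<And>i. i < d \<Longrightarrow> b i \<in> V"
    and b_indep: "lin_indep_mod K W {..<d} b"
    unfolding indep_of_size_def by blast
  have "spans_mod K V W {..<d} b"
    unfolding spans_mod_def
  proof (intro ballI, rule ccontr)
    fix z assume z_in_V: "z \<in> V" and "\<nexists>c. (\<forall>i\<in>{..<d}. c i \<in> K) \<and> z - (\<Sum>i<d. c i * b i) \<in> W"
    then have "lin_indep_mod K W {..<Suc d} (b(d := z))"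
      by (intro lin_indep_mod_extend[OF submodule_W b_indep]) auto
    moreover have "\<forall>i<Suc d. (b(d := z)) i \<in> V"
      using b_in_V z_in_V by (auto simp: less_Suc_eq)
    ultimately have "indep_of_size (Suc d)"
      unfolding indep_of_size_def by blast
    then show False
      using d_maximal by fastforce
  qed
  then show ?thesis
    using b_in_V b_indep indep_of_size_d le_N unfolding has_dim_def by blast
qed

lemma has_dim_exists_if_spans:
  assumes "submodule K W" "finite B" "spans_mod K V W B v"
  shows "\<exists>d\<le>card B. has_dim K V W d"
proof (rule has_dim_exists_if_bounded[OF assms(1)])
  fix d and b :: "nat \<Rightarrow> 'f" assume "\<And>i. i < d \<Longrightarrow> b i \<in> V" "lin_indep_mod K W {..<d} b"
  then show "d \<le> card B"
    using card_lin_indep_le_card_spans[OF assms(1) _ assms(2) _ _ assms(3), of "{..<d}" b] by simp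
qed

lemma has_dim_embed:
  assumes submodule_V: "submodule K V" and submodule_W: "submodule K W"
    and submodule_W': "submodule K W'"
    and has_dim_V': "has_dim K V' W' d" and V_subset_V': "V \<subseteq> V'" and V_Int_W'_subset_W: "V \<inter> W' \<subseteq> W"
  shows "\<exists>e\<le>d. has_dim K V W e"
proof (rule has_dim_exists_if_bounded[OF submodule_W])
  fix e and b :: "nat \<Rightarrow> 'f" assume b_in_V: "\<And>i. i < e \<Longrightarrow> b i \<in> V"
    and b_indep: "lin_indep_mod K W {..<e} b"
  have "lin_indep_mod K W' {..<e} b"
  proof (rule lin_indep_modI)
    fix c i assume c_in_K: "\<And>j. j \<in> {..<e} \<Longrightarrow> c j \<in> K" and lincomb_in_W': "(\<Sum>j<e. c j * b j) \<in> W'"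
      and i_less_e: "i \<in> {..<e}"
    then have "(\<Sum>j<e. c j * b j) \<in> W"
      using V_Int_W'_subset_W submodule_lincomb[OF submodule_V, of "{..<e}" b c] b_in_V by auto
    then show "c i = 0"
      using lin_indep_modD[OF b_indep] c_in_K lincomb_in_W' i_less_e by blast
  qed
  then show "e \<le> d"
    using card_lin_indep_le_dim[OF submodule_W' has_dim_V', of "{..<e}" b] b_in_V V_subset_V' by auto
qed

lemma lin_indep_mod_append:
  fixes b c :: "nat \<Rightarrow> 'f"
  assumes submodule_W: "submodule K W" and U_subset_W: "U \<subseteq> W" and c_in: "\<forall>i<e. c i \<in> W"
    and b_indep: "lin_indep_mod K W {..<d} b" and c_indep: "lin_indep_mod K U {..<e} c"
  shows "lin_indep_mod K U {..<d + e} (\<lambda>i. if i < d then b i else c (i - d))"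
  unfolding lin_indep_mod_def sum_lessThan_append
proof (intro allI impI)
  fix k assume k_in_K: "\<forall>i\<in>{..<d + e}. k i \<in> K"
    and lincomb_in_U: "(\<Sum>i<d. k i * b i) + (\<Sum>i<e. k (d + i) * c i) \<in> U"
  have "(\<Sum>i<e. k (d + i) * c i) \<in> W"
    using k_in_K c_in by (intro submodule_lincomb[OF submodule_W]) auto
  then have "(\<Sum>i<d. k i * b i) \<in> W"
    using submodule_diff[OF submodule_W] lincomb_in_U U_subset_W by fastforce
  then have k_eq_0_below_d: "k i = 0" if "i < d" for i
    using lin_indep_modD[OF b_indep, of k i] k_in_K that by auto
  then have "k (d + i) = 0" if "i < e" for i
    using lin_indep_modD[OF c_indep, of "\<lambda>i. k (d + i)" i] k_in_K lincomb_in_U that by auto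
  then show "\<forall>i\<in>{..<d + e}. k i = 0"
    using k_eq_0_below_d by (metis add_diff_inverse_nat lessThan_iff nat_add_left_cancel_less)
qed

lemma has_dim_trans:
  assumes submodule_W: "submodule K W" and U_subset_W: "U \<subseteq> W" and W_subset_V: "W \<subseteq> V"
    and has_dim_V: "has_dim K V W d" and has_dim_W: "has_dim K W U e"
  shows "has_dim K V U (d + e)"
proof -
  obtain b where b_in_V: "\<forall>i<d. b i \<in> V" and b_indep: "lin_indep_mod K W {..<d} b"
    and b_spans: "\<forall>z\<in>V. \<exists>k. (\<forall>i<d. k i \<in> K) \<and> z - (\<Sum>i<d. k i * b i) \<in> W"
    using has_dim_V by (rule has_dimE)
  obtain c where c_in_W: "\<forall>i<e. c i \<in> W" and c_indep: "lin_indep_mod K U {..<e} c"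
    and c_spans: "\<forall>z\<in>W. \<exists>l. (\<forall>i<e. l i \<in> K) \<and> z - (\<Sum>i<e. l i * c i) \<in> U"
    using has_dim_W by (rule has_dimE)
  let ?b = "\<lambda>i. if i < d then b i else c (i - d)"
  show ?thesis
  proof (rule has_dimI[where b = ?b], goal_cases in_V indep spans)
    case (in_V i)
    then show ?case
      using b_in_V c_in_W W_subset_V by auto
  next
    case indep
    show ?case
      by (rule lin_indep_mod_append[OF submodule_W U_subset_W c_in_W b_indep c_indep])
  next
    case (spans z)
    then obtain k where k_in_K: "\<forall>i<d. k i \<in> K" and remainder_in_W: "z - (\<Sum>i<d. k i * b i) \<in> W"
      using b_spans by blast
    then obtain l where l_in_K: "\<forall>i<e. l i \<in> K"
      and remainder_in_U: "z - (\<Sum>i<d. k i * b i) - (\<Sum>i<e. l i * c i) \<in> U"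
      using c_spans by blast
    show ?case
      unfolding sum_lessThan_append using k_in_K remainder_in_W l_in_K remainder_in_U
      by (intro exI[of _ "\<lambda>i. if i < d then k i else l (i - d)"]) (auto simp: diff_diff_eq)
  qed
qed

text \<open>The second isomorphism theorem.\<close>
lemma has_dim_Int:
  assumes submodule_V: "submodule K V" and submodule_W: "submodule K W" and "V \<subseteq> V'"
    and represented_in_V: "\<And>z. z \<in> V' \<Longrightarrow> \<exists>v\<in>V. z - v \<in> W" and has_dim_V': "has_dim K V' W d"
  shows "has_dim K V (V \<inter> W) d"
proof -
  obtain b where b_in_V': "\<forall>i<d. b i \<in> V'" and b_indep: "lin_indep_mod K W {..<d} b"
    and b_spans: "\<forall>z\<in>V'. \<exists>c. (\<forall>i<d. c i \<in> K) \<and> z - (\<Sum>i<d. c i * b i) \<in> W"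
    using has_dim_V' by (rule has_dimE)
  have "\<forall>i. \<exists>v. i < d \<longrightarrow> v \<in> V \<and> b i - v \<in> W"
    using represented_in_V b_in_V' by blast
  then obtain v where v_in_V: "\<And>i. i < d \<Longrightarrow> v i \<in> V" and b_minus_v_in_W: "\<And>i. i < d \<Longrightarrow> b i - v i \<in> W"
    by metis
  have v_comb: "(\<Sum>i<d. c i * v i) \<in> V" and diff_comb: "(\<Sum>i<d. c i * (b i - v i)) \<in> W"
    if "\<And>i. i < d \<Longrightarrow> c i \<in> K" for c
    using that v_in_V b_minus_v_in_W by (auto intro!: submodule_lincomb submodule_V submodule_W)
  have comb_eq: "(\<Sum>i<d. c i * b i) = (\<Sum>i<d. c i * v i) + (\<Sum>i<d. c i * (b i - v i))" for c
    by (simp add: right_diff_distrib sum_subtractf)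
  show ?thesis
  proof (rule has_dimI[where b = v])
    show "lin_indep_mod K (V \<inter> W) {..<d} v"
    proof (rule lin_indep_modI)
      fix c i assume c_in_K: "\<And>j. j \<in> {..<d} \<Longrightarrow> c j \<in> K"
        and lincomb_in_V_Int_W: "(\<Sum>j<d. c j * v j) \<in> V \<inter> W" and i_less_d: "i \<in> {..<d}"
      then have "(\<Sum>j<d. c j * b j) \<in> W"
        unfolding comb_eq using diff_comb[of c] by (auto intro: submodule_add[OF submodule_W])
      then show "c i = 0"
        using lin_indep_modD[OF b_indep] c_in_K lincomb_in_V_Int_W i_less_d by blast
    qed
  next
    fix z assume z_in_V: "z \<in> V"
    then obtain c where c_in_K: "\<forall>i<d. c i \<in> K" and remainder_in_W: "z - (\<Sum>i<d. c i * b i) \<in> W"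
      using b_spans \<open>V \<subseteq> V'\<close> by blast
    have "z - (\<Sum>i<d. c i * b i) + (\<Sum>i<d. c i * (b i - v i)) \<in> W"
      using c_in_K remainder_in_W by (intro submodule_add[OF submodule_W] diff_comb) auto
    moreover have "z - (\<Sum>i<d. c i * v i) \<in> V"
      using c_in_K by (intro submodule_diff[OF submodule_V z_in_V] v_comb) auto
    ultimately show "\<exists>c. (\<forall>i<d. c i \<in> K) \<and> z - (\<Sum>i<d. c i * v i) \<in> V \<inter> W"
      using c_in_K unfolding comb_eq by auto
  qed (rule v_in_V)
qed

lemma lin_indep_mod_notin_set_plus_lincombs:
  assumes b_indep: "lin_indep_mod K W A b" and "finite A" "i \<in> A"
  shows "b i \<notin> W + lincombs K (A - {i}) b"
proof
  assume "b i \<in> W + lincombs K (A - {i}) b"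
  then obtain w c where "w \<in> W" and c_in_K: "\<forall>j\<in>A - {i}. c j \<in> K"
    and "b i = w + (\<Sum>j\<in>A - {i}. c j * b j)"
    by (elim set_plus_elim lincombsE) (simp only:)
  define c' where "c' j = (if j = i then 1 else - c j)" for j
  have "(\<Sum>j\<in>A. c' j * b j) = b i - (\<Sum>j\<in>A - {i}. c j * b j)"
    using assms(2,3) by (simp add: sum.remove c'_def sum_negf)
  also have "\<dots> \<in> W"
    using \<open>w \<in> W\<close> \<open>b i = _\<close> by simp
  finally have "c' i = 0"
    using c_in_K \<open>i \<in> A\<close> by (intro lin_indep_modD[OF b_indep]) (auto simp: c'_def K_1 K_uminus)
  then show False
    by (simp add: c'_def)
qed

lemma hyperplane_exists:
  assumes submodule_W: "submodule K W" and has_dim_V: "has_dim K V W d" and d_pos: "d > 0"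
  obtains H b where "submodule K H" "W \<subseteq> H" "b \<in> V" "b \<notin> H" "\<And>z. z \<in> V \<Longrightarrow> \<exists>c\<in>K. z - c * b \<in> H"
proof -
  obtain b where b_in_V: "\<forall>i<d. b i \<in> V" and b_indep: "lin_indep_mod K W {..<d} b"
    and b_spans: "\<forall>z\<in>V. \<exists>c. (\<forall>i<d. c i \<in> K) \<and> z - (\<Sum>i<d. c i * b i) \<in> W"
    using has_dim_V by (rule has_dimE)
  define H where "H = W + lincombs K ({..<d} - {0}) b"
  have submodule_lincombs_tail: "submodule K (lincombs K ({..<d} - {0}) b)"
    by (rule submodule_lincombs[OF subring_K])
  have "submodule K H"
    unfolding H_def by (rule submodule_set_plus[OF submodule_W submodule_lincombs_tail])
  moreover have "W \<subseteq> H"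
    unfolding H_def using set_zero_plus2[OF submodule_0[OF submodule_lincombs_tail], of W]
    by (simp add: add.commute)
  moreover have "b 0 \<notin> H"
    unfolding H_def using d_pos by (intro lin_indep_mod_notin_set_plus_lincombs[OF b_indep]) auto
  moreover have "\<exists>c\<in>K. z - c * b 0 \<in> H" if z_in_V: "z \<in> V" for z
  proof -
    obtain c where c_in_K: "\<forall>i<d. c i \<in> K" and "z - (\<Sum>i<d. c i * b i) \<in> W"
      using b_spans z_in_V by blast
    then have "(z - (\<Sum>i<d. c i * b i)) + (\<Sum>i\<in>{..<d} - {0}. c i * b i) \<in> H"
      unfolding H_def by (intro set_plus_intro lincombsI) auto
    then show ?thesis
      using c_in_K d_pos by (intro bexI[of _ "c 0"]) (auto simp: sum.remove[of _ 0])
  qed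
  ultimately show thesis
    using that b_in_V d_pos by blast
qed

lemma kdim_eq:
  assumes submodule_V: "submodule K V" and has_dim_V: "has_dim K V {0} d"
  shows "kdim K V = d"
proof -
  have "(\<exists>b. (\<forall>i<d. b i \<in> V) \<and>
      (\<forall>c. (\<forall>i<d. c i \<in> K) \<longrightarrow> (\<Sum>i<d. c i * b i) = 0 \<longrightarrow> (\<forall>i<d. c i = 0)) \<and>
      V = {\<Sum>i<d. c i * b i | c. \<forall>i<d. c i \<in> K}) \<longleftrightarrow> has_dim K V {0} d" for d
    unfolding has_dim_def lin_indep_mod_def spans_mod_def
  proof (intro ex_cong1 conj_cong refl)
    fix b :: "nat \<Rightarrow> 'f" assume b_in_V: "\<forall>i<d. b i \<in> V"
    have "{\<Sum>i<d. c i * b i | c. \<forall>i<d. c i \<in> K} \<subseteq> V"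
      using b_in_V by (auto intro!: submodule_lincomb[OF submodule_V])
    then show "(V = {\<Sum>i<d. c i * b i | c. \<forall>i<d. c i \<in> K}) =
      (\<forall>z\<in>V. \<exists>c. (\<forall>i\<in>{..<d}. c i \<in> K) \<and> z - (\<Sum>i<d. c i * b i) \<in> {0})"
      by (simp add: set_eq_iff subset_iff Ball_def) blast
  qed auto
  then show ?thesis
    unfolding kdim_def using has_dim_V has_dim_unique[OF submodule_singleton_0]
    by (simp add: the_equality)
qed

lemma place_degree_eq:
  assumes "submodule K (max_ideal R)" and has_dim_R: "has_dim K R (max_ideal R) d"
  shows "place_degree K R = d"
proof -
  have "place_degree K R = (THE d. has_dim K R (max_ideal R) d)"
    unfolding place_degree_def has_dim_def lin_indep_mod_def spans_mod_def Ball_def lessThan_iff ..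
  then show ?thesis
    using has_dim_R has_dim_unique[OF assms(1)] by auto
qed

end

section \<open>Polynomial and rational expressions in one element\<close>

definition polys_over :: "'f::field set \<Rightarrow> 'f \<Rightarrow> 'f set" where
  "polys_over S y = {poly p y | p. \<forall>k. coeff p k \<in> S}"

lemma polys_overI: "(\<And>k. coeff p k \<in> S) \<Longrightarrow> poly p y \<in> polys_over S y"
  unfolding polys_over_def by blast

lemma polys_overE:
  assumes "z \<in> polys_over S y"
  obtains p where "\<forall>k. coeff p k \<in> S" "z = poly p y"
  using assms unfolding polys_over_def by blast

lemma subset_polys_over: "subring S \<Longrightarrow> S \<subseteq> polys_over S y"
  using polys_overI[of "[:_:]" S y] by (auto simp: coeff_pCons subring_0 split: nat.splits)

lemma self_in_polys_over: "subring S \<Longrightarrow> y \<in> polys_over S y"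
  using polys_overI[of "[:0, 1:]" S y] by (auto simp: coeff_pCons subring_0 subring_1 split: nat.splits)

lemma polys_over_subset: "subring T \<Longrightarrow> S \<subseteq> T \<Longrightarrow> y \<in> T \<Longrightarrow> polys_over S y \<subseteq> T"
  unfolding polys_over_def poly_altdef by (auto intro!: subring_sum subring_mult subring_power)

lemma subring_polys_over:
  assumes subring_S: "subring S"
  shows "subring (polys_over S y)"
proof -
  have "a + b \<in> polys_over S y \<and> a * b \<in> polys_over S y \<and> - a \<in> polys_over S y"
    if "a \<in> polys_over S y" "b \<in> polys_over S y" for a b
  proof -
    obtain p q where coeff_p_in_S: "\<forall>k. coeff p k \<in> S" and a_eq: "a = poly p y"
      and coeff_q_in_S: "\<forall>k. coeff q k \<in> S" and b_eq: "b = poly q y"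
      using \<open>a \<in> _\<close> \<open>b \<in> _\<close> by (elim polys_overE)
    have "coeff (p + q) k \<in> S" "coeff (p * q) k \<in> S" "coeff (- p) k \<in> S" for k
      using coeff_p_in_S coeff_q_in_S subring_S by (auto simp: coeff_mult intro!: subring_closed)
    then show ?thesis
      using polys_overI[of "p + q" S y] polys_overI[of "p * q" S y] polys_overI[of "- p" S y] a_eq b_eq
      by simp
  qed
  then show ?thesis
    unfolding subring_def[of "polys_over S y"]
    using subset_polys_over[OF subring_S] subring_0[OF subring_S] subring_1[OF subring_S] by blast
qed

lemma polys_over_imp_lincombs_powers:
  assumes "z \<in> polys_over S y"
  shows "\<exists>n. z \<in> lincombs S {..<n} (\<lambda>i. y ^ i)"
proof -
  obtain p where "\<forall>k. coeff p k \<in> S" "z = poly p y"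
    using assms by (rule polys_overE)
  then have "z \<in> lincombs S {..<Suc (degree p)} (\<lambda>i. y ^ i)"
    unfolding poly_altdef lessThan_Suc_atMost by (auto intro: lincombsI)
  then show ?thesis ..
qed

lemma poly_eq_sum_atMost:
  fixes y :: "'f::field"
  assumes "degree p \<le> n"
  shows "poly p y = (\<Sum>i\<le>n. coeff p i * y ^ i)"
proof -
  have "poly (\<Sum>i\<le>n. monom (coeff p i) i) y = (\<Sum>i\<le>n. coeff p i * y ^ i)"
    by (simp add: poly_sum poly_monom)
  then show ?thesis
    using assms by (simp add: poly_as_sum_of_monoms')
qed

lemma lin_indep_polys_over:
  assumes "finite A" and monomials_indep: "\<And>m. lin_indep K ({..m} \<times> A) (\<lambda>(j, k). y ^ j * u k)"
  shows "lin_indep (polys_over K y) A u"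
proof (rule lin_indep_modI)
  fix c i assume c_in_polys_over: "\<And>k. k \<in> A \<Longrightarrow> c k \<in> polys_over K y"
    and lincomb_in_0: "(\<Sum>k\<in>A. c k * u k) \<in> {0}" and i_in_A: "i \<in> A"
  have "\<forall>k. \<exists>p. k \<in> A \<longrightarrow> (\<forall>j. coeff p j \<in> K) \<and> c k = poly p y"
    using c_in_polys_over by (meson polys_overE)
  then obtain p where coeff_in_K: "\<And>k j. k \<in> A \<Longrightarrow> coeff (p k) j \<in> K"
    and c_k_eq: "\<And>k. k \<in> A \<Longrightarrow> c k = poly (p k) y"
    by metis
  define m where "m = (\<Sum>k\<in>A. degree (p k))"
  have "(\<Sum>k\<in>A. c k * u k) = (\<Sum>k\<in>A. \<Sum>j\<le>m. coeff (p k) j * (y ^ j * u k))"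
  proof (rule sum.cong[OF refl])
    fix k assume k_in_A: "k \<in> A"
    then have "degree (p k) \<le> m"
      unfolding m_def using assms(1) by (intro member_le_sum) auto
    then show "c k * u k = (\<Sum>j\<le>m. coeff (p k) j * (y ^ j * u k))"
      using c_k_eq[OF k_in_A] by (simp add: poly_eq_sum_atMost sum_distrib_right mult.assoc)
  qed
  also have "\<dots> = (\<Sum>i\<in>{..m} \<times> A. coeff (p (snd i)) (fst i) * (case i of (j, k) \<Rightarrow> y ^ j * u k))"
    by (subst sum.swap) (simp add: sum.cartesian_product split_def)
  finally have "(\<Sum>i\<in>{..m} \<times> A. coeff (p (snd i)) (fst i) * (case i of (j, k) \<Rightarrow> y ^ j * u k)) \<in> {0}"
    using lincomb_in_0 by simp
  then have "coeff (p i) j = 0" if "j \<le> m" for j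
    using lin_indep_modD[OF monomials_indep, of m "\<lambda>i. coeff (p (snd i)) (fst i)" "(j, i)"] coeff_in_K
      i_in_A that by auto
  moreover have "degree (p i) \<le> m"
    unfolding m_def using assms(1) i_in_A by (intro member_le_sum) auto
  ultimately have "p i = 0"
    by (metis leading_coeff_0_iff)
  then show "c i = 0"
    using c_k_eq i_in_A by simp
qed

lemma spans_mod_tower:
  assumes v_spans: "spans_mod K E {0} A v" and u_spans: "spans_mod E V {0} B u"
  shows "spans_mod K V {0} (A \<times> B) (\<lambda>(i, j). v i * u j)"
  unfolding spans_mod_0_iff
proof
  fix z assume "z \<in> V"
  then have "z \<in> lincombs E B u"
    using u_spans unfolding spans_mod_0_iff by blast
  then obtain e where e_in_E: "\<forall>j\<in>B. e j \<in> E" and z_eq: "z = (\<Sum>j\<in>B. e j * u j)"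
    by (rule lincombsE)
  have "\<forall>j\<in>B. \<exists>c. (\<forall>i\<in>A. c i \<in> K) \<and> e j = (\<Sum>i\<in>A. c i * v i)"
    using v_spans e_in_E unfolding spans_mod_0_iff lincombs_def by blast
  then obtain c where c_in_K: "\<And>i j. j \<in> B \<Longrightarrow> i \<in> A \<Longrightarrow> c j i \<in> K"
    and e_j_eq: "\<And>j. j \<in> B \<Longrightarrow> e j = (\<Sum>i\<in>A. c j i * v i)"
    by (metis bchoice)
  have "z = (\<Sum>j\<in>B. \<Sum>i\<in>A. c j i * (v i * u j))"
    by (simp add: z_eq e_j_eq sum_distrib_right mult.assoc)
  also have "\<dots> = (\<Sum>i\<in>A \<times> B. c (snd i) (fst i) * (case i of (i, j) \<Rightarrow> v i * u j))"
    by (subst sum.swap) (simp add: sum.cartesian_product split_def)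
  finally show "z \<in> lincombs K (A \<times> B) (\<lambda>(i, j). v i * u j)"
    using c_in_K by (auto intro!: lincombsI)
qed

context base_field
begin

lemma set_coeffs_subset_iff: "set (coeffs p) \<subseteq> K \<longleftrightarrow> (\<forall>k. coeff p k \<in> K)"
  using range_coeff[of p] K_0 by (metis image_subset_iff insert_subset UNIV_I)

lemma transcendental_overD:
  "transcendental_over K y \<Longrightarrow> (\<And>k. coeff p k \<in> K) \<Longrightarrow> poly p y = 0 \<Longrightarrow> p = 0"
  unfolding transcendental_over_def set_coeffs_subset_iff by blast

lemma not_transcendental_overE:
  assumes "\<not> transcendental_over K y"
  obtains p where "\<forall>k. coeff p k \<in> K" "p \<noteq> 0" "poly p y = 0"
  using assms unfolding transcendental_over_def set_coeffs_subset_iff by blast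

lemma transcendental_over_nonzero: "transcendental_over K y \<Longrightarrow> y \<noteq> 0"
  using transcendental_overD[of y "[:0, 1:]"] K_0 K_1 by (force simp: coeff_pCons split: nat.splits)

lemma lin_indep_monomials:
  assumes transcendental_y: "transcendental_over K y" and u_indep: "lin_indep (polys_over K y) A u"
  shows "lin_indep K ({..m} \<times> A) (\<lambda>(j, k). y ^ j * u k)"
proof (rule lin_indep_modI)
  fix c i
  assume c_in_K: "\<And>i. i \<in> {..m} \<times> A \<Longrightarrow> c i \<in> K"
    and lincomb_in_0: "(\<Sum>i\<in>{..m} \<times> A. c i * (case i of (j, k) \<Rightarrow> y ^ j * u k)) \<in> {0}"
    and i_in_index_set: "i \<in> {..m} \<times> A"
  define p where "p k = (\<Sum>j\<le>m. monom (c (j, k)) j)" for k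
  have coeff_p: "coeff (p k) j = (if j \<le> m then c (j, k) else 0)" for j k
    unfolding p_def by (simp add: coeff_sum)
  then have coeff_p_in: "coeff (p k) j \<in> K" if "k \<in> A" for j k
    using c_in_K that K_0 by auto
  have "(\<Sum>i\<in>{..m} \<times> A. c i * (case i of (j, k) \<Rightarrow> y ^ j * u k)) = (\<Sum>j\<le>m. \<Sum>k\<in>A. c (j, k) * y ^ j * u k)"
    by (simp add: sum.cartesian_product split_def mult.assoc)
  also have "\<dots> = (\<Sum>k\<in>A. poly (p k) y * u k)"
    by (subst sum.swap) (simp add: p_def poly_sum poly_monom sum_distrib_right)
  finally have "poly (p (snd i)) y = 0"
    using lincomb_in_0 i_in_index_set coeff_p_in
    by (intro lin_indep_modD[OF u_indep, of "\<lambda>k. poly (p k) y"]) (auto intro: polys_overI)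
  then have "p (snd i) = 0"
    using transcendental_overD[OF transcendental_y] coeff_p_in i_in_index_set by auto
  then show "c i = 0"
    using coeff_p[of "snd i" "fst i"] i_in_index_set by auto
qed

lemma transcendental_over_iff_lin_indep_powers:
  "transcendental_over K y \<longleftrightarrow> (\<forall>m. lin_indep K {..m} (\<lambda>j. y ^ j))"
proof
  assume transcendental_y: "transcendental_over K y"
  show "\<forall>m. lin_indep K {..m} (\<lambda>j. y ^ j)"
  proof (intro allI lin_indep_modI)
    fix m c i
    assume c_in_K: "\<And>j. j \<in> {..m} \<Longrightarrow> c j \<in> K" and lincomb_in_0: "(\<Sum>j\<le>m. c j * y ^ j) \<in> {0}"
      and i_le_m: "i \<in> {..m}"
    let ?p = "\<Sum>j\<le>m. monom (c j) j"
    have coeff_p: "coeff ?p j = (if j \<le> m then c j else 0)" for j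
      by (simp add: coeff_sum)
    have "?p = 0"
      using c_in_K lincomb_in_0 K_0 coeff_p
      by (intro transcendental_overD[OF transcendental_y]) (auto simp: poly_sum poly_monom)
    then show "c i = 0"
      using coeff_p[of i] i_le_m by simp
  qed
next
  assume powers_indep: "\<forall>m. lin_indep K {..m} (\<lambda>j. y ^ j)"
  show "transcendental_over K y"
  proof (rule ccontr)
    assume "\<not> transcendental_over K y"
    then obtain p where "\<forall>k. coeff p k \<in> K" and p_nonzero: "p \<noteq> 0" and "poly p y = 0"
      by (rule not_transcendental_overE)
    then have "lead_coeff p = 0"
      using powers_indep by (intro lin_indep_modD[of K "{0}" "{..degree p}" "\<lambda>j. y ^ j" "coeff p"])
        (auto simp: poly_altdef)
    then show False
      using p_nonzero by simp
  qed
qed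

lemma not_transcendental_over_if_spans:
  assumes "finite B" "spans_mod K V {0} B v" "\<And>i. y ^ i \<in> V"
  shows "\<not> transcendental_over K y"
proof
  assume "transcendental_over K y"
  then have "lin_indep K {..card B} (\<lambda>j. y ^ j)"
    using transcendental_over_iff_lin_indep_powers by blast
  then have "card {..card B} \<le> card B"
    using card_lin_indep_le_card_spans[OF submodule_singleton_0 _ assms(1) _ _ assms(2)] assms(3)
    by blast
  then show False
    by simp
qed

lemma inverse_in_polys_over_if_root:
  assumes "p \<noteq> 0" "\<forall>k. coeff p k \<in> K" "poly p a = 0"
  shows "inverse a \<in> polys_over K a"
proof (cases "a = 0")
  case True
  then show ?thesis
    using subset_polys_over[OF subring_K] K_0 by auto
next
  case False
  then show ?thesis
    using assms
  proof (induction p)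
    case (pCons c q)
    have c_in_K: "c \<in> K" and coeff_q_in_K: "\<forall>k. coeff q k \<in> K"
      using pCons.prems(3) by (metis coeff_pCons_0) (metis pCons.prems(3) coeff_pCons_Suc)
    show ?case
    proof (cases "c = 0")
      case True
      then show ?thesis
        using pCons coeff_q_in_K by simp
    next
      case c_nonzero: False
      have "a * poly q a = - c"
        using pCons.prems(4) by (simp add: eq_neg_iff_add_eq_0 add.commute)
      then have "inverse a = poly (smult (- inverse c) q) a"
        using c_nonzero pCons.prems(1) by (simp add: field_simps)
      moreover have "\<forall>k. coeff (smult (- inverse c) q) k \<in> K"
        using c_in_K coeff_q_in_K by (auto intro!: K_mult K_uminus K_inverse)
      ultimately show ?thesis
        using polys_overI by metis
    qed
  qed simp
qed

lemma polys_over_subset_lincombs_powers: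
  assumes p_nonzero: "p \<noteq> 0" and coeff_in_K: "\<forall>k. coeff p k \<in> K" and root: "poly p a = 0"
  shows "polys_over K a \<subseteq> lincombs K {..<degree p} (\<lambda>i. a ^ i)"
proof -
  let ?V = "lincombs K {..<degree p} (\<lambda>i. a ^ i)"
  have submodule_V: "submodule K ?V"
    by (rule submodule_lincombs[OF subring_K])
  have small_power_in_V: "a ^ i \<in> ?V" if "i < degree p" for i
    using that by (intro basis_in_lincombs[OF subring_K]) auto
  have power_degree_in_V: "a ^ degree p \<in> ?V"
  proof -
    have "lead_coeff p * a ^ degree p + (\<Sum>i<degree p. coeff p i * a ^ i) = 0"
      using root by (simp add: poly_altdef add.commute flip: lessThan_Suc_atMost)
    then have "a ^ degree p = (\<Sum>i<degree p. (- inverse (lead_coeff p) * coeff p i) * a ^ i)"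
      using p_nonzero by (simp add: sum_negf eq_neg_iff_add_eq_0 mult.assoc flip: sum_distrib_left)
        (simp add: field_simps)
    also have "\<dots> \<in> ?V"
      using coeff_in_K by (intro lincombsI K_mult K_uminus K_inverse) auto
    finally show ?thesis .
  qed
  have times: "a * z \<in> ?V" if z_in_V: "z \<in> ?V" for z
  proof -
    obtain c where c_in_K: "\<forall>i\<in>{..<degree p}. c i \<in> K" and z_eq: "z = (\<Sum>i<degree p. c i * a ^ i)"
      using z_in_V by (rule lincombsE)
    have "a ^ Suc i \<in> ?V" if "i < degree p" for i
      using small_power_in_V[of "Suc i"] power_degree_in_V that by (cases "Suc i = degree p") auto
    then have "(\<Sum>i<degree p. c i * a ^ Suc i) \<in> ?V"
      using c_in_K by (intro submodule_lincomb[OF submodule_V]) auto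
    then show ?thesis
      by (simp add: z_eq sum_distrib_left mult.left_commute)
  qed
  have "degree p > 0"
    using p_nonzero root by (intro gr0I) (auto elim: degree_eq_zeroE)
  then have "a ^ i \<in> ?V" for i
    using small_power_in_V[of 0] times by (induction i) auto
  then show ?thesis
    unfolding polys_over_def poly_altdef by (auto intro!: submodule_lincomb[OF submodule_V])
qed

lemma subfield_polys_over_if_root:
  assumes p_nonzero: "p \<noteq> 0" and coeff_in_K: "\<forall>k. coeff p k \<in> K" and root: "poly p a = 0"
  shows "subfield (polys_over K a)"
proof -
  let ?E = "polys_over K a"
  have subring_E: "subring ?E"
    by (rule subring_polys_over[OF subring_K])
  have spans: "spans_mod K ?E {0} {..<degree p} (\<lambda>i. a ^ i)"
    using polys_over_subset_lincombs_powers[OF p_nonzero coeff_in_K root] unfolding spans_mod_0_iff .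
  have "inverse z \<in> ?E" if z_in_E: "z \<in> ?E" for z
  proof -
    have "\<not> transcendental_over K z"
      by (rule not_transcendental_over_if_spans[OF finite_lessThan spans
        subring_power[OF subring_E z_in_E]])
    then have "inverse z \<in> polys_over K z"
      by (elim not_transcendental_overE) (rule inverse_in_polys_over_if_root)
    then show ?thesis
      using polys_over_subset[OF subring_E subset_polys_over[OF subring_K] z_in_E] by blast
  qed
  then show ?thesis
    using subring_E unfolding subfield_def subring_def by blast
qed

lemma mem_rat_fun_field_iff:
  "z \<in> rat_fun_field K y \<longleftrightarrow> (\<exists>a\<in>polys_over K y. \<exists>b\<in>polys_over K y. b \<noteq> 0 \<and> z = a / b)"
  unfolding rat_fun_field_def polys_over_def set_coeffs_subset_iff by blast

lemma polys_over_subset_rat_fun_field: "polys_over K y \<subseteq> rat_fun_field K y"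
  unfolding mem_rat_fun_field_iff subset_iff
  using subring_1[OF subring_polys_over[OF subring_K, of y]] by (metis div_by_1 zero_neq_one)

lemma subfield_rat_fun_field: "subfield (rat_fun_field K y)"
proof -
  note polys_closed = subring_closed[OF subring_polys_over[OF subring_K, of y]]
  have "r + s \<in> rat_fun_field K y \<and> r * s \<in> rat_fun_field K y"
    if "r \<in> rat_fun_field K y" "s \<in> rat_fun_field K y" for r s
  proof -
    obtain a b where "a \<in> polys_over K y" "b \<in> polys_over K y" "b \<noteq> 0" "r = a / b"
      using \<open>r \<in> _\<close> unfolding mem_rat_fun_field_iff by blast
    moreover obtain c d where "c \<in> polys_over K y" "d \<in> polys_over K y" "d \<noteq> 0" "s = c / d"
      using \<open>s \<in> _\<close> unfolding mem_rat_fun_field_iff by blast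
    moreover from calculation have "r + s = (a * d + c * b) / (b * d)" "r * s = (a * c) / (b * d)"
      by (auto simp: field_simps)
    ultimately show ?thesis
      unfolding mem_rat_fun_field_iff by (metis polys_closed(3,4) no_zero_divisors)
  qed
  moreover have "- r \<in> rat_fun_field K y \<and> inverse r \<in> rat_fun_field K y"
    if r_in_rat_fun_field: "r \<in> rat_fun_field K y" for r
  proof -
    obtain a b where a_in_polys_over: "a \<in> polys_over K y" and b_in_polys_over: "b \<in> polys_over K y"
      and b_nonzero: "b \<noteq> 0" and r_eq: "r = a / b"
      using r_in_rat_fun_field unfolding mem_rat_fun_field_iff by blast
    have "- r \<in> rat_fun_field K y"
      unfolding mem_rat_fun_field_iff
      using a_in_polys_over b_in_polys_over b_nonzero r_eq polys_closed(5) by (metis minus_divide_left)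
    moreover have "inverse r \<in> rat_fun_field K y"
      using r_in_rat_fun_field a_in_polys_over b_in_polys_over b_nonzero r_eq
      unfolding mem_rat_fun_field_iff by (cases "a = 0") (simp, metis inverse_divide)
    ultimately show ?thesis ..
  qed
  moreover have "0 \<in> rat_fun_field K y" "1 \<in> rat_fun_field K y"
    using polys_over_subset_rat_fun_field polys_closed(1,2) by blast+
  ultimately show ?thesis
    unfolding subfield_def by blast
qed

lemma base_field_rat_fun_field: "base_field (rat_fun_field K y)"
  using subfield_rat_fun_field by unfold_locales

lemma rat_fun_field_subset:
  assumes subfield_E: "subfield E" and K_subset_E: "K \<subseteq> E" and y_in_E: "y \<in> E"
  shows "rat_fun_field K y \<subseteq> E"
proof -
  interpret E: base_field E
    using subfield_E by unfold_locales
  show ?thesis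
    unfolding mem_rat_fun_field_iff subset_iff
    using polys_over_subset[OF E.subring_K K_subset_E y_in_E] by (auto intro!: E.K_divide)
qed

lemma rat_fun_field_inverse: "rat_fun_field K (inverse y) = rat_fun_field K y"
proof -
  have "rat_fun_field K (inverse y) \<subseteq> rat_fun_field K y" for y
  proof (rule rat_fun_field_subset[OF subfield_rat_fun_field])
    show "K \<subseteq> rat_fun_field K y" "inverse y \<in> rat_fun_field K y"
      using polys_over_subset_rat_fun_field[of y] subset_polys_over[OF subring_K, of y]
        self_in_polys_over[OF subring_K, of y] base_field.K_inverse[OF base_field_rat_fun_field, of y y]
      by blast+
  qed
  from this[of y] this[of "inverse y"] show ?thesis
    by simp
qed

lemma lin_indep_rat_fun_field:
  assumes "finite A" and u_indep: "lin_indep (polys_over K y) A u"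
  shows "lin_indep (rat_fun_field K y) A u"
proof (rule lin_indep_modI)
  fix c i
  assume c_in_rat_fun_field: "\<And>i. i \<in> A \<Longrightarrow> c i \<in> rat_fun_field K y"
    and lincomb_in_0: "(\<Sum>i\<in>A. c i * u i) \<in> {0}" and i_in_A: "i \<in> A"
  note polys_closed = subring_closed[OF subring_polys_over[OF subring_K, of y]]
  have "\<forall>i\<in>A. \<exists>a b. a \<in> polys_over K y \<and> b \<in> polys_over K y \<and> b \<noteq> 0 \<and> c i = a / b"
    using c_in_rat_fun_field unfolding mem_rat_fun_field_iff by blast
  then obtain a b where a_in_polys_over: "\<And>i. i \<in> A \<Longrightarrow> a i \<in> polys_over K y"
    and b_in_polys_over: "\<And>i. i \<in> A \<Longrightarrow> b i \<in> polys_over K y"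
    and b_nonzero: "\<And>i. i \<in> A \<Longrightarrow> b i \<noteq> 0" and c_i_eq: "\<And>i. i \<in> A \<Longrightarrow> c i = a i / b i"
    by metis
  define D where "D = (\<Prod>i\<in>A. b i)"
  have "D \<noteq> 0"
    unfolding D_def using b_nonzero assms(1) by simp
  have "D * c j \<in> polys_over K y" if j_in_A: "j \<in> A" for j
  proof -
    have "D * c j = (\<Prod>i\<in>A - {j}. b i) * a j"
      unfolding D_def using b_nonzero[OF j_in_A] c_i_eq[OF j_in_A] j_in_A assms(1)
      by (simp add: prod.remove)
    then show ?thesis
      using a_in_polys_over b_in_polys_over j_in_A by (auto intro!: polys_closed(4) polys_closed(8))
  qed
  moreover have "(\<Sum>j\<in>A. D * c j * u j) \<in> {0}"
    using lincomb_in_0 by (simp add: mult.assoc flip: sum_distrib_left)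
  ultimately have "D * c i = 0"
    using i_in_A by (intro lin_indep_modD[OF u_indep, of "\<lambda>j. D * c j"]) auto
  then show "c i = 0"
    using \<open>D \<noteq> 0\<close> by simp
qed

lemma transcendental_over_rat_fun_field_swap:
  assumes transcendental_y: "transcendental_over K y"
    and transcendental_x: "transcendental_over (rat_fun_field K y) x"
  shows "transcendental_over (rat_fun_field K x) y"
proof -
  interpret Kx: base_field "rat_fun_field K x"
    by (rule base_field_rat_fun_field)
  interpret Ky: base_field "rat_fun_field K y"
    by (rule base_field_rat_fun_field)
  have "lin_indep (rat_fun_field K x) {..m} (\<lambda>j. y ^ j)" for m
  proof (intro lin_indep_rat_fun_field lin_indep_polys_over)
    fix n
    have "lin_indep (polys_over K y) {..n} (\<lambda>k. x ^ k)"
      using transcendental_x Ky.transcendental_over_iff_lin_indep_powers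
        lin_indep_mod_mono[OF _ polys_over_subset_rat_fun_field]
      by blast
    then have "lin_indep K ({..m} \<times> {..n}) (\<lambda>(j, k). y ^ j * x ^ k)"
      by (rule lin_indep_monomials[OF transcendental_y])
    then have "lin_indep K ({..n} \<times> {..m}) ((\<lambda>(j, k). y ^ j * x ^ k) \<circ> prod.swap)"
      by (rule lin_indep_mod_reindex[rotated]) (auto simp: bij_betw_def)
    then show "lin_indep K ({..n} \<times> {..m}) (\<lambda>(j, k). x ^ j * y ^ k)"
      by (simp add: o_def split_def mult.commute)
  qed auto
  then show ?thesis
    using Kx.transcendental_over_iff_lin_indep_powers by blast
qed

lemma has_dim_over_rat_fun_field_transfer:
  assumes degree_over_x: "has_dim (rat_fun_field K x) UNIV {0} n"
    and transcendental_y: "transcendental_over K y"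
  shows "\<exists>d. has_dim (rat_fun_field K y) UNIV {0} d"
proof -
  interpret Kx: base_field "rat_fun_field K x"
    by (rule base_field_rat_fun_field)
  interpret Ky: base_field "rat_fun_field K y"
    by (rule base_field_rat_fun_field)
  obtain u where u_spans: "spans_mod (rat_fun_field K x) UNIV {0} {..<n} u"
    using degree_over_x unfolding has_dim_def by blast
  then have "\<not> transcendental_over (rat_fun_field K x) y"
    by (intro Kx.not_transcendental_over_if_spans) auto
  then have "\<not> transcendental_over (rat_fun_field K y) x"
    using transcendental_over_rat_fun_field_swap[OF transcendental_y] by blast
  then obtain p where coeff_in_rat_fun_field: "\<forall>k. coeff p k \<in> rat_fun_field K y" and p_nonzero: "p \<noteq> 0"
    and root: "poly p x = 0"
    by (rule Ky.not_transcendental_overE)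
  let ?E = "polys_over (rat_fun_field K y) x"
  have "rat_fun_field K x \<subseteq> ?E"
    using Ky.subfield_polys_over_if_root[OF p_nonzero coeff_in_rat_fun_field root]
      subset_polys_over[OF Ky.subring_K]
      subset_polys_over[OF subring_K] polys_over_subset_rat_fun_field self_in_polys_over[OF Ky.subring_K]
    by (intro rat_fun_field_subset) blast+
  then have "spans_mod ?E UNIV {0} {..<n} u"
    using u_spans unfolding spans_mod_def by (meson subsetD)
  moreover have "spans_mod (rat_fun_field K y) ?E {0} {..<degree p} (\<lambda>i. x ^ i)"
    using Ky.polys_over_subset_lincombs_powers[OF p_nonzero coeff_in_rat_fun_field root]
    unfolding spans_mod_0_iff .
  ultimately show ?thesis
    using Ky.has_dim_exists_if_spans[OF submodule_singleton_0 _ spans_mod_tower]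
    by (metis finite_SigmaI finite_lessThan)
qed

lemma lin_indep_monomials_if_lin_indep_mod:
  assumes subring_T: "subring T" and K_subset_T: "K \<subseteq> T" and y_in_T: "y \<in> T" and y_nonzero: "y \<noteq> 0"
    and z_in_T: "\<And>k. k \<in> A \<Longrightarrow> z k \<in> T"
    and z_indep: "lin_indep_mod K ((*) y ` T) A z"
  shows "lin_indep K ({..<m} \<times> A) (\<lambda>(j, k). y ^ j * z k)"
proof (induction m)
  case 0
  show ?case
    by (simp add: lin_indep_mod_def)
next
  case (Suc m)
  show ?case
  proof (rule lin_indep_modI)
    fix c i
    assume c_in_K: "\<And>i. i \<in> {..<Suc m} \<times> A \<Longrightarrow> c i \<in> K"
      and lincomb_in_0: "(\<Sum>i\<in>{..<Suc m} \<times> A. c i * (case i of (j, k) \<Rightarrow> y ^ j * z k)) \<in> {0}"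
      and i_in_index_set: "i \<in> {..<Suc m} \<times> A"
    let ?tail = "\<Sum>j<m. \<Sum>k\<in>A. c (Suc j, k) * (y ^ j * z k)"
    have "(\<Sum>j<Suc m. \<Sum>k\<in>A. c (j, k) * (y ^ j * z k)) = 0"
      using lincomb_in_0 by (simp add: sum.cartesian_product split_def del: sum.lessThan_Suc)
    then have "(\<Sum>k\<in>A. c (0, k) * z k) + y * ?tail = 0"
      unfolding sum.lessThan_Suc_shift by (simp add: sum_distrib_left mult.left_commute mult.assoc)
    then have head: "(\<Sum>k\<in>A. c (0, k) * z k) = y * - ?tail"
      by (simp add: eq_neg_iff_add_eq_0)
    have "?tail \<in> T"
      using c_in_K z_in_T subring_T K_subset_T y_in_T
      by (intro subring_sum subring_mult subring_power) auto
    then have "(\<Sum>k\<in>A. c (0, k) * z k) \<in> (*) y ` T"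
      unfolding head using subring_uminus[OF subring_T] by blast
    then have c_0_eq_0: "c (0, k) = 0" if "k \<in> A" for k
      using lin_indep_modD[OF z_indep, of "\<lambda>k. c (0, k)" k] c_in_K that by auto
    then have "?tail = 0"
      using head y_nonzero by simp
    then have "c (Suc j, k) = 0" if "j < m" "k \<in> A" for j k
      using lin_indep_modD[OF Suc.IH, of "\<lambda>(j, k). c (Suc j, k)" "(j, k)"] c_in_K that
      by (auto simp: sum.cartesian_product split_def)
    then show "c i = 0"
      using c_0_eq_0 i_in_index_set by (cases "fst i") auto
  qed
qed

lemma has_dim_mod_times:
  assumes subring_T: "subring T" and K_subset_T: "K \<subseteq> T" and y_in_T: "y \<in> T" and y_nonzero: "y \<noteq> 0"
    and degree_over_y: "has_dim (rat_fun_field K y) UNIV {0} n"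
  shows "\<exists>d\<le>n. has_dim K T ((*) y ` T) d"
proof (rule has_dim_exists_if_bounded)
  show "submodule K ((*) y ` T)"
    by (intro submodule_times_image submodule_subring subring_T K_subset_T)
next
  fix d and b :: "nat \<Rightarrow> 'f"
  assume b_in_T: "\<And>i. i < d \<Longrightarrow> b i \<in> T" and b_indep: "lin_indep_mod K ((*) y ` T) {..<d} b"
  interpret Ky: base_field "rat_fun_field K y"
    by (rule base_field_rat_fun_field)
  have "lin_indep (rat_fun_field K y) {..<d} b"
    using lin_indep_monomials_if_lin_indep_mod[OF subring_T K_subset_T y_in_T y_nonzero _ b_indep,
      of "Suc _"] b_in_T
    by (intro lin_indep_rat_fun_field lin_indep_polys_over) (auto simp: lessThan_Suc_atMost)
  then show "d \<le> n"
    using Ky.card_lin_indep_le_dim[OF submodule_singleton_0 degree_over_y] by fastforce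
qed

end

locale alg_function_field =
  fixes K :: "'f::field set"
  assumes function_field: "function_field K"

sublocale alg_function_field \<subseteq> base_field K
  using function_field unfolding function_field_def by unfold_locales blast

context alg_function_field
begin

lemma transcendental_over_exists: "\<exists>x. transcendental_over K x"
  using function_field unfolding function_field_def by blast

lemma has_dim_over_rat_fun_field_exists:
  assumes "transcendental_over K y"
  shows "\<exists>n. has_dim (rat_fun_field K y) UNIV {0} n"
proof -
  obtain x B where "transcendental_over K x" and finite_B: "finite B"
    and B_spans: "\<And>z. \<exists>c. (\<forall>b\<in>B. c b \<in> rat_fun_field K x) \<and> z = (\<Sum>b\<in>B. c b * b)"
    using function_field unfolding function_field_def by blast
  interpret Kx: base_field "rat_fun_field K x"
    by (rule base_field_rat_fun_field)
  have "spans_mod (rat_fun_field K x) UNIV {0} B (\<lambda>b. b)"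
    using B_spans unfolding spans_mod_def by simp
  then show ?thesis
    using Kx.has_dim_exists_if_spans[OF submodule_singleton_0 finite_B]
      has_dim_over_rat_fun_field_transfer assms
    by blast
qed

end

section \<open>Places are discrete valuation rings\<close>

definition unit_of :: "'f::field set \<Rightarrow> 'f \<Rightarrow> bool" where
  "unit_of R w \<longleftrightarrow> w \<in> R \<and> w \<noteq> 0 \<and> inverse w \<in> R"

definition unif :: "'f::field set \<Rightarrow> 'f" where
  "unif R = (SOME t. uniformizer R t)"

definition val_ge :: "'f::field set \<Rightarrow> int \<Rightarrow> 'f set" where
  "val_ge R n = {z. z = 0 \<or> ord R z \<ge> n}"

lemma val_ge_mono: "m \<le> n \<Longrightarrow> val_ge R n \<subseteq> val_ge R m"
  unfolding val_ge_def by auto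

lemma mem_val_ge_ord: "z \<in> val_ge R (ord R z)"
  unfolding val_ge_def by simp

lemma max_ideal_subset: "max_ideal R \<subseteq> R"
  unfolding max_ideal_def by blast

lemma unit_of_iff: "unit_of R w \<longleftrightarrow> w \<in> R \<and> w \<notin> max_ideal R"
  unfolding unit_of_def max_ideal_def by auto

lemma unit_of_inverse: "unit_of R w \<Longrightarrow> unit_of R (inverse w)"
  unfolding unit_of_def by simp

context base_field
begin

lemma place_subring: "R \<in> places K \<Longrightarrow> subring R"
  using K_0 K_1 unfolding places_def valuation_ring_def subring_def by blast

lemma K_subset_place: "R \<in> places K \<Longrightarrow> K \<subseteq> R"
  unfolding places_def valuation_ring_def by blast

lemma exists_notin_place: "R \<in> places K \<Longrightarrow> \<exists>z. z \<notin> R"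
  unfolding places_def valuation_ring_def by blast

lemma place_0: "R \<in> places K \<Longrightarrow> 0 \<in> R"
  by (rule subring_0[OF place_subring])

lemma place_1: "R \<in> places K \<Longrightarrow> 1 \<in> R"
  by (rule subring_1[OF place_subring])

lemma place_add: "R \<in> places K \<Longrightarrow> a \<in> R \<Longrightarrow> b \<in> R \<Longrightarrow> a + b \<in> R"
  by (rule subring_add[OF place_subring])

lemma place_mult: "R \<in> places K \<Longrightarrow> a \<in> R \<Longrightarrow> b \<in> R \<Longrightarrow> a * b \<in> R"
  by (rule subring_mult[OF place_subring])

lemma place_diff: "R \<in> places K \<Longrightarrow> a \<in> R \<Longrightarrow> b \<in> R \<Longrightarrow> a - b \<in> R"
  by (rule subring_diff[OF place_subring])

lemma place_power: "R \<in> places K \<Longrightarrow> a \<in> R \<Longrightarrow> a ^ n \<in> R"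
  by (rule subring_power[OF place_subring])

lemma submodule_place: "R \<in> places K \<Longrightarrow> submodule K R"
  by (intro submodule_subring place_subring K_subset_place)

lemma inverse_in_max_ideal: "R \<in> places K \<Longrightarrow> z \<notin> R \<Longrightarrow> inverse z \<in> max_ideal R"
  unfolding places_def valuation_ring_def max_ideal_def by auto

lemma max_ideal_0: "R \<in> places K \<Longrightarrow> 0 \<in> max_ideal R"
  using place_0 unfolding max_ideal_def by auto

lemma max_ideal_mult:
  assumes R_place: "R \<in> places K" and a_in_max_ideal: "a \<in> max_ideal R" and r_in_R: "r \<in> R"
  shows "r * a \<in> max_ideal R"
proof (cases "r * a = 0")
  case True
  then show ?thesis
    using max_ideal_0[OF R_place] by (simp only:)
next
  case False
  have "inverse (r * a) \<notin> R"
  proof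
    assume "inverse (r * a) \<in> R"
    then have "r * inverse (r * a) \<in> R"
      by (rule place_mult[OF R_place r_in_R])
    moreover have "r * inverse (r * a) = inverse a"
      using False by (simp add: field_simps)
    ultimately have "inverse a \<in> R"
      by (simp only:)
    then show False
      using a_in_max_ideal False unfolding max_ideal_def by auto
  qed
  then show ?thesis
    using place_mult[OF R_place r_in_R] a_in_max_ideal unfolding max_ideal_def by blast
qed

lemma max_ideal_add:
  assumes R_place: "R \<in> places K" and a_in_max_ideal: "a \<in> max_ideal R"
    and b_in_max_ideal: "b \<in> max_ideal R"
  shows "a + b \<in> max_ideal R"
proof (cases "a = 0 \<or> b = 0")
  case True
  then show ?thesis
    using a_in_max_ideal b_in_max_ideal by auto
next
  case False
  have sum_in: "a + b \<in> max_ideal R" if "b \<in> max_ideal R" "a / b \<in> R" "b \<noteq> 0" for a b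
  proof -
    have "(1 + a / b) * b \<in> max_ideal R"
      using that by (intro max_ideal_mult place_add place_1 R_place)
    moreover have "(1 + a / b) * b = a + b"
      using that(3) by (simp add: distrib_right)
    ultimately show ?thesis
      by (simp only:)
  qed
  have "a / b \<in> R \<or> b / a \<in> R"
    using inverse_in_max_ideal[OF R_place, of "a / b"] max_ideal_subset[of R] by auto
  then show ?thesis
    using sum_in[OF b_in_max_ideal] sum_in[OF a_in_max_ideal, of b] False by (auto simp: add.commute)
qed

lemma submodule_max_ideal: "R \<in> places K \<Longrightarrow> submodule K (max_ideal R)"
  unfolding submodule_def using max_ideal_add max_ideal_mult K_subset_place max_ideal_0 by blast

lemma max_ideal_Int_K: "R \<in> places K \<Longrightarrow> a \<in> K \<Longrightarrow> a \<in> max_ideal R \<Longrightarrow> a = 0"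
  unfolding max_ideal_def using K_inverse K_subset_place by blast

lemma one_notin_max_ideal: "R \<in> places K \<Longrightarrow> 1 \<notin> max_ideal R"
  using max_ideal_Int_K[of R 1] K_1 by auto

lemma max_ideal_nonzero:
  assumes R_place: "R \<in> places K"
  shows "\<exists>t\<in>max_ideal R. t \<noteq> 0"
proof -
  obtain z where "z \<notin> R"
    using exists_notin_place[OF R_place] by blast
  then show ?thesis
    using inverse_in_max_ideal[OF R_place] place_0[OF R_place] by (intro bexI[of _ "inverse z"]) auto
qed

lemma unit_of_mult: "R \<in> places K \<Longrightarrow> unit_of R v \<Longrightarrow> unit_of R w \<Longrightarrow> unit_of R (v * w)"
  unfolding unit_of_def by (auto simp: place_mult)

lemma unit_of_1: "R \<in> places K \<Longrightarrow> unit_of R 1"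
  unfolding unit_of_def by (simp add: place_1)

lemma transcendental_over_max_ideal:
  assumes R_place: "R \<in> places K" and w_in_max_ideal: "w \<in> max_ideal R" and w_nonzero: "w \<noteq> 0"
  shows "transcendental_over K w"
proof (rule ccontr)
  assume "\<not> transcendental_over K w"
  then have "inverse w \<in> polys_over K w"
    by (elim not_transcendental_overE) (rule inverse_in_polys_over_if_root)
  also have "\<dots> \<subseteq> R"
    using w_in_max_ideal max_ideal_subset
    by (intro polys_over_subset place_subring K_subset_place R_place) blast
  finally show False
    using w_in_max_ideal w_nonzero unfolding max_ideal_def by blast
qed

lemma times_image_unit:
  assumes R_place: "R \<in> places K" and w_unit: "unit_of R w"
  shows "(*) w ` R = R"
proof
  show "(*) w ` R \<subseteq> R"
    using w_unit place_mult[OF R_place] unfolding unit_of_def by blast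
  show "R \<subseteq> (*) w ` R"
  proof
    fix a assume "a \<in> R"
    then have "inverse w * a \<in> R"
      using w_unit place_mult[OF R_place] unfolding unit_of_def by blast
    then show "a \<in> (*) w ` R"
      using w_unit unfolding unit_of_def by (intro image_eqI[of _ _ "inverse w * a"]) auto
  qed
qed

lemma has_dim_mod_times_mult:
  assumes R_place: "R \<in> places K" and a_in_R: "a \<in> R" and a_nonzero: "a \<noteq> 0" and b_in_R: "b \<in> R"
    and has_dim_mod_a: "has_dim K R ((*) a ` R) d" and has_dim_mod_b: "has_dim K R ((*) b ` R) e"
  shows "has_dim K R ((*) (a * b) ` R) (d + e)"
proof -
  have "has_dim K ((*) a ` R) ((*) a ` (*) b ` R) e"
    by (rule has_dim_times_image[OF a_nonzero has_dim_mod_b])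
  then show ?thesis
    using a_in_R b_in_R place_mult[OF R_place]
    by (intro has_dim_trans[OF submodule_times_image[OF submodule_place[OF R_place]] _ _ has_dim_mod_a])
      (auto simp: image_image mult.assoc)
qed

lemma has_dim_mod_times_pos:
  assumes R_place: "R \<in> places K" and a_in_max_ideal: "a \<in> max_ideal R"
    and has_dim_mod_a: "has_dim K R ((*) a ` R) d"
  shows "d > 0"
proof (rule gr0I)
  assume "d = 0"
  then have "1 \<in> (*) a ` R"
    using has_dim_0D has_dim_mod_a place_1[OF R_place] by blast
  then obtain r where "r \<in> R" "1 = r * a"
    by (auto simp: mult.commute)
  then show False
    using max_ideal_mult[OF R_place a_in_max_ideal] one_notin_max_ideal[OF R_place] by metis
qed

end

context alg_function_field
begin

lemma has_dim_place_mod_times: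
  assumes R_place: "R \<in> places K" and z_in_R: "z \<in> R" and z_nonzero: "z \<noteq> 0"
  shows "\<exists>d. has_dim K R ((*) z ` R) d"
proof (cases "z \<in> max_ideal R")
  case True
  then obtain n where "has_dim (rat_fun_field K z) UNIV {0} n"
    using has_dim_over_rat_fun_field_exists transcendental_over_max_ideal[OF R_place] z_nonzero by blast
  then show ?thesis
    using has_dim_mod_times[OF place_subring[OF R_place] K_subset_place[OF R_place] z_in_R z_nonzero]
    by blast
next
  case False
  then show ?thesis
    using has_dim_self[OF submodule_place[OF R_place]] times_image_unit[OF R_place, of z] z_in_R
      unit_of_iff by metis
qed

lemma has_dim_mod_times_mult_less:
  assumes R_place: "R \<in> places K" and a_in_R: "a \<in> R" and a_nonzero: "a \<noteq> 0"
    and b_in_max_ideal: "b \<in> max_ideal R" and b_nonzero: "b \<noteq> 0"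
    and has_dim_mod_mult: "has_dim K R ((*) (a * b) ` R) d"
  shows "\<exists>e<d. has_dim K R ((*) a ` R) e"
proof -
  have b_in_R: "b \<in> R"
    using b_in_max_ideal max_ideal_subset by blast
  obtain e where has_dim_mod_a: "has_dim K R ((*) a ` R) e"
    using has_dim_place_mod_times[OF R_place a_in_R a_nonzero] by blast
  obtain f where has_dim_mod_b: "has_dim K R ((*) b ` R) f"
    using has_dim_place_mod_times[OF R_place b_in_R b_nonzero] by blast
  have "d = e + f"
    using has_dim_unique[OF submodule_times_image[OF submodule_place[OF R_place]] has_dim_mod_mult]
      has_dim_mod_times_mult[OF R_place a_in_R a_nonzero b_in_R has_dim_mod_a has_dim_mod_b] by blast
  moreover have "f > 0"
    by (rule has_dim_mod_times_pos[OF R_place b_in_max_ideal has_dim_mod_b])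
  ultimately show ?thesis
    using has_dim_mod_a by (intro exI[of _ e]) simp
qed

text \<open>A uniformizer is a nonzero \<open>t\<close> in the maximal ideal for which \<open>R / t R\<close> has the least dimension.\<close>
lemma uniformizer_exists:
  assumes R_place: "R \<in> places K"
  shows "\<exists>t. uniformizer R t"
proof -
  define codim where "codim d \<longleftrightarrow> (\<exists>t\<in>max_ideal R. t \<noteq> 0 \<and> has_dim K R ((*) t ` R) d)" for d
  obtain t0 where "t0 \<in> max_ideal R" "t0 \<noteq> 0"
    using max_ideal_nonzero[OF R_place] by blast
  then have "\<exists>d. codim d"
    unfolding codim_def using has_dim_place_mod_times[OF R_place] max_ideal_subset by blast
  then obtain d where "codim d" and d_minimal: "\<And>e. codim e \<Longrightarrow> d \<le> e"
    by (meson LeastI_ex Least_le)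
  then obtain t where t_in_max_ideal: "t \<in> max_ideal R" and t_nonzero: "t \<noteq> 0"
    and has_dim_mod_t: "has_dim K R ((*) t ` R) d"
    unfolding codim_def by blast
  have "s \<in> (*) t ` R" if s_in_max_ideal: "s \<in> max_ideal R" for s
  proof (rule ccontr)
    assume notin: "s \<notin> (*) t ` R"
    have s_nonzero: "s \<noteq> 0"
      using notin place_0[OF R_place] by (metis image_eqI mult_zero_right)
    have "s / t \<notin> R"
      using notin t_nonzero by (metis image_eqI nonzero_mult_div_cancel_left times_divide_eq_right)
    then have quotient: "t / s \<in> max_ideal R"
      using inverse_in_max_ideal[OF R_place] by fastforce
    obtain e where "e < d" "has_dim K R ((*) s ` R) e"
      using has_dim_mod_times_mult_less[OF R_place _ s_nonzero quotient, of d] has_dim_mod_t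
        s_in_max_ideal s_nonzero t_nonzero max_ideal_subset by auto
    then show False
      using d_minimal[of e] s_in_max_ideal s_nonzero unfolding codim_def by fastforce
  qed
  moreover have "t * a \<in> max_ideal R" if "a \<in> R" for a
    using max_ideal_mult[OF R_place t_in_max_ideal that] by (simp add: mult.commute)
  ultimately have "max_ideal R = {t * a | a. a \<in> R}"
    by blast
  then show ?thesis
    unfolding uniformizer_def using t_in_max_ideal max_ideal_subset by blast
qed

lemma max_ideal_eq_unif_times: "R \<in> places K \<Longrightarrow> max_ideal R = (*) (unif R) ` R"
  using someI_ex[OF uniformizer_exists] unfolding unif_def uniformizer_def by blast

lemma unif_in_max_ideal: "R \<in> places K \<Longrightarrow> unif R \<in> max_ideal R"
  unfolding max_ideal_eq_unif_times using place_1 by (intro image_eqI[of _ _ 1]) auto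

lemma unif_in_place: "R \<in> places K \<Longrightarrow> unif R \<in> R"
  using unif_in_max_ideal max_ideal_subset by blast

lemma unif_nonzero: "R \<in> places K \<Longrightarrow> unif R \<noteq> 0"
  using max_ideal_nonzero[of R] max_ideal_eq_unif_times[of R] by auto

lemma unif_powi_in_max_ideal:
  assumes R_place: "R \<in> places K" and "n > 0"
  shows "unif R powi n \<in> max_ideal R"
proof -
  have "n = int (Suc (nat n - 1))"
    using assms(2) by simp
  moreover have "unif R ^ (nat n - 1) * unif R \<in> max_ideal R"
    by (intro max_ideal_mult place_power unif_in_place unif_in_max_ideal R_place)
  ultimately show ?thesis
    by (metis power_Suc2 power_int_of_nat)
qed

lemma unif_power_decomposition:
  assumes R_place: "R \<in> places K" and "z \<in> R" "z \<noteq> 0"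
  shows "\<exists>n w. unit_of R w \<and> z = unif R ^ n * w"
proof -
  obtain d where "has_dim K R ((*) z ` R) d"
    using has_dim_place_mod_times[OF assms] by blast
  then show ?thesis
    using assms(2,3)
  proof (induction d arbitrary: z rule: less_induct)
    case (less d)
    show ?case
    proof (cases "z \<in> max_ideal R")
      case False
      then have "unit_of R z"
        unfolding unit_of_iff using less.prems(2) by blast
      then show ?thesis
        by (intro exI[of _ 0] exI[of _ z]) auto
    next
      case True
      then obtain a where a_in_R: "a \<in> R" and z_eq: "z = unif R * a"
        using max_ideal_eq_unif_times[OF R_place] by blast
      have "a \<noteq> 0"
        using z_eq less.prems(3) by auto
      have "z = a * unif R"
        by (simp add: z_eq)
      then obtain e where "e < d" and has_dim_mod_a: "has_dim K R ((*) a ` R) e"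
        using has_dim_mod_times_mult_less[OF R_place a_in_R \<open>a \<noteq> 0\<close> unif_in_max_ideal[OF R_place]
          unif_nonzero[OF R_place], of d] less.prems(1) by auto
      then obtain n w where "unit_of R w" "a = unif R ^ n * w"
        using less.IH[OF _ has_dim_mod_a a_in_R \<open>a \<noteq> 0\<close>] by auto
      then show ?thesis
        using z_eq by (intro exI[of _ "Suc n"] exI[of _ w]) auto
    qed
  qed
qed

lemma unif_powi_decomposition:
  assumes R_place: "R \<in> places K" and z_nonzero: "z \<noteq> 0"
  shows "\<exists>n w. unit_of R w \<and> z = unif R powi n * w"
proof (cases "z \<in> R")
  case True
  then obtain n w where "unit_of R w" "z = unif R ^ n * w"
    using unif_power_decomposition[OF R_place] z_nonzero by blast
  then show ?thesis
    by (intro exI[of _ "int n"] exI[of _ w]) simp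
next
  case False
  then have "inverse z \<in> R"
    using inverse_in_max_ideal[OF R_place] max_ideal_subset by blast
  then obtain n w where w_unit: "unit_of R w" and inverse_z_eq: "inverse z = unif R ^ n * w"
    using unif_power_decomposition[OF R_place, of "inverse z"] z_nonzero by auto
  have "z = inverse (unif R ^ n * w)"
    using inverse_z_eq by (metis inverse_inverse_eq)
  also have "\<dots> = unif R powi (- int n) * inverse w"
    by (simp add: power_int_minus)
  finally show ?thesis
    using unit_of_inverse[OF w_unit] by blast
qed

lemma unif_powi_decomposition_unique:
  assumes R_place: "R \<in> places K" and "unit_of R v" and "unit_of R w"
    and "unif R powi m * v = unif R powi n * w"
  shows "m = n"
proof -
  have False
    if "k < l" "unit_of R v" "unit_of R w" "unif R powi k * v = unif R powi l * w" for k l v w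
  proof -
    have "unif R powi l = unif R powi k * unif R powi (l - k)"
      using power_int_add[of "unif R" k "l - k"] unif_nonzero[OF R_place] by simp
    then have "v = w * unif R powi (l - k)"
      using that(4) unif_nonzero[OF R_place] by (simp add: mult.assoc mult.commute[of w])
    then show False
      using max_ideal_mult[OF R_place unif_powi_in_max_ideal[OF R_place]] that(1-3) unfolding unit_of_iff
      by simp
  qed
  then show ?thesis
    using assms(2-4) by (metis linorder_neqE)
qed

lemma ord_eqI:
  assumes R_place: "R \<in> places K" and w_unit: "unit_of R w" and z_eq: "z = unif R powi n * w"
  shows "ord R z = n"
proof -
  have "ord R z = (THE n. \<exists>w. unit_of R w \<and> z = unif R powi n * w)"
    unfolding ord_def unif_def unit_of_def by (simp add: conj_assoc)
  then show ?thesis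
    using w_unit z_eq unif_powi_decomposition_unique[OF R_place] by (auto intro!: the_equality)
qed

lemma ordE:
  assumes "R \<in> places K" "z \<noteq> 0"
  obtains w where "unit_of R w" "z = unif R powi (ord R z) * w"
  using unif_powi_decomposition[OF assms] ord_eqI[OF assms(1)] by metis

lemma ord_mult:
  assumes R_place: "R \<in> places K" and "y \<noteq> 0" "z \<noteq> 0"
  shows "ord R (y * z) = ord R y + ord R z"
proof -
  obtain v where v_unit: "unit_of R v" and y_eq: "y = unif R powi (ord R y) * v"
    using ordE[OF R_place assms(2)] .
  obtain w where w_unit: "unit_of R w" and z_eq: "z = unif R powi (ord R z) * w"
    using ordE[OF R_place assms(3)] .
  have "y * z = unif R powi (ord R y + ord R z) * (v * w)"
    using power_int_add[of "unif R" "ord R y" "ord R z"] unif_nonzero[OF R_place] y_eq z_eq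
    by (metis mult.assoc mult.left_commute)
  then show ?thesis
    using ord_eqI[OF R_place unit_of_mult[OF R_place v_unit w_unit]] by blast
qed

lemma ord_1: "R \<in> places K \<Longrightarrow> ord R 1 = 0"
  using ord_eqI[OF _ unit_of_1, of R 1 0] by simp

lemma ord_inverse: "R \<in> places K \<Longrightarrow> z \<noteq> 0 \<Longrightarrow> ord R (inverse z) = - ord R z"
  using ord_mult[of R z "inverse z"] ord_1[of R] by simp

lemma ord_power: "R \<in> places K \<Longrightarrow> z \<noteq> 0 \<Longrightarrow> ord R (z ^ n) = int n * ord R z"
  by (induction n) (auto simp: ord_1 ord_mult algebra_simps)

lemma ord_unif_powi: "R \<in> places K \<Longrightarrow> ord R (unif R powi n) = n"
  using ord_eqI[OF _ unit_of_1, of R "unif R powi n" n] by simp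

lemma ord_pos_imp_in_max_ideal:
  assumes R_place: "R \<in> places K" and "z \<noteq> 0" "ord R z > 0"
  shows "z \<in> max_ideal R"
proof -
  obtain w where "unit_of R w" "z = unif R powi (ord R z) * w"
    using ordE[OF R_place assms(2)] .
  then show ?thesis
    using max_ideal_mult[OF R_place unif_powi_in_max_ideal[OF R_place assms(3)], of w]
    by (simp add: unit_of_iff mult.commute)
qed

lemma ord_pos_iff:
  assumes R_place: "R \<in> places K" and z_nonzero: "z \<noteq> 0"
  shows "ord R z > 0 \<longleftrightarrow> z \<in> max_ideal R"
proof
  assume z_in_max_ideal: "z \<in> max_ideal R"
  show "ord R z > 0"
  proof (rule ccontr)
    assume "\<not> ord R z > 0"
    then consider "ord R z = 0" | "ord R (inverse z) > 0"
      using ord_inverse[OF R_place z_nonzero] by linarith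
    then show False
    proof cases
      case 1
      then have "unit_of R z"
        using ordE[OF R_place z_nonzero] by (metis mult_1 power_int_0_right)
      then show False
        using z_in_max_ideal unfolding unit_of_iff by blast
    next
      case 2
      then have "inverse z \<in> R"
        using ord_pos_imp_in_max_ideal[OF R_place, of "inverse z"] z_nonzero max_ideal_subset by auto
      then show False
        using z_in_max_ideal z_nonzero unfolding max_ideal_def by blast
    qed
  qed
qed (rule ord_pos_imp_in_max_ideal[OF assms])

lemma ord_nonneg_iff: "R \<in> places K \<Longrightarrow> z \<noteq> 0 \<Longrightarrow> ord R z \<ge> 0 \<longleftrightarrow> z \<in> R"
  using ord_pos_iff[of R "inverse z"] ord_inverse[of R z] inverse_in_max_ideal[of R z]
  unfolding max_ideal_def by auto

lemma val_ge_0: "R \<in> places K \<Longrightarrow> val_ge R 0 = R"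
  using ord_nonneg_iff[of R] place_0[of R] unfolding val_ge_def by (auto, metis)

lemma val_ge_1: "R \<in> places K \<Longrightarrow> val_ge R 1 = max_ideal R"
  using ord_pos_iff[of R] max_ideal_0[of R] unfolding val_ge_def
  by (auto simp: int_one_le_iff_zero_less) metis

lemma times_image_val_ge:
  assumes R_place: "R \<in> places K" and y_nonzero: "y \<noteq> 0"
  shows "(*) y ` val_ge R n = val_ge R (n + ord R y)"
proof
  show "(*) y ` val_ge R n \<subseteq> val_ge R (n + ord R y)"
    unfolding val_ge_def using ord_mult[OF R_place y_nonzero] by fastforce
  show "val_ge R (n + ord R y) \<subseteq> (*) y ` val_ge R n"
  proof
    fix a assume "a \<in> val_ge R (n + ord R y)"
    then have "inverse y * a \<in> val_ge R n"
      unfolding val_ge_def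
      using ord_mult[OF R_place, of "inverse y" a] ord_inverse[OF R_place y_nonzero] y_nonzero
      by (cases "a = 0") auto
    then show "a \<in> (*) y ` val_ge R n"
      using y_nonzero by (intro image_eqI[of _ _ "inverse y * a"]) auto
  qed
qed

lemma submodule_val_ge: "R \<in> places K \<Longrightarrow> submodule K (val_ge R n)"
  using times_image_val_ge[of R "unif R powi n" 0] submodule_times_image[OF submodule_place[of R]]
  by (metis add_0 ord_unif_powi power_int_eq_0_iff unif_nonzero val_ge_0)

lemma val_ge_mult:
  "R \<in> places K \<Longrightarrow> a \<in> val_ge R m \<Longrightarrow> b \<in> val_ge R n \<Longrightarrow> a * b \<in> val_ge R (m + n)"
  unfolding val_ge_def using ord_mult[of R a b] by (cases "a = 0 \<or> b = 0") auto

lemma ord_add_eq: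
  assumes R_place: "R \<in> places K" and y_nonzero: "y \<noteq> 0" and z_in_val_ge: "z \<in> val_ge R (ord R y + 1)"
  shows "ord R (y + z) = ord R y" and "y + z \<noteq> 0"
proof -
  let ?n = "ord R y"
  have "y + z \<in> val_ge R ?n"
    using z_in_val_ge val_ge_mono[of ?n "?n + 1"] mem_val_ge_ord
    by (intro submodule_add[OF submodule_val_ge[OF R_place]]) auto
  moreover have "y + z \<notin> val_ge R (?n + 1)"
  proof
    assume "y + z \<in> val_ge R (?n + 1)"
    then have "y + z - z \<in> val_ge R (?n + 1)"
      using z_in_val_ge by (intro submodule_diff[OF submodule_val_ge[OF R_place]])
    then show False
      using y_nonzero unfolding val_ge_def by simp
  qed
  ultimately show "ord R (y + z) = ord R y" "y + z \<noteq> 0"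
    unfolding val_ge_def by auto
qed

lemma has_dim_residue_field:
  assumes R_place: "R \<in> places K"
  shows "has_dim K R (max_ideal R) (place_degree K R)"
proof -
  obtain d where "has_dim K R (max_ideal R) d"
    using has_dim_place_mod_times[OF R_place unif_in_place[OF R_place] unif_nonzero[OF R_place]]
    unfolding max_ideal_eq_unif_times[OF R_place] by blast
  then show ?thesis
    using place_degree_eq[OF submodule_max_ideal[OF R_place]] by simp
qed

lemma place_degree_pos: "R \<in> places K \<Longrightarrow> place_degree K R > 0"
  using has_dim_mod_times_pos[OF _ unif_in_max_ideal] has_dim_residue_field
  by (simp add: max_ideal_eq_unif_times)

lemma has_dim_val_ge:
  assumes R_place: "R \<in> places K" and "m \<le> n"
  shows "has_dim K (val_ge R m) (val_ge R n) (nat (n - m) * place_degree K R)"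
  using assms(2)
proof (induction n rule: int_ge_induct)
  case base
  then show ?case
    using has_dim_self[OF submodule_val_ge[OF R_place]] by simp
next
  case (step n)
  have "has_dim K (val_ge R n) (val_ge R (n + 1)) (place_degree K R)"
    using has_dim_times_image[OF _ has_dim_residue_field[OF R_place], of "unif R powi n"]
      times_image_val_ge[OF R_place, of "unif R powi n" 0]
      times_image_val_ge[OF R_place, of "unif R powi n" 1]
    by (simp add: unif_nonzero[OF R_place] ord_unif_powi[OF R_place] val_ge_0[OF R_place]
      val_ge_1[OF R_place] add.commute)
  then have "has_dim K (val_ge R m) (val_ge R (n + 1)) (nat (n - m) * place_degree K R + place_degree K R)"
    using step by (intro has_dim_trans[OF submodule_val_ge[OF R_place] _ _ step.IH] val_ge_mono) auto
  moreover have "nat (n + 1 - m) = Suc (nat (n - m))"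
    using step.hyps by simp
  ultimately show ?case
    by (simp add: add.commute)
qed

end

section \<open>Weak approximation and the degree of zero divisors\<close>

lemma mem_times_image_iff: "y \<noteq> 0 \<Longrightarrow> z \<in> (*) y ` V \<longleftrightarrow> inverse y * z \<in> V" for y :: "'f::field"
  by (auto simp: image_iff field_simps intro!: bexI[of _ "inverse y * z"])

context alg_function_field
begin

lemma ord_le_minus_1_iff: "R \<in> places K \<Longrightarrow> z \<noteq> 0 \<Longrightarrow> ord R z \<le> - 1 \<longleftrightarrow> z \<notin> R"
  using ord_nonneg_iff[of R z] by auto

lemma ord_power_notin_place_le:
  assumes R_place: "R \<in> places K" and "z \<notin> R"
  shows "ord R (z ^ n) \<le> - int n"
proof -
  have "z \<noteq> 0"
    using assms place_0 by auto
  then have "int n * ord R z \<le> int n * - 1"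
    using ord_le_minus_1_iff[OF R_place] assms(2) by (intro mult_left_mono) auto
  then show ?thesis
    using ord_power[OF R_place \<open>z \<noteq> 0\<close>] by simp
qed

lemma power_notin_place:
  assumes R_place: "R \<in> places K" and "z \<notin> R"
  shows "z ^ Suc n \<notin> R"
  using ord_power_notin_place_le[OF assms, of "Suc n"] ord_le_minus_1_iff[OF R_place, of "z ^ Suc n"]
    assms place_0[OF R_place] by (cases "z = 0") auto

lemma place_not_subset_place:
  assumes R_place: "R \<in> places K" and S_place: "S \<in> places K" and "R \<noteq> S"
  shows "\<exists>z\<in>R. z \<notin> S"
proof (rule ccontr)
  assume "\<not> (\<exists>z\<in>R. z \<notin> S)"
  then have R_subset_S: "R \<subseteq> S"
    by blast
  then obtain z where z_in_S: "z \<in> S" and z_notin_R: "z \<notin> R"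
    using assms(3) by blast
  obtain v where v_notin_S: "v \<notin> S"
    using exists_notin_place[OF S_place] by blast
  have nonzero: "v \<noteq> 0" "z \<noteq> 0"
    using v_notin_S z_in_S z_notin_R place_0 R_place S_place by auto
  define k where "k = nat \<bar>ord R v\<bar>"
  have "ord R (v * inverse (z ^ k)) \<ge> 0"
    using ord_mult[OF R_place, of v "inverse (z ^ k)"] ord_inverse[OF R_place, of "z ^ k"]
      ord_power_notin_place_le[OF R_place z_notin_R, of k] nonzero abs_ge_minus_self[of "ord R v"]
    unfolding k_def by simp
  then have "v * inverse (z ^ k) \<in> S"
    using ord_nonneg_iff[OF R_place, of "v * inverse (z ^ k)"] nonzero R_subset_S by auto
  then have "v * inverse (z ^ k) * z ^ k \<in> S"
    using z_in_S by (rule place_mult[OF S_place _ place_power[OF S_place]])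
  moreover have "v * inverse (z ^ k) * z ^ k = v"
    using nonzero by (simp add: mult.assoc)
  ultimately show False
    using v_notin_S by (simp only:)
qed

lemma add_power_notin_place:
  assumes R_place: "R \<in> places K" and v_notin_R: "v \<notin> R" and r_large: "nat \<bar>ord R v\<bar> \<le> r"
  shows "v + z ^ Suc r \<notin> R"
proof (cases "z \<in> R")
  case True
  then have "z ^ Suc r \<in> R"
    by (intro place_power R_place)
  then show ?thesis
    using place_diff[OF R_place, of "v + z ^ Suc r" "z ^ Suc r"] v_notin_R by auto
next
  case False
  then have nonzero: "z ^ Suc r \<noteq> 0"
    using place_0[OF R_place] by auto
  have "ord R (z ^ Suc r) \<le> - int (Suc r)"
    by (rule ord_power_notin_place_le[OF R_place False])
  then have "ord R (z ^ Suc r) + 1 \<le> ord R v" "ord R (z ^ Suc r) < 0"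
    using r_large by linarith+
  then have "ord R (z ^ Suc r + v) < 0" "z ^ Suc r + v \<noteq> 0"
    using ord_add_eq[OF R_place nonzero, of v] unfolding val_ge_def by auto
  then show ?thesis
    using ord_nonneg_iff[OF R_place, of "z ^ Suc r + v"] by (simp add: add.commute)
qed

lemma zero_at_place_pole_at_place:
  assumes P_place: "P \<in> places K" and Q_place: "Q \<in> places K" and "P \<noteq> Q"
  shows "\<exists>z\<in>max_ideal P. z \<notin> Q"
proof -
  obtain a b where a_in_P: "a \<in> P" and a_notin_Q: "a \<notin> Q" and b_in_Q: "b \<in> Q" and b_notin_P: "b \<notin> P"
    using place_not_subset_place[OF P_place Q_place] place_not_subset_place[OF Q_place P_place] \<open>P \<noteq> Q\<close>
    by metis
  have "b \<noteq> 0"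
    using b_notin_P place_0[OF P_place] by auto
  then have cancel_b: "a * inverse b * b = a"
    by (simp add: mult.assoc)
  have "a * inverse b \<in> max_ideal P"
    by (intro max_ideal_mult inverse_in_max_ideal P_place a_in_P a_notin_Q b_in_Q b_notin_P)
  moreover have "a * inverse b \<notin> Q"
    using place_mult[OF Q_place _ b_in_Q, of "a * inverse b"] a_notin_Q unfolding cancel_b by blast
  ultimately show ?thesis
    by blast
qed

lemma zero_at_place_pole_at_places:
  assumes "finite T" "T \<subseteq> places K" and P_place: "P \<in> places K" and "P \<notin> T"
  shows "\<exists>v\<in>max_ideal P. \<forall>Q\<in>T. v \<notin> Q"
  using assms(1,2,4)
proof (induction T rule: finite_induct)
  case empty
  then show ?case
    using max_ideal_0[OF P_place] by blast
next
  case (insert Q T)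
  then obtain v where v_in_max_ideal: "v \<in> max_ideal P" and v_notin_S: "\<forall>S\<in>T. v \<notin> S"
    by auto
  have Q_place: "Q \<in> places K" and "P \<noteq> Q"
    using insert by auto
  show ?case
  proof (cases "v \<in> Q")
    case False
    then show ?thesis
      using v_in_max_ideal v_notin_S by blast
  next
    case True
    obtain z where z_in_max_ideal: "z \<in> max_ideal P" and z_notin_Q: "z \<notin> Q"
      using zero_at_place_pole_at_place[OF P_place Q_place \<open>P \<noteq> Q\<close>] by blast
    define r where "r = (\<Sum>S\<in>T. nat \<bar>ord S v\<bar>)"
    have "z ^ r * z \<in> max_ideal P"
      using z_in_max_ideal max_ideal_subset by (intro max_ideal_mult place_power P_place) auto
    then have "v + z ^ Suc r \<in> max_ideal P"
      unfolding power_Suc2 by (intro max_ideal_add P_place v_in_max_ideal)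
    moreover have "v + z ^ Suc r \<notin> Q"
      using power_notin_place[OF Q_place z_notin_Q] place_diff[OF Q_place _ True] by fastforce
    moreover have "v + z ^ Suc r \<notin> S" if "S \<in> T" for S
    proof -
      have "nat \<bar>ord S v\<bar> \<le> r"
        unfolding r_def using insert.hyps(1) that by (intro member_le_sum) auto
      then show ?thesis
        using insert.prems v_notin_S that by (intro add_power_notin_place) auto
    qed
    ultimately show ?thesis
      by blast
  qed
qed

lemma power_in_val_ge:
  assumes R_place: "R \<in> places K" and v_in_max_ideal: "v \<in> max_ideal R"
  shows "v ^ k \<in> val_ge R (int k)"
proof (induction k)
  case 0
  then show ?case
    using ord_1[OF R_place] by (simp add: val_ge_def)
next
  case (Suc k)
  then show ?case
    using val_ge_mult[OF R_place, of v 1 "v ^ k" "int k"] v_in_max_ideal val_ge_1[OF R_place] by simp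
qed

lemma approximate_indicator:
  assumes finite_T: "finite T" and T_subset_places: "T \<subseteq> places K" and P_place: "P \<in> places K"
    and "P \<notin> T"
  shows "\<exists>w. w - 1 \<in> val_ge P (int m) \<and> (\<forall>Q\<in>T. w \<in> val_ge Q (int m))"
proof -
  obtain v where v_in_max_ideal: "v \<in> max_ideal P" and v_notin_Q: "\<forall>Q\<in>T. v \<notin> Q"
    using zero_at_place_pole_at_places[OF assms] by blast
  define s where "s = v ^ Suc m"
  define w where "w = inverse (1 + s)"
  have s_in_val_ge: "s \<in> val_ge P (int (Suc m))"
    unfolding s_def by (rule power_in_val_ge[OF P_place v_in_max_ideal])
  then have unit: "ord P (1 + s) = 0" "1 + s \<noteq> 0"
    using ord_add_eq[OF P_place, of 1 s] val_ge_mono[of 1 "int (Suc m)" P] ord_1[OF P_place] by auto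
  then have "w \<in> val_ge P 0"
    using ord_inverse[OF P_place] unfolding val_ge_def w_def by simp
  then have "s * w \<in> val_ge P (int (Suc m) + 0)"
    by (intro val_ge_mult[OF P_place] s_in_val_ge)
  then have "- (s * w) \<in> val_ge P (int m)"
    using val_ge_mono[of "int m" "int (Suc m)" P] submodule_uminus[OF submodule_val_ge[OF P_place]]
    by auto
  then have "w - 1 \<in> val_ge P (int m)"
    unfolding w_def using unit(2) by (simp add: field_simps)
  moreover have "w \<in> val_ge Q (int m)" if "Q \<in> T" for Q
  proof -
    have Q_place: "Q \<in> places K" and "v \<notin> Q"
      using that finite_T T_subset_places v_notin_Q by auto
    then have "v \<noteq> 0"
      using place_0 by auto
    then have "s \<noteq> 0" and ord_s_le: "ord Q s \<le> - int (Suc m)"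
      unfolding s_def using ord_power_notin_place_le[OF Q_place \<open>v \<notin> Q\<close>] by (simp, blast)
    then have "ord Q (s + 1) = ord Q s" "s + 1 \<noteq> 0"
      using ord_add_eq[OF Q_place, of s 1] ord_1[OF Q_place] unfolding val_ge_def by auto
    then have "ord Q w = - ord Q s"
      unfolding w_def using ord_inverse[OF Q_place] by (simp add: add.commute)
    then show ?thesis
      unfolding val_ge_def using ord_s_le by auto
  qed
  ultimately show ?thesis
    by blast
qed

theorem weak_approximation:
  assumes finite_T: "finite T" and T_subset_places: "T \<subseteq> places K"
  shows "\<exists>z. \<forall>R\<in>T. z - b R \<in> val_ge R m"
proof -
  define M where "M = nat (\<bar>m\<bar> + (\<Sum>R\<in>T. \<Sum>P\<in>T. \<bar>ord R (b P)\<bar>))"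
  have "\<exists>w. w - 1 \<in> val_ge P (int M) \<and> (\<forall>R\<in>T - {P}. w \<in> val_ge R (int M))" if "P \<in> T" for P
    using approximate_indicator[of "T - {P}" P M] finite_T T_subset_places that by blast
  then obtain w where w_minus_1_in_val_ge: "\<And>P. P \<in> T \<Longrightarrow> w P - 1 \<in> val_ge P (int M)"
    and w_in_val_ge: "\<And>P R. P \<in> T \<Longrightarrow> R \<in> T - {P} \<Longrightarrow> w P \<in> val_ge R (int M)"
    by metis
  have times_b: "a * b P \<in> val_ge R m" if "R \<in> T" "P \<in> T" "a \<in> val_ge R (int M)" for R P a
  proof -
    have "\<bar>ord R (b P)\<bar> \<le> (\<Sum>P\<in>T. \<bar>ord R (b P)\<bar>)"
      using finite_T that(2) by (intro member_le_sum) auto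
    also have "\<dots> \<le> (\<Sum>R\<in>T. \<Sum>P\<in>T. \<bar>ord R (b P)\<bar>)"
      using finite_T that(1) by (intro member_le_sum sum_nonneg) auto
    finally have "m \<le> int M + ord R (b P)"
      unfolding M_def by linarith
    then show ?thesis
      using val_ge_mult[of R a "int M" "b P", OF _ that(3) mem_val_ge_ord] val_ge_mono that(1)
        T_subset_places by blast
  qed
  have "(\<Sum>P\<in>T. w P * b P) - b R \<in> val_ge R m" if R_in_T: "R \<in> T" for R
  proof -
    have "(w R - 1) * b R + (\<Sum>P\<in>T - {R}. w P * b P) \<in> val_ge R m"
      using R_in_T T_subset_places w_minus_1_in_val_ge w_in_val_ge
      by (intro submodule_add[OF submodule_val_ge] submodule_sum[OF submodule_val_ge] times_b) auto
    then show ?thesis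
      using R_in_T finite_T by (simp add: sum.remove algebra_simps)
  qed
  then show ?thesis
    by blast
qed

lemma INT_val_ge_approximation:
  assumes finite_T: "finite T" and T_subset_places: "T \<subseteq> places K" and P_in_T: "P \<in> T"
    and z_in_val_ge: "z \<in> val_ge P (m P)"
  shows "\<exists>v\<in>(\<Inter>R\<in>T. val_ge R (m R)). z - v \<in> val_ge P k"
proof -
  have P_place: "P \<in> places K"
    using P_in_T T_subset_places by blast
  define M where "M = \<bar>k\<bar> + (\<Sum>R\<in>T. \<bar>m R\<bar>)"
  have m_le_M: "m R \<le> M" if "R \<in> T" for R
    unfolding M_def using member_le_sum[OF that, of "\<lambda>R. \<bar>m R\<bar>"] finite_T by fastforce
  have "k \<le> M"
    unfolding M_def using sum_nonneg[of T "\<lambda>R. \<bar>m R\<bar>"] by linarith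
  obtain v where v_approximates: "\<forall>R\<in>T. v - (if R = P then z else 0) \<in> val_ge R M"
    using weak_approximation[OF finite_T T_subset_places, of "\<lambda>R. if R = P then z else 0" M] by blast
  then have v_minus_z_in_val_ge: "v - z \<in> val_ge P M"
    using P_in_T by auto
  have "v \<in> val_ge R (m R)" if R_in_T: "R \<in> T" for R
  proof (cases "R = P")
    case True
    have "(v - z) + z \<in> val_ge P (m P)"
      using v_minus_z_in_val_ge z_in_val_ge val_ge_mono[OF m_le_M[OF P_in_T]]
      by (intro submodule_add[OF submodule_val_ge[OF P_place]]) auto
    then show ?thesis
      using True by simp
  next
    case False
    then have "v \<in> val_ge R M"
      using bspec[OF v_approximates R_in_T] by simp
    then show ?thesis
      using val_ge_mono[OF m_le_M[OF R_in_T]] by blast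
  qed
  moreover have "z - v \<in> val_ge P k"
    using submodule_uminus[OF submodule_val_ge[OF P_place] v_minus_z_in_val_ge] val_ge_mono[OF \<open>k \<le> M\<close>]
    by auto
  ultimately show ?thesis
    by blast
qed

lemma has_dim_INT_val_ge_upd:
  assumes finite_T: "finite T" and T_subset_places: "T \<subseteq> places K" and P_in_T: "P \<in> T"
    and m_le_k: "m P \<le> k"
  shows "has_dim K (\<Inter>R\<in>T. val_ge R (m R)) (\<Inter>R\<in>T. val_ge R ((m(P := k)) R))
    (nat (k - m P) * place_degree K P)"
proof -
  let ?V = "\<Inter>R\<in>T. val_ge R (m R)"
  have P_place: "P \<in> places K"
    using P_in_T T_subset_places by blast
  have submodule_V: "submodule K ?V"
    using T_subset_places by (intro submodule_INT submodule_val_ge) auto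
  have split_P: "(\<Inter>R\<in>T. val_ge R (f R)) = val_ge P (f P) \<inter> (\<Inter>R\<in>T - {P}. val_ge R (f R))" for f
    using P_in_T by blast
  have "has_dim K ?V (?V \<inter> val_ge P k) (nat (k - m P) * place_degree K P)"
    using P_in_T m_le_k INT_val_ge_approximation[OF finite_T T_subset_places P_in_T, of _ m k]
    by (intro has_dim_Int[OF submodule_V submodule_val_ge _ _ has_dim_val_ge] P_place) auto
  moreover have "?V \<inter> val_ge P k = (\<Inter>R\<in>T. val_ge R ((m(P := k)) R))"
    unfolding split_P using val_ge_mono[OF m_le_k, of P] by auto
  ultimately show ?thesis
    by (simp only:)
qed

lemma has_dim_INT_val_ge:
  assumes finite_T: "finite T" and T_subset_places: "T \<subseteq> places K" and m_le_e: "\<And>R. R \<in> T \<Longrightarrow> m R \<le> e R"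
  shows "has_dim K (\<Inter>R\<in>T. val_ge R (m R)) (\<Inter>R\<in>T. val_ge R (e R))
    (\<Sum>R\<in>T. nat (e R - m R) * place_degree K R)"
proof -
  define f where "f S R = (if R \<in> S then e R else m R)" for S R
  define V where "V S = (\<Inter>R\<in>T. val_ge R (f S R))" for S
  have submodule_V: "submodule K (V S)" for S
    unfolding V_def using T_subset_places by (intro submodule_INT submodule_val_ge) auto
  have V_mono: "V S' \<subseteq> V S" if "S \<subseteq> S'" for S S'
    unfolding V_def f_def using that m_le_e by (intro INT_anti_mono val_ge_mono) auto
  have "has_dim K (V {}) (V S) (\<Sum>R\<in>S. nat (e R - m R) * place_degree K R)" if "S \<subseteq> T" for S
    using finite_subset[OF that finite_T] that
  proof (induction S rule: finite_induct)
    case empty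
    then show ?case
      using has_dim_self[OF submodule_V] by simp
  next
    case (insert P S)
    have "f S P = m P" "(f S)(P := e P) = f (insert P S)"
      using insert.hyps(2) by (auto simp: f_def)
    then have "has_dim K (V S) (V (insert P S)) (nat (e P - m P) * place_degree K P)"
      using has_dim_INT_val_ge_upd[OF finite_T T_subset_places, of P "f S" "e P"] insert.prems m_le_e
      unfolding V_def by simp
    then have "has_dim K (V {}) (V (insert P S))
        ((\<Sum>R\<in>S. nat (e R - m R) * place_degree K R) + nat (e P - m P) * place_degree K P)"
      using insert.IH insert.prems by (intro has_dim_trans[OF submodule_V V_mono V_mono]) auto
    then show ?case
      using insert.hyps by (simp add: add.commute)
  qed
  from this[of T] show ?thesis
    unfolding V_def f_def by (simp cong: INF_cong)
qed

lemma sum_ord_zeros_le_degree: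
  assumes finite_S: "finite S" and S_subset_places: "S \<subseteq> places K" and y_nonzero: "y \<noteq> 0"
    and y_in_max_ideal: "\<And>R. R \<in> S \<Longrightarrow> y \<in> max_ideal R"
    and degree_over_y: "has_dim (rat_fun_field K y) UNIV {0} n"
  shows "(\<Sum>R\<in>S. nat (ord R y) * place_degree K R) \<le> n"
proof -
  have place: "R \<in> places K" if "R \<in> S" for R
    using that S_subset_places by blast
  have "subring (\<Inter>S)"
    using place_subring[OF place] unfolding subring_def by blast
  moreover have "K \<subseteq> \<Inter>S" "y \<in> \<Inter>S"
    using K_subset_place[OF place] y_in_max_ideal max_ideal_subset by blast+
  ultimately obtain d where d_le_n: "d \<le> n" and has_dim_Inter_mod_times: "has_dim K (\<Inter>S) ((*) y ` \<Inter>S) d"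
    using has_dim_mod_times y_nonzero degree_over_y by blast
  have "val_ge R (ord R y) = (*) y ` R" if "R \<in> S" for R
    using times_image_val_ge[OF place[OF that] y_nonzero, of 0] val_ge_0[OF place[OF that]] by simp
  then have "(*) y ` \<Inter>S = (\<Inter>R\<in>S. val_ge R (ord R y))"
    by (intro set_eqI) (simp add: mem_times_image_iff[OF y_nonzero])
  moreover have "\<Inter>S = (\<Inter>R\<in>S. val_ge R 0)"
    using val_ge_0[OF place] by simp
  moreover have "0 \<le> ord R y" if "R \<in> S" for R
    using ord_pos_iff[OF place y_nonzero] y_in_max_ideal that by force
  ultimately have "has_dim K (\<Inter>S) ((*) y ` \<Inter>S) (\<Sum>R\<in>S. nat (ord R y - 0) * place_degree K R)"
    using has_dim_INT_val_ge[OF finite_S S_subset_places, of "\<lambda>_. 0" "\<lambda>R. ord R y"] by simp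
  moreover have "submodule K ((*) y ` \<Inter>S)"
    using submodule_place[OF place] submodule_INT[of S K "\<lambda>R. R"] by (auto intro: submodule_times_image)
  ultimately have "(\<Sum>R\<in>S. nat (ord R y) * place_degree K R) = d"
    using has_dim_unique has_dim_Inter_mod_times by simp
  then show ?thesis
    using d_le_n by simp
qed

lemma finite_zeros:
  assumes y_nonzero: "y \<noteq> 0"
  shows "finite {R \<in> places K. y \<in> max_ideal R}"
proof (rule ccontr)
  let ?Z = "{R \<in> places K. y \<in> max_ideal R}"
  assume infinite: "infinite ?Z"
  then obtain R where "R \<in> places K" "y \<in> max_ideal R"
    using infinite_imp_nonempty by blast
  then obtain n where degree_over_y: "has_dim (rat_fun_field K y) UNIV {0} n"
    using has_dim_over_rat_fun_field_exists transcendental_over_max_ideal y_nonzero by blast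
  obtain S where S_subset_Z: "S \<subseteq> ?Z" and finite_S: "finite S" and card_S_eq: "card S = Suc n"
    using infinite_arbitrarily_large[OF infinite] by blast
  have "card S = (\<Sum>R\<in>S. 1)"
    by simp
  also have "\<dots> \<le> (\<Sum>R\<in>S. nat (ord R y) * place_degree K R)"
  proof (rule sum_mono)
    fix R assume "R \<in> S"
    then have "ord R y > 0" "place_degree K R > 0"
      using S_subset_Z ord_pos_iff[OF _ y_nonzero] place_degree_pos by auto
    then show "1 \<le> nat (ord R y) * place_degree K R"
      by (simp add: Suc_le_eq)
  qed
  also have "\<dots> \<le> n"
    using S_subset_Z finite_S by (intro sum_ord_zeros_le_degree[OF _ _ y_nonzero _ degree_over_y]) auto
  finally show False
    using card_S_eq by simp
qed

lemma finite_poles: "finite {R \<in> places K. z \<notin> R}"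
proof (cases "z = 0")
  case True
  then have "{R \<in> places K. z \<notin> R} = {}"
    using place_0 by auto
  then show ?thesis
    by (metis finite.emptyI)
next
  case False
  have "{R \<in> places K. z \<notin> R} \<subseteq> {R \<in> places K. inverse z \<in> max_ideal R}"
    using inverse_in_max_ideal by auto
  then show ?thesis
    using finite_zeros[of "inverse z"] False finite_subset by auto
qed

end

section \<open>Existence of zeros and poles\<close>

lemma one_minus_times_power_in_lincombs:
  assumes subring_S: "subring S" and w_in_S: "w \<in> S" and w_times_z: "w * z = 1"
    and y_times_y': "y * y' = 1"
    and b_in_S: "\<forall>i\<in>{..<Suc k}. b i \<in> S" and z_eq: "z = (\<Sum>i<Suc k. b i * y' ^ i)"
    and k_le_Suc: "k \<le> Suc n"
  shows "(1 - w * b 0) * y ^ Suc n \<in> lincombs S {..<Suc n} (\<lambda>i. y ^ i)"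
proof -
  let ?U = "lincombs S {..<Suc n} (\<lambda>i. y ^ i)"
  have submodule_U: "submodule S ?U"
    by (rule submodule_lincombs[OF subring_S])
  have powers: "y ^ i \<in> ?U" if "i \<le> n" for i
    using that by (intro basis_in_lincombs[OF subring_S]) auto
  have cancel: "y ^ Suc n * y' ^ Suc j = y ^ (n - j)" if "j < k" for j
  proof -
    have "y ^ Suc n = y ^ (n - j) * y ^ Suc j"
      using that k_le_Suc by (simp flip: power_add del: power_Suc)
    then show ?thesis
      using y_times_y' by (simp add: mult.assoc del: power_Suc flip: power_mult_distrib)
  qed
  have "(z - b 0) * y ^ Suc n = (\<Sum>j<k. b (Suc j) * y' ^ Suc j) * y ^ Suc n"
    unfolding z_eq sum.lessThan_Suc_shift by simp
  also have "\<dots> = (\<Sum>j<k. b (Suc j) * (y ^ Suc n * y' ^ Suc j))"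
    by (simp only: sum_distrib_right mult.assoc mult.commute[of "y ^ Suc n"])
  also have "\<dots> = (\<Sum>j<k. b (Suc j) * y ^ (n - j))"
    using cancel by (intro sum.cong) auto
  also have "\<dots> \<in> ?U"
    using b_in_S powers by (intro submodule_lincomb[OF submodule_U]) auto
  finally have "w * ((z - b 0) * y ^ Suc n) \<in> ?U"
    by (rule submodule_smult[OF submodule_U w_in_S])
  moreover have "w * ((z - b 0) * y ^ Suc n) = (1 - w * b 0) * y ^ Suc n"
    unfolding mult.assoc[symmetric] right_diff_distrib w_times_z ..
  ultimately show ?thesis
    by (simp only:)
qed

lemma lincombs_powers_reduce:
  assumes subring_S: "subring S" and w_in_S: "w \<in> S" and w_times_z: "w * z = 1"
    and y_times_y': "y * y' = 1"
    and z_in_lincombs_y: "z \<in> lincombs S {..<Suc (Suc n)} (\<lambda>i. y ^ i)"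
    and z_in_lincombs_y': "z \<in> lincombs S {..<Suc k} (\<lambda>i. y' ^ i)"
    and k_le_Suc: "k \<le> Suc n"
  shows "z \<in> lincombs S {..<Suc n} (\<lambda>i. y ^ i)"
proof -
  let ?U = "lincombs S {..<Suc n} (\<lambda>i. y ^ i)"
  have submodule_U: "submodule S ?U"
    by (rule submodule_lincombs[OF subring_S])
  have powers: "y ^ i \<in> ?U" if "i \<le> n" for i
    using that by (intro basis_in_lincombs[OF subring_S]) auto
  obtain a where a_in_S: "\<forall>i\<in>{..<Suc (Suc n)}. a i \<in> S"
    and z_eq_sum_y: "z = (\<Sum>i<Suc (Suc n). a i * y ^ i)"
    using z_in_lincombs_y by (rule lincombsE)
  obtain b where b_in_S: "\<forall>i\<in>{..<Suc k}. b i \<in> S" and z_eq_sum_y': "z = (\<Sum>i<Suc k. b i * y' ^ i)"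
    using z_in_lincombs_y' by (rule lincombsE)
  have b_0_in_S: "b 0 \<in> S"
    using b_in_S by simp
  have top_term_in_U: "(1 - w * b 0) * y ^ Suc n \<in> ?U"
    by (rule one_minus_times_power_in_lincombs[OF subring_S w_in_S w_times_z y_times_y' b_in_S
      z_eq_sum_y' k_le_Suc])
  have "z = b 0 + (1 - w * b 0) * z"
    using w_times_z by (simp add: algebra_simps)
  also have "\<dots> = b 0 * y ^ 0 + ((1 - w * b 0) * (\<Sum>i<Suc n. a i * y ^ i) +
      a (Suc n) * ((1 - w * b 0) * y ^ Suc n))"
    unfolding z_eq_sum_y sum.lessThan_Suc[of _ "Suc n"]
    by (simp only: distrib_left mult_ac power_0 mult_1_left mult_1_right)
  also have "\<dots> \<in> ?U"
  proof -
    have "1 - w * b 0 \<in> S"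
      by (intro subring_diff subring_1 subring_mult subring_S w_in_S b_0_in_S)
    moreover have "(\<Sum>i<Suc n. a i * y ^ i) \<in> ?U"
      using a_in_S by (intro lincombsI) auto
    ultimately have "(1 - w * b 0) * (\<Sum>i<Suc n. a i * y ^ i) \<in> ?U"
      by (rule submodule_smult[OF submodule_U])
    moreover have "b 0 * y ^ 0 \<in> ?U"
      by (rule submodule_smult[OF submodule_U b_0_in_S powers]) simp
    moreover have "a (Suc n) * ((1 - w * b 0) * y ^ Suc n) \<in> ?U"
      using a_in_S by (intro submodule_smult[OF submodule_U _ top_term_in_U]) auto
    ultimately show ?thesis
      by (intro submodule_add[OF submodule_U])
  qed
  finally show ?thesis .
qed

lemma lincombs_powers_inverse_imp_mem:
  assumes subring_S: "subring S" and w_in_S: "w \<in> S" and w_times_z: "w * z = 1" and "y * y' = 1"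
    and "z \<in> lincombs S {..<n} (\<lambda>i. y ^ i)" "z \<in> lincombs S {..<m} (\<lambda>i. y' ^ i)"
  shows "z \<in> S"
  using assms(4-)
proof (induction "n + m" arbitrary: n m y y' rule: less_induct)
  case less
  show ?case
  proof (rule ccontr)
    assume notin: "z \<notin> S"
    have ge_2: "\<exists>k. n = Suc (Suc k)" if "z \<in> lincombs S {..<n} (\<lambda>i. y ^ i)" for n y
    proof (rule ccontr)
      assume "\<nexists>k. n = Suc (Suc k)"
      then have "n = 0 \<or> n = 1"
        by (metis One_nat_def not0_implies_Suc)
      then show False
        using that notin subring_S by (auto elim!: lincombsE simp: subring_0)
    qed
    obtain k l where n_eq: "n = Suc (Suc k)" and m_eq: "m = Suc (Suc l)"
      using ge_2 less.prems by metis
    show False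
    proof (cases "m \<le> n")
      case True
      then have "z \<in> lincombs S {..<Suc k} (\<lambda>i. y ^ i)"
        using lincombs_powers_reduce[OF subring_S w_in_S w_times_z less.prems(1), of k "Suc l"]
          less.prems(2,3) n_eq m_eq by simp
      then show False
        using less.hyps[of "Suc k" m y y'] less.prems n_eq m_eq notin by simp
    next
      case False
      then have "z \<in> lincombs S {..<Suc l} (\<lambda>i. y' ^ i)"
        using lincombs_powers_reduce[OF subring_S w_in_S w_times_z, of y' y l "Suc k"] less.prems n_eq
          m_eq by (simp add: mult.commute)
      then show False
        using less.hyps[of n "Suc l" y y'] less.prems n_eq m_eq notin by simp
    qed
  qed
qed

context base_field
begin

lemma inverse_notin_polys_over:
  assumes "transcendental_over K w"
  shows "inverse w \<notin> polys_over K w"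
proof
  assume "inverse w \<in> polys_over K w"
  then obtain p where coeff_in_K: "\<forall>k. coeff p k \<in> K" and inverse_w_eq: "inverse w = poly p w"
    by (rule polys_overE)
  have "coeff (pCons (- 1) p) k \<in> K" for k
    using coeff_in_K K_1 K_uminus by (auto simp: coeff_pCons split: nat.splits)
  moreover have "poly (pCons (- 1) p) w = 0"
    using transcendental_over_nonzero[OF assms] by (simp flip: inverse_w_eq)
  ultimately show False
    using transcendental_overD[OF assms] by fastforce
qed

lemma maximal_subring_avoiding:
  assumes "subring S0" "K \<subseteq> S0" "z \<notin> S0"
  obtains S where "subring S" "S0 \<subseteq> S" "z \<notin> S" "\<And>T. subring T \<Longrightarrow> S \<subseteq> T \<Longrightarrow> z \<notin> T \<Longrightarrow> T = S"
proof -
  define \<T> where "\<T> = {S. subring S \<and> S0 \<subseteq> S \<and> z \<notin> S}"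
  have "\<exists>S\<in>\<T>. \<forall>X\<in>\<T>. S \<subseteq> X \<longrightarrow> X = S"
  proof (rule subset_Zorn_nonempty)
    show "\<T> \<noteq> {}"
      unfolding \<T>_def using assms by blast
    fix C assume C_nonempty: "C \<noteq> {}" and C_chain: "subset.chain \<T> C"
    have in_C: "subring S \<and> S0 \<subseteq> S \<and> z \<notin> S" if "S \<in> C" for S
      using that C_chain unfolding subset.chain_def \<T>_def by blast
    have common: "\<exists>D\<in>C. a \<in> D \<and> b \<in> D" if "a \<in> \<Union>C" "b \<in> \<Union>C" for a b
      using that C_chain unfolding subset.chain_def by blast
    have "a + b \<in> \<Union>C \<and> a * b \<in> \<Union>C \<and> - a \<in> \<Union>C" if a_in_Union: "a \<in> \<Union>C" and b_in_Union: "b \<in> \<Union>C" for a b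
    proof -
      obtain D where "D \<in> C" "a \<in> D" "b \<in> D"
        using common[OF a_in_Union b_in_Union] by blast
      then show ?thesis
        using in_C subring_add subring_mult subring_uminus by (meson UnionI)
    qed
    moreover obtain D where "D \<in> C"
      using C_nonempty by blast
    then have "0 \<in> \<Union>C" "1 \<in> \<Union>C"
      using in_C subring_0 subring_1 by blast+
    ultimately have "subring (\<Union>C)"
      unfolding subring_def by blast
    then show "\<Union>C \<in> \<T>"
      unfolding \<T>_def using C_nonempty in_C by blast
  qed
  then obtain S where S_in_family: "S \<in> \<T>" and "\<And>T. T \<in> \<T> \<Longrightarrow> S \<subseteq> T \<Longrightarrow> T = S"
    by blast
  then have "T = S" if "subring T" "S \<subseteq> T" "z \<notin> T" for T
    using that unfolding \<T>_def by blast
  then show thesis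
    using that S_in_family unfolding \<T>_def by blast
qed

text \<open>A maximal subring that contains \<open>K\<close> and \<open>w\<close> but not the inverse of \<open>w\<close> is a valuation ring.\<close>
lemma zero_exists:
  assumes transcendental_w: "transcendental_over K w"
  shows "\<exists>R\<in>places K. w \<in> max_ideal R"
proof -
  let ?z = "inverse w"
  have w_times_inverse: "w * ?z = 1"
    using transcendental_over_nonzero[OF transcendental_w] by simp
  obtain S where subring_S: "subring S" and polys_over_subset_S: "polys_over K w \<subseteq> S"
    and inverse_notin_S: "?z \<notin> S"
    and maximal: "\<And>T. subring T \<Longrightarrow> S \<subseteq> T \<Longrightarrow> ?z \<notin> T \<Longrightarrow> T = S"
    using maximal_subring_avoiding[OF subring_polys_over[OF subring_K] subset_polys_over[OF subring_K]
        inverse_notin_polys_over[OF transcendental_w]] by metis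
  have K_subset_S: "K \<subseteq> S" and w_in_S: "w \<in> S"
    using polys_over_subset_S subset_polys_over[OF subring_K] self_in_polys_over[OF subring_K] by blast+
  have "\<exists>n. ?z \<in> lincombs S {..<n} (\<lambda>i. y ^ i)" if "y \<notin> S" for y
    using maximal[OF subring_polys_over[OF subring_S] subset_polys_over[OF subring_S], of y] that
      self_in_polys_over[OF subring_S, of y] polys_over_imp_lincombs_powers by blast
  then have "y \<in> S \<or> inverse y \<in> S" for y
    using lincombs_powers_inverse_imp_mem[OF subring_S w_in_S w_times_inverse, of y "inverse y"]
      inverse_notin_S subring_0[OF subring_S]
    by (metis right_inverse)
  moreover have "K \<noteq> S"
    using w_in_S inverse_notin_S K_inverse by blast
  ultimately have "S \<in> places K"
    using subring_S inverse_notin_S K_subset_S unfolding places_def valuation_ring_def subring_def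
    by blast
  then show ?thesis
    using w_in_S inverse_notin_S unfolding max_ideal_def by blast
qed

lemma transcendental_over_inverse:
  assumes transcendental_z: "transcendental_over K z"
  shows "transcendental_over K (inverse z)"
proof (rule ccontr)
  assume "\<not> transcendental_over K (inverse z)"
  then obtain p where coeff_in_K: "\<forall>k. coeff p k \<in> K" and p_nonzero: "p \<noteq> 0"
    and root: "poly p (inverse z) = 0"
    by (rule not_transcendental_overE)
  then have "z \<in> polys_over K (inverse z)"
    using inverse_in_polys_over_if_root[OF p_nonzero coeff_in_K root] by simp
  then have powers: "z ^ i \<in> polys_over K (inverse z)" for i
    by (intro subring_power[OF subring_polys_over[OF subring_K]])
  have "spans_mod K (polys_over K (inverse z)) {0} {..<degree p} (\<lambda>i. inverse z ^ i)"
    using polys_over_subset_lincombs_powers[OF p_nonzero coeff_in_K root] unfolding spans_mod_0_iff .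
  then show False
    using not_transcendental_over_if_spans[OF finite_lessThan _ powers] transcendental_z by metis
qed

lemma pole_exists:
  assumes "transcendental_over K z"
  shows "\<exists>R\<in>places K. z \<notin> R"
  using zero_exists[OF transcendental_over_inverse[OF assms]] transcendental_over_nonzero[OF assms]
  unfolding max_ideal_def by auto

end

section \<open>Divisors and Riemann--Roch spaces\<close>

definition principal_div :: "'f::field set \<Rightarrow> 'f \<Rightarrow> 'f set \<Rightarrow> int" where
  "principal_div K z = (\<lambda>R. if R \<in> places K then ord R z else 0)"

definition pole_div :: "'f::field set \<Rightarrow> 'f \<Rightarrow> 'f set \<Rightarrow> int" where
  "pole_div K z = (\<lambda>R. if R \<in> places K \<and> z \<notin> R then - ord R z else 0)"

abbreviation smult_div :: "int \<Rightarrow> ('p \<Rightarrow> int) \<Rightarrow> 'p \<Rightarrow> int" (infixr "\<cdot>" 75) where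
  "m \<cdot> D \<equiv> (\<lambda>R. m * D R)"

lemma sum_fun_apply: "(\<Sum>i\<in>A. f i) x = (\<Sum>i\<in>A. f i x)"
  by (induction A rule: infinite_finite_induct) auto

lemma place_div_nonneg: "0 \<le> place_div R"
  by (simp add: le_fun_def place_div_def)

lemma divisor_finite_support: "divisor K D \<Longrightarrow> finite {R. D R \<noteq> 0}"
  unfolding divisor_def by blast

lemma divisor_support: "divisor K D \<Longrightarrow> D R \<noteq> 0 \<Longrightarrow> R \<in> places K"
  unfolding divisor_def by blast

lemma divisorI:
  assumes "finite S" "S \<subseteq> places K" "\<And>R. D R \<noteq> 0 \<Longrightarrow> R \<in> S"
  shows "divisor K D"
  unfolding divisor_def using assms by (auto intro: finite_subset[of _ S])

lemma div_deg_eq_sum: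
  assumes "finite S" "\<And>R. D R \<noteq> 0 \<Longrightarrow> R \<in> S"
  shows "div_deg K D = (\<Sum>R\<in>S. D R * int (place_degree K R))"
  unfolding div_deg_def by (rule sum.mono_neutral_left) (use assms in auto)

lemma
  assumes "divisor K A" "divisor K B"
  shows divisor_lincomb: "divisor K (\<lambda>R. a * A R + b * B R)"
    and div_deg_lincomb: "div_deg K (\<lambda>R. a * A R + b * B R) = a * div_deg K A + b * div_deg K B"
proof -
  let ?S = "{R. A R \<noteq> 0} \<union> {R. B R \<noteq> 0}"
  have finite_S: "finite ?S" and "?S \<subseteq> places K"
    using assms divisor_finite_support divisor_support by blast+
  then show "divisor K (\<lambda>R. a * A R + b * B R)"
    by (rule divisorI) auto
  have "div_deg K (\<lambda>R. a * A R + b * B R) = (\<Sum>R\<in>?S. (a * A R + b * B R) * int (place_degree K R))"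
    by (rule div_deg_eq_sum[OF finite_S]) auto
  moreover have "div_deg K A = (\<Sum>R\<in>?S. A R * int (place_degree K R))"
    by (rule div_deg_eq_sum[OF finite_S]) auto
  moreover have "div_deg K B = (\<Sum>R\<in>?S. B R * int (place_degree K R))"
    by (rule div_deg_eq_sum[OF finite_S]) auto
  ultimately show "div_deg K (\<lambda>R. a * A R + b * B R) = a * div_deg K A + b * div_deg K B"
    by (simp add: sum_distrib_left sum.distrib algebra_simps)
qed

lemma
  assumes "divisor K A" "divisor K B"
  shows divisor_add: "divisor K (A + B)" and div_deg_add: "div_deg K (A + B) = div_deg K A + div_deg K B"
  using divisor_lincomb[OF assms, of 1 1] div_deg_lincomb[OF assms, of 1 1]
  by (simp_all add: plus_fun_def)

lemma
  assumes "divisor K A" "divisor K B"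
  shows divisor_diff: "divisor K (A - B)"
    and div_deg_diff: "div_deg K (A - B) = div_deg K A - div_deg K B"
  using divisor_lincomb[OF assms, of 1 "- 1"] div_deg_lincomb[OF assms, of 1 "- 1"]
  by (simp_all add: fun_diff_def)

lemma
  assumes "divisor K A"
  shows divisor_smult: "divisor K (m \<cdot> A)"
    and div_deg_smult: "div_deg K (m \<cdot> A) = m * div_deg K A"
  using divisor_lincomb[OF assms assms, of m 0] div_deg_lincomb[OF assms assms, of m 0] by simp_all

lemma divisor_0: "divisor K 0"
  unfolding divisor_def by simp

lemma div_deg_0: "div_deg K 0 = 0"
  unfolding div_deg_def by simp

lemma divisor_sum: "(\<And>i. i \<in> S \<Longrightarrow> divisor K (D i)) \<Longrightarrow> divisor K (\<Sum>i\<in>S. D i)"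
  by (induction S rule: infinite_finite_induct)
    (auto intro: divisor_0 divisor_add simp flip: zero_fun_def)

lemma div_deg_sum:
  "(\<And>i. i \<in> S \<Longrightarrow> divisor K (D i)) \<Longrightarrow> div_deg K (\<Sum>i\<in>S. D i) = (\<Sum>i\<in>S. div_deg K (D i))"
  by (induction S rule: infinite_finite_induct) (auto simp: div_deg_0 div_deg_add divisor_sum)

lemma divisor_place_div: "R \<in> places K \<Longrightarrow> divisor K (place_div R)"
  by (rule divisorI[of "{R}"]) (auto simp: place_div_def split: if_splits)

lemma div_deg_place_div: "div_deg K (place_div R) = int (place_degree K R)"
proof -
  have "div_deg K (place_div R) = (\<Sum>S\<in>{R}. place_div R S * int (place_degree K S))"
    by (rule div_deg_eq_sum) (simp_all add: place_div_def split: if_splits)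
  then show ?thesis
    by (simp add: place_div_def)
qed

lemma div_deg_nonneg: "0 \<le> D \<Longrightarrow> 0 \<le> div_deg K D"
  unfolding div_deg_def by (intro sum_nonneg) (auto simp: le_fun_def)

lemma mem_RR_space_iff: "z \<in> RR_space K A \<longleftrightarrow> (\<forall>R\<in>places K. z \<in> val_ge R (- A R))"
  unfolding RR_space_def val_ge_def by auto

lemma RR_space_mono: "A \<le> B \<Longrightarrow> RR_space K A \<subseteq> RR_space K B"
  unfolding mem_RR_space_iff subset_iff le_fun_def using val_ge_mono by (meson neg_le_iff_le subsetD)

lemma RR_space_Int_val_ge:
  assumes "R \<in> places K" "A \<le> B" "\<And>S. S \<noteq> R \<Longrightarrow> B S = A S"
  shows "RR_space K B \<inter> val_ge R (- A R) = RR_space K A"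
proof (intro equalityI subsetI)
  fix z assume z_in_RR_space: "z \<in> RR_space K B \<inter> val_ge R (- A R)"
  have "z \<in> val_ge S (- A S)" if "S \<in> places K" for S
  proof (cases "S = R")
    case False
    then show ?thesis
      using z_in_RR_space that assms(3)[OF False] unfolding mem_RR_space_iff
      by (metis IntD1 mem_RR_space_iff)
  qed (use z_in_RR_space in simp)
  then show "z \<in> RR_space K A"
    unfolding mem_RR_space_iff by blast
next
  fix z assume "z \<in> RR_space K A"
  then show "z \<in> RR_space K B \<inter> val_ge R (- A R)"
    using RR_space_mono[OF assms(2)] assms(1) mem_RR_space_iff by blast
qed

context alg_function_field
begin

lemma submodule_RR_space: "submodule K (RR_space K A)"
proof -
  have "RR_space K A = (\<Inter>R\<in>places K. val_ge R (- A R))"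
    using mem_RR_space_iff by blast
  then show ?thesis
    by (simp add: submodule_INT submodule_val_ge)
qed

lemma times_image_RR_space:
  assumes y_nonzero: "y \<noteq> 0"
  shows "(*) y ` RR_space K A = RR_space K (A - principal_div K y)"
proof (rule set_eqI)
  fix z
  have "inverse y * z \<in> val_ge R (- A R) \<longleftrightarrow> z \<in> val_ge R (- (A - principal_div K y) R)"
    if "R \<in> places K" for R
    using times_image_val_ge[OF that y_nonzero, of "- A R"] that
    by (simp add: principal_div_def flip: mem_times_image_iff[OF y_nonzero])
  then show "z \<in> (*) y ` RR_space K A \<longleftrightarrow> z \<in> RR_space K (A - principal_div K y)"
    unfolding mem_times_image_iff[OF y_nonzero] mem_RR_space_iff by simp
qed

lemma principal_div_eq:
  assumes z_nonzero: "z \<noteq> 0"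
  shows "principal_div K z = pole_div K (inverse z) - pole_div K z"
proof
  fix R
  show "principal_div K z R = (pole_div K (inverse z) - pole_div K z) R"
  proof (cases "R \<in> places K")
    case True
    then have "0 \<le> ord R z \<longleftrightarrow> z \<in> R" "ord R z \<le> 0 \<longleftrightarrow> inverse z \<in> R"
      using ord_nonneg_iff[OF True, of "inverse z"] ord_nonneg_iff[OF True z_nonzero]
        ord_inverse[OF True z_nonzero] z_nonzero by auto
    then show ?thesis
      using True ord_inverse[OF True z_nonzero] by (simp add: principal_div_def pole_div_def) linarith
  qed (simp add: principal_div_def pole_div_def)
qed

lemma pole_div_nonneg: "0 \<le> pole_div K z"
proof (rule le_funI)
  fix R
  show "0 R \<le> pole_div K z R"
  proof (cases "R \<in> places K \<and> z \<notin> R")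
    case True
    then have "z \<noteq> 0"
      using place_0 by auto
    then show ?thesis
      using True ord_nonneg_iff[of R z] by (simp add: pole_div_def)
  qed (auto simp: pole_div_def)
qed

lemma divisor_pole_div: "divisor K (pole_div K z)"
  by (rule divisorI[OF finite_poles[of z]]) (auto simp: pole_div_def split: if_splits)

lemma divisor_principal_div: "z \<noteq> 0 \<Longrightarrow> divisor K (principal_div K z)"
  by (simp add: principal_div_eq divisor_diff divisor_pole_div)

lemma power_in_val_ge_pole_div:
  assumes R_place: "R \<in> places K" and "j \<le> m"
  shows "z ^ j \<in> val_ge R (- (int m * pole_div K z R))"
proof (cases "z \<in> R")
  case True
  then have "z ^ j \<in> val_ge R 0"
    by (simp add: val_ge_0 place_power R_place)
  then show ?thesis
    using True by (simp add: pole_div_def)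
next
  case False
  then have "z \<noteq> 0"
    using place_0[OF R_place] by auto
  moreover have "int m * ord R z \<le> int j * ord R z"
    using assms(2) ord_nonneg_iff[OF R_place \<open>z \<noteq> 0\<close>] False by (intro mult_right_mono_neg) auto
  ultimately show ?thesis
    using False R_place ord_power[OF R_place] unfolding val_ge_def pole_div_def by simp
qed

lemma has_dim_RR_space_add_place:
  assumes R_place: "R \<in> places K" and has_dim_RR_space: "has_dim K (RR_space K A) {0} d"
  shows "\<exists>d'\<le>d + place_degree K R. has_dim K (RR_space K (A + place_div R)) {0} d'"
proof -
  let ?B = "A + place_div R"
  have A_le_B: "A \<le> ?B"
    using place_div_nonneg by simp
  have "has_dim K (val_ge R (- A R - 1)) (val_ge R (- A R)) (place_degree K R)"
    using has_dim_val_ge[OF R_place, of "- A R - 1" "- A R"] by simp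
  moreover have "RR_space K ?B \<subseteq> val_ge R (- A R - 1)"
    using R_place by (auto simp: mem_RR_space_iff place_div_def dest!: bspec)
  moreover have "RR_space K ?B \<inter> val_ge R (- A R) = RR_space K A"
    by (rule RR_space_Int_val_ge[OF R_place A_le_B]) (simp add: place_div_def)
  ultimately obtain e where e_le_place_degree: "e \<le> place_degree K R"
    and has_dim_quotient: "has_dim K (RR_space K ?B) (RR_space K A) e"
    using has_dim_embed[OF submodule_RR_space submodule_RR_space submodule_val_ge[OF R_place]] by blast
  have "has_dim K (RR_space K ?B) {0} (e + d)"
    using RR_space_mono[OF A_le_B] submodule_0[OF submodule_RR_space]
    by (intro has_dim_trans[OF submodule_RR_space _ _ has_dim_quotient has_dim_RR_space]) auto
  then show ?thesis
    using e_le_place_degree by (intro exI[of _ "e + d"]) simp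
qed

lemma has_dim_RR_space_add_effective:
  assumes "divisor K D" "0 \<le> D" "has_dim K (RR_space K A) {0} d"
  shows "\<exists>d'. has_dim K (RR_space K (A + D)) {0} d' \<and> int d' \<le> int d + div_deg K D"
  using assms
proof (induction "nat (div_deg K D)" arbitrary: D rule: less_induct)
  case less
  show ?case
  proof (cases "D = 0")
    case True
    then have "A + D = A" "div_deg K D = 0"
      using div_deg_0[of K] by simp_all
    then show ?thesis
      using less.prems(3) by auto
  next
    case False
    then obtain R where D_R_nonzero: "D R \<noteq> 0" and R_place: "R \<in> places K"
      using divisor_support[OF less.prems(1)] by (auto simp: fun_eq_iff)
    define D' where "D' = D - place_div R"
    have divisor_D': "divisor K D'"
      and div_deg_D_eq: "div_deg K D = div_deg K D' + int (place_degree K R)"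
      using less.prems(1) R_place
      by (simp_all add: D'_def divisor_diff divisor_place_div div_deg_diff div_deg_place_div)
    have "0 \<le> D' S" for S
      using less.prems(2)[THEN le_funD, of S] D_R_nonzero
      by (cases "S = R") (simp_all add: D'_def place_div_def)
    then have "0 \<le> D'"
      by (simp add: le_fun_def)
    moreover from this have "nat (div_deg K D') < nat (div_deg K D)"
      using div_deg_nonneg[of D' K] div_deg_D_eq place_degree_pos[OF R_place] by simp
    ultimately obtain d' where has_dim_RR_space_D': "has_dim K (RR_space K (A + D')) {0} d'"
      and d'_le: "int d' \<le> int d + div_deg K D'"
      using less.hyps divisor_D' less.prems(3) by blast
    obtain e where "e \<le> d' + place_degree K R" "has_dim K (RR_space K (A + D' + place_div R)) {0} e"
      using has_dim_RR_space_add_place[OF R_place has_dim_RR_space_D'] by blast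
    moreover have "A + D' + place_div R = A + D"
      by (simp add: D'_def)
    ultimately show ?thesis
      using d'_le div_deg_D_eq by (intro exI[of _ e]) simp
  qed
qed

lemma has_dim_RR_space_0:
  assumes R_place: "R \<in> places K"
  shows "\<exists>d\<le>place_degree K R. has_dim K (RR_space K 0) {0} d"
proof (rule has_dim_embed[OF submodule_RR_space submodule_singleton_0])
  show "submodule K (max_ideal R)"
    by (rule submodule_max_ideal[OF R_place])
  show "has_dim K R (max_ideal R) (place_degree K R)"
    by (rule has_dim_residue_field[OF R_place])
  show "RR_space K 0 \<subseteq> R"
    using R_place val_ge_0 by (auto simp: mem_RR_space_iff)
  show "RR_space K 0 \<inter> max_ideal R \<subseteq> {0}"
  proof (intro subsetI, rule ccontr)
    fix z assume z_in_RR_space: "z \<in> RR_space K 0 \<inter> max_ideal R" and "z \<notin> {0}"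
    then obtain S where "S \<in> places K" "z \<notin> S"
      using pole_exists[OF transcendental_over_max_ideal[OF R_place]] by blast
    then show False
      using z_in_RR_space val_ge_0 by (auto simp: mem_RR_space_iff)
  qed
qed

lemma ell_eqI: "has_dim K (RR_space K A) {0} d \<Longrightarrow> ell K A = d"
  unfolding ell_def by (rule kdim_eq[OF submodule_RR_space])

lemma has_dim_RR_space:
  assumes divisor_A: "divisor K A"
  shows "has_dim K (RR_space K A) {0} (ell K A)"
proof -
  define B where "B = (\<lambda>R. max 0 (A R))"
  have "divisor K B"
    using divisor_finite_support[OF divisor_A] divisor_support[OF divisor_A]
    by (intro divisorI[of "{R. A R \<noteq> 0}"]) (auto simp: B_def split: if_splits)
  moreover have "0 \<le> B" "A \<le> B"
    by (simp_all add: B_def le_fun_def)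
  moreover obtain R where "R \<in> places K"
    using transcendental_over_exists zero_exists by blast
  then obtain d where "has_dim K (RR_space K 0) {0} d"
    using has_dim_RR_space_0 by blast
  ultimately obtain d' where "has_dim K (RR_space K B) {0} d'"
    using has_dim_RR_space_add_effective[of B 0] by auto
  then obtain e where "has_dim K (RR_space K A) {0} e"
    using has_dim_embed[OF submodule_RR_space submodule_singleton_0 submodule_singleton_0]
      RR_space_mono[OF \<open>A \<le> B\<close>] by blast
  then show ?thesis
    using ell_eqI by blast
qed

lemma ell_0_le_place_degree: "R \<in> places K \<Longrightarrow> ell K 0 \<le> place_degree K R"
  using has_dim_RR_space_0 ell_eqI by blast

lemma ell_minus_deg_antimono:
  assumes divisor_A: "divisor K A" and divisor_B: "divisor K B" and A_le_B: "A \<le> B"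
  shows "int (ell K B) - div_deg K B \<le> int (ell K A) - div_deg K A"
proof -
  have "0 \<le> B - A"
    using A_le_B by (simp add: le_fun_def)
  then obtain d
    where "has_dim K (RR_space K (A + (B - A))) {0} d" "int d \<le> int (ell K A) + div_deg K (B - A)"
    using has_dim_RR_space_add_effective[OF divisor_diff[OF divisor_B divisor_A]]
      has_dim_RR_space[OF divisor_A] by blast
  then show ?thesis
    using ell_eqI div_deg_diff[OF divisor_B divisor_A] by simp
qed

lemma ell_diff_principal_div:
  assumes "y \<noteq> 0" "divisor K A"
  shows "ell K (A - principal_div K y) = ell K A"
  using has_dim_times_image[OF assms(1) has_dim_RR_space[OF assms(2)]]
  by (intro ell_eqI) (simp add: times_image_RR_space[OF assms(1)])

end

section \<open>Riemann's theorem\<close>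

lemma le_Greatest_int:
  fixes m :: int
  assumes "P m" "\<And>k. P k \<Longrightarrow> k \<le> b"
  shows "m \<le> (GREATEST k. P k)"
proof -
  obtain g where g_satisfies: "P g" and g_maximal: "\<And>k. P k \<Longrightarrow> nat (b - g) \<le> nat (b - k)"
    using ex_has_least_nat[of P m "\<lambda>k. nat (b - k)"] assms(1) by blast
  have "k \<le> g" if "P k" for k
    using g_satisfies g_maximal that assms(2) by (smt (verit) nat_le_eq_zle)
  then show ?thesis
    using Greatest_equality[of P g] g_satisfies assms(1) by auto
qed

context alg_function_field
begin

lemma div_deg_pole_div_le:
  assumes transcendental_y: "transcendental_over K y"
    and degree_over_y: "has_dim (rat_fun_field K y) UNIV {0} n"
  shows "div_deg K (pole_div K y) \<le> int n"
proof -
  let ?S = "{R \<in> places K. y \<notin> R}"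
  have nonzero: "y \<noteq> 0"
    by (rule transcendental_over_nonzero[OF transcendental_y])
  have "div_deg K (pole_div K y) = (\<Sum>R\<in>?S. pole_div K y R * int (place_degree K R))"
    by (rule div_deg_eq_sum[OF finite_poles]) (auto simp: pole_div_def split: if_splits)
  also have "\<dots> = int (\<Sum>R\<in>?S. nat (ord R (inverse y)) * place_degree K R)"
    unfolding of_nat_sum of_nat_mult
  proof (intro sum.cong refl)
    fix R assume "R \<in> ?S"
    then have "pole_div K y R = ord R (inverse y)"
      using ord_inverse[OF _ nonzero] by (simp add: pole_div_def)
    moreover from this have "0 \<le> ord R (inverse y)"
      using pole_div_nonneg[of y] by (simp add: le_fun_def) metis
    ultimately show "pole_div K y R * int (place_degree K R) =
        int (nat (ord R (inverse y))) * int (place_degree K R)"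
      by simp
  qed
  also have "\<dots> \<le> int n"
    using degree_over_y nonzero inverse_in_max_ideal
    by (intro of_nat_mono sum_ord_zeros_le_degree[OF finite_poles]) (auto simp: rat_fun_field_inverse)
  finally show ?thesis .
qed

lemma mem_val_ge_sum_pole_div:
  assumes "R \<in> places K" "finite A" "k \<in> A"
  shows "u k \<in> val_ge R (- (\<Sum>k\<in>A. pole_div K (u k)) R)"
proof -
  have "pole_div K (u k) R \<le> (\<Sum>k\<in>A. pole_div K (u k)) R"
    unfolding sum_fun_apply using assms pole_div_nonneg
    by (intro member_le_sum) (auto simp: le_fun_def)
  then show ?thesis
    using power_in_val_ge_pole_div[OF assms(1), of 1 1 "u k"]
      val_ge_mono[of "- (\<Sum>k\<in>A. pole_div K (u k)) R" "- pole_div K (u k) R" R]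
    by auto
qed

lemma ell_mult_pole_div_ge:
  assumes transcendental_y: "transcendental_over K y"
    and degree_over_y: "has_dim (rat_fun_field K y) UNIV {0} n"
  shows "\<exists>C. divisor K C \<and> 0 \<le> C \<and> (\<forall>m. Suc m * n \<le> ell K (int m \<cdot> pole_div K y + C))"
proof -
  obtain u where u_indep: "lin_indep (rat_fun_field K y) {..<n} u"
    using degree_over_y unfolding has_dim_def by blast
  define C where "C = (\<Sum>k<n. pole_div K (u k))"
  have divisor_C: "divisor K C" and C_nonneg: "0 \<le> C"
    unfolding C_def using divisor_pole_div pole_div_nonneg by (auto intro: divisor_sum sum_nonneg)
  have u_val_ge: "u k \<in> val_ge R (- C R)" if "R \<in> places K" "k < n" for R k
    unfolding C_def using that by (intro mem_val_ge_sum_pole_div) auto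
  have "Suc m * n \<le> ell K (int m \<cdot> pole_div K y + C)" for m
  proof -
    let ?A = "{..m} \<times> {..<n}" and ?D = "int m \<cdot> pole_div K y + C"
    have "card ?A \<le> ell K ?D"
    proof (rule card_lin_indep_le_dim[OF submodule_singleton_0 has_dim_RR_space])
      show "divisor K ?D"
        by (intro divisor_add divisor_smult divisor_pole_div divisor_C)
      show "lin_indep K ?A (\<lambda>(j, k). y ^ j * u k)"
        using lin_indep_mod_mono[OF u_indep polys_over_subset_rat_fun_field]
        by (intro lin_indep_monomials[OF transcendental_y]) auto
      fix i assume "i \<in> ?A"
      then obtain j k where i_eq: "i = (j, k)" and j_le_m: "j \<le> m" and k_less_n: "k < n"
        by auto
      have "y ^ j * u k \<in> val_ge R (- (int m * pole_div K y R) + - C R)" if "R \<in> places K" for R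
        by (intro val_ge_mult power_in_val_ge_pole_div u_val_ge that j_le_m k_less_n)
      then show "(case i of (j, k) \<Rightarrow> y ^ j * u k) \<in> RR_space K ?D"
        unfolding mem_RR_space_iff i_eq by simp
    qed auto
    then show ?thesis
      by simp
  qed
  then show ?thesis
    using divisor_C C_nonneg by blast
qed

theorem div_deg_pole_div:
  assumes "transcendental_over K y" and "has_dim (rat_fun_field K y) UNIV {0} n"
  shows "div_deg K (pole_div K y) = int n"
proof (rule antisym[OF div_deg_pole_div_le[OF assms]], rule ccontr)
  let ?deg = "div_deg K (pole_div K y)"
  assume "\<not> int n \<le> ?deg"
  obtain C where divisor_C: "divisor K C" and C_nonneg: "0 \<le> C"
    and ell_ge: "\<And>m. Suc m * n \<le> ell K (int m \<cdot> pole_div K y + C)"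
    using ell_mult_pole_div_ge[OF assms] by blast
  have ell_le: "int (ell K (int m \<cdot> pole_div K y + C)) \<le> int (ell K 0) + int m * ?deg + div_deg K C" for m
  proof -
    let ?D = "int m \<cdot> pole_div K y + C"
    have "divisor K ?D" "div_deg K ?D = int m * ?deg + div_deg K C"
      by (simp_all add: divisor_add div_deg_add div_deg_smult divisor_smult divisor_pole_div divisor_C)
    moreover have "0 \<le> ?D"
      using C_nonneg pole_div_nonneg by (auto simp: le_fun_def)
    ultimately show ?thesis
      using ell_minus_deg_antimono[OF divisor_0, of ?D] div_deg_0[of K] by simp
  qed
  define m where "m = ell K 0 + nat (div_deg K C)"
  have "int (Suc m) * int n \<le> int (ell K 0) + int m * ?deg + div_deg K C"
    using ell_ge[of m] ell_le[of m] by (metis (no_types, lifting) of_nat_le_iff of_nat_mult order_trans)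
  also have "\<dots> \<le> int m + int m * (int n - 1)"
  proof -
    have "int m * ?deg \<le> int m * (int n - 1)"
      using \<open>\<not> int n \<le> ?deg\<close> by (intro mult_left_mono) auto
    moreover have "int (ell K 0) + div_deg K C \<le> int m"
      unfolding m_def by simp
    ultimately show ?thesis
      by linarith
  qed
  finally have "int n \<le> 0"
    by (simp add: algebra_simps)
  then show False
    using \<open>\<not> int n \<le> ?deg\<close> div_deg_nonneg[OF pole_div_nonneg[of y], of K] by linarith
qed

theorem div_deg_principal_div:
  assumes z_nonzero: "z \<noteq> 0"
  shows "div_deg K (principal_div K z) = 0"
proof (cases "transcendental_over K z")
  case True
  then obtain n where "has_dim (rat_fun_field K z) UNIV {0} n"
    using has_dim_over_rat_fun_field_exists by blast
  then have "div_deg K (pole_div K z) = int n" "div_deg K (pole_div K (inverse z)) = int n"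
    using div_deg_pole_div True transcendental_over_inverse by (auto simp: rat_fun_field_inverse)
  then show ?thesis
    by (simp add: principal_div_eq[OF z_nonzero] div_deg_diff divisor_pole_div)
next
  case False
  then have "\<not> transcendental_over K (inverse z)"
    using transcendental_over_inverse[of "inverse z"] by auto
  then have "z \<in> R \<and> inverse z \<in> R" if "R \<in> places K" for R
    using False transcendental_over_max_ideal[OF that] inverse_in_max_ideal[OF that] z_nonzero
    by (metis inverse_inverse_eq inverse_nonzero_iff_nonzero)
  then have "pole_div K z = 0" "pole_div K (inverse z) = 0"
    by (auto simp: pole_div_def fun_eq_iff)
  then show ?thesis
    by (simp add: principal_div_eq[OF z_nonzero] div_deg_0)
qed

lemma ell_mult_pole_div_bounded:
  assumes transcendental_y: "transcendental_over K y"
    and degree_over_y: "has_dim (rat_fun_field K y) UNIV {0} n"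
  shows "\<exists>\<gamma>. \<forall>m. int m * int n - int (ell K (int m \<cdot> pole_div K y)) \<le> \<gamma>"
proof -
  let ?B = "\<lambda>m. int m \<cdot> pole_div K y"
  have divisor_B: "divisor K (?B m)" and div_deg_B: "div_deg K (?B m) = int m * int n" for m
    using div_deg_pole_div[OF transcendental_y degree_over_y]
    by (simp_all add: divisor_smult div_deg_smult divisor_pole_div)
  obtain C where divisor_C: "divisor K C" and C_nonneg: "0 \<le> C"
    and ell_ge: "\<And>m. Suc m * n \<le> ell K (?B m + C)"
    using ell_mult_pole_div_ge[OF transcendental_y degree_over_y] by blast
  have "int m * int n - int (ell K (?B m)) \<le> div_deg K C - int n" for m
  proof -
    have "int (Suc m * n) \<le> int (ell K (?B m + C))"
      using ell_ge by (simp only: of_nat_le_iff)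
    moreover have "int (ell K (?B m + C)) - div_deg K (?B m + C) \<le> int (ell K (?B m)) - div_deg K (?B m)"
      using divisor_C C_nonneg by (intro ell_minus_deg_antimono divisor_add divisor_B) auto
    ultimately show ?thesis
      using div_deg_add[OF divisor_B divisor_C, of m] div_deg_B[of m] by (simp add: algebra_simps)
  qed
  then show ?thesis
    by blast
qed

lemma RR_space_nonzero_if_ell_pos: "ell K A > 0 \<Longrightarrow> \<exists>f\<in>RR_space K A. f \<noteq> 0"
  using ell_eqI[of A 0] has_dim_self[OF submodule_singleton_0, of K] submodule_0[OF submodule_RR_space]
  by (metis less_irrefl singletonI subset_singletonD subsetI empty_iff)

lemma exists_equivalent_le_mult_pole_div:
  assumes transcendental_y: "transcendental_over K y"
    and degree_over_y: "has_dim (rat_fun_field K y) UNIV {0} n"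
    and divisor_A: "divisor K A" and A_nonneg: "0 \<le> A"
  shows "\<exists>f m. f \<noteq> 0 \<and> A - principal_div K f \<le> int m \<cdot> pole_div K y"
proof -
  let ?B = "\<lambda>m. int m \<cdot> pole_div K y"
  have divisor_B: "divisor K (?B m)" for m
    by (intro divisor_smult divisor_pole_div)
  obtain \<gamma> where le_gamma: "\<And>m. int m * int n - int (ell K (?B m)) \<le> \<gamma>"
    using ell_mult_pole_div_bounded[OF transcendental_y degree_over_y] by blast
  define m where "m = nat (\<gamma> + div_deg K A + 1)"
  have "n > 0"
    using has_dim_0D[of "rat_fun_field K y" UNIV "{0}"] degree_over_y
    by (metis gr0I UNIV_I singletonD subsetD zero_neq_one)
  then have "int m * 1 \<le> int m * int n"
    by (intro mult_left_mono) auto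
  moreover have "int (ell K (?B m)) - div_deg K A \<le> int (ell K (?B m - A))"
    using ell_minus_deg_antimono[OF divisor_diff[OF divisor_B divisor_A] divisor_B, of m m]
      div_deg_diff[OF divisor_B divisor_A, of m] A_nonneg
    by (simp add: le_fun_def)
  ultimately have "ell K (?B m - A) > 0"
    using le_gamma[of m] unfolding m_def by linarith
  then obtain f where f_in_RR_space: "f \<in> RR_space K (?B m - A)" and f_nonzero: "f \<noteq> 0"
    using RR_space_nonzero_if_ell_pos by blast
  have "A - principal_div K f \<le> ?B m"
    using f_in_RR_space f_nonzero divisor_support[OF divisor_A] pole_div_nonneg[of y]
    by (force simp: le_fun_def RR_space_def principal_div_def pole_div_def)
  then show ?thesis
    using f_nonzero by blast
qed

lemma div_deg_minus_ell_bounded: "\<exists>\<gamma>. \<forall>A. divisor K A \<longrightarrow> div_deg K A - int (ell K A) \<le> \<gamma>"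
proof -
  obtain y where transcendental_y: "transcendental_over K y"
    using transcendental_over_exists by blast
  then obtain n where degree_over_y: "has_dim (rat_fun_field K y) UNIV {0} n"
    using has_dim_over_rat_fun_field_exists by blast
  obtain \<gamma> where le_gamma: "\<And>m. int m * int n - int (ell K (int m \<cdot> pole_div K y)) \<le> \<gamma>"
    using ell_mult_pole_div_bounded[OF transcendental_y degree_over_y] by blast
  have "div_deg K A - int (ell K A) \<le> \<gamma>" if divisor_A: "divisor K A" for A
  proof -
    let ?A = "sup 0 A"
    have effective: "divisor K ?A"
      using divisor_finite_support[OF divisor_A] divisor_support[OF divisor_A]
      by (intro divisorI[of "{R. A R \<noteq> 0}"]) (auto simp: sup_int_def split: if_splits)
    obtain f m where f_nonzero: "f \<noteq> 0"
      and le_mult_pole_div: "?A - principal_div K f \<le> int m \<cdot> pole_div K y"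
      using exists_equivalent_le_mult_pole_div[OF transcendental_y degree_over_y effective] by auto
    have "div_deg K (int m \<cdot> pole_div K y) = int m * int n"
      using div_deg_pole_div[OF transcendental_y degree_over_y]
      by (simp add: div_deg_smult divisor_pole_div)
    moreover have "int (ell K (int m \<cdot> pole_div K y)) - div_deg K (int m \<cdot> pole_div K y) \<le>
        int (ell K (?A - principal_div K f)) - div_deg K (?A - principal_div K f)"
      using f_nonzero le_mult_pole_div
      by (intro ell_minus_deg_antimono divisor_diff divisor_smult divisor_pole_div divisor_principal_div
        effective)
    moreover have "ell K (?A - principal_div K f) = ell K ?A"
      by (rule ell_diff_principal_div[OF f_nonzero effective])
    moreover have "div_deg K (?A - principal_div K f) = div_deg K ?A"
      using f_nonzero effective by (simp add: div_deg_diff divisor_principal_div div_deg_principal_div)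
    moreover have "int (ell K ?A) - div_deg K ?A \<le> int (ell K A) - div_deg K A"
      by (intro ell_minus_deg_antimono divisor_A effective) auto
    ultimately show ?thesis
      using le_gamma[of m] by linarith
  qed
  then show ?thesis
    by blast
qed

theorem Riemann_inequality:
  assumes divisor_A: "divisor K A"
  shows "div_deg K A + 1 - genus K \<le> int (ell K A)"
proof -
  obtain \<gamma> where le_gamma: "\<And>A. divisor K A \<Longrightarrow> div_deg K A - int (ell K A) \<le> \<gamma>"
    using div_deg_minus_ell_bounded by blast
  have "div_deg K A - int (ell K A) + 1 \<le> genus K"
    unfolding genus_def
  proof (rule le_Greatest_int)
    show "k \<le> \<gamma> + 1" if "\<exists>A. divisor K A \<and> k = div_deg K A - int (ell K A) + 1" for k
      using that le_gamma by auto
  qed (use divisor_A in blast)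
  then show ?thesis
    by simp
qed

lemma RR_space_eq_0_if_deg_neg:
  assumes divisor_A: "divisor K A" and div_deg_neg: "div_deg K A < 0"
  shows "RR_space K A = {0}"
proof -
  have "z = 0" if z_in_RR_space: "z \<in> RR_space K A" for z
  proof (rule ccontr)
    assume "z \<noteq> 0"
    then have "0 \<le> A + principal_div K z"
      using z_in_RR_space divisor_support[OF divisor_A]
      by (force simp: le_fun_def RR_space_def principal_div_def)
    then have "0 \<le> div_deg K A"
      using div_deg_nonneg[of "A + principal_div K z" K] \<open>z \<noteq> 0\<close> divisor_A
      by (simp add: div_deg_add divisor_principal_div div_deg_principal_div)
    then show False
      using div_deg_neg by simp
  qed
  then show ?thesis
    using submodule_0[OF submodule_RR_space] by blast
qed

end

section \<open>Non-special divisors and interpolation\<close>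

definition RR_space_away :: "'f::field set \<Rightarrow> 'f set \<Rightarrow> ('f set \<Rightarrow> int) \<Rightarrow> 'f set" where
  "RR_space_away K R A = {z. \<forall>S\<in>places K - {R}. z \<in> val_ge S (- A S)}"

text \<open>The quotient of the function field by this space is the first cohomology of \<open>A\<close>.\<close>
definition coboundaries :: "'f::field set \<Rightarrow> 'f set \<Rightarrow> ('f set \<Rightarrow> int) \<Rightarrow> 'f set" where
  "coboundaries K R A = RR_space_away K R A + val_ge R (- A R)"

lemma RR_space_eq_away_Int: "R \<in> places K \<Longrightarrow> RR_space K A = RR_space_away K R A \<inter> val_ge R (- A R)"
  unfolding RR_space_away_def by (auto simp: mem_RR_space_iff)

lemma RR_space_away_cong: "(\<And>S. S \<noteq> R \<Longrightarrow> A S = B S) \<Longrightarrow> RR_space_away K R A = RR_space_away K R B"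
  unfolding RR_space_away_def by auto

lemma
  assumes "rational_place K R"
  shows rational_place_in_places: "R \<in> places K" and place_degree_rational: "place_degree K R = 1"
  using assms unfolding rational_place_def by auto

context base_field
begin

lemma multiplier_into_hyperplane:
  assumes submodule_H: "submodule K H" and H_complement: "\<And>z. \<exists>c\<in>K. z - c * b \<in> H"
    and submodule_V: "submodule K V" and has_dim_V: "has_dim K V {0} n" and "k < n"
  shows "\<exists>x\<in>V. x \<noteq> 0 \<and> (\<forall>j<k. x * y j \<in> H)"
proof -
  obtain v where v_in_V: "\<forall>i<n. v i \<in> V" and v_indep: "lin_indep K {..<n} v"
    using has_dim_V by (rule has_dimE)
  obtain coord where coord: "\<And>z. coord z \<in> K" "\<And>z. z - coord z * b \<in> H"
    using H_complement by metis
  define a where "a i j = coord (v i * y j)" for i j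
  have a_in_K: "a i j \<in> K" and v_times_y_mod_H: "v i * y j - a i j * b \<in> H" for i j
    unfolding a_def by (rule coord)+
  obtain c where c_in_K: "\<forall>i\<in>{..<n}. c i \<in> K" and c_nonzero: "\<exists>i\<in>{..<n}. c i \<noteq> 0"
    and c_solves: "\<forall>j\<in>{..<k}. (\<Sum>i<n. c i * a i j) = 0"
    using homogeneous_system_nontrivial_solution[of "{..<k}" "{..<n}" a] a_in_K \<open>k < n\<close> by auto
  define x where "x = (\<Sum>i<n. c i * v i)"
  have "x \<in> V"
    unfolding x_def using c_in_K v_in_V by (intro submodule_lincomb[OF submodule_V]) auto
  moreover have "x \<noteq> 0"
    using lin_indep_modD[OF v_indep, of c] c_in_K c_nonzero unfolding x_def by auto
  moreover have "x * y j \<in> H" if "j < k" for j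
  proof -
    have "x * y j = (\<Sum>i<n. c i * (v i * y j - a i j * b)) + (\<Sum>i<n. c i * a i j) * b"
      unfolding x_def by (simp add: right_diff_distrib sum_subtractf sum_distrib_right mult.assoc)
    then show ?thesis
      using c_in_K c_solves v_times_y_mod_H that by (auto intro!: submodule_lincomb[OF submodule_H])
  qed
  ultimately show ?thesis
    by blast
qed

end

context alg_function_field
begin

lemma submodule_RR_space_away: "submodule K (RR_space_away K R A)"
proof -
  have "RR_space_away K R A = (\<Inter>S\<in>places K - {R}. val_ge S (- A S))"
    unfolding RR_space_away_def by blast
  then show ?thesis
    by (auto intro: submodule_INT submodule_val_ge)
qed

lemma submodule_coboundaries: "R \<in> places K \<Longrightarrow> submodule K (coboundaries K R A)"
  unfolding coboundaries_def by (intro submodule_set_plus submodule_RR_space_away submodule_val_ge)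

lemma RR_space_away_subset_coboundaries: "R \<in> places K \<Longrightarrow> RR_space_away K R A \<subseteq> coboundaries K R A"
  unfolding coboundaries_def using set_zero_plus2[OF submodule_0[OF submodule_val_ge]]
  by (metis add.commute)

lemma val_ge_subset_coboundaries: "val_ge R (- A R) \<subseteq> coboundaries K R A"
  unfolding coboundaries_def by (rule set_zero_plus2[OF submodule_0[OF submodule_RR_space_away]])

lemma ell_eq_add_if_eq_off_place:
  assumes R_place: "R \<in> places K" and divisor_A: "divisor K A" and A_le_D: "A R \<le> D R"
    and eq_off_R: "\<And>S. S \<noteq> R \<Longrightarrow> D S = A S"
    and has_dim_mod_val_ge: "has_dim K (val_ge R (- D R) \<inter> coboundaries K R A) (val_ge R (- A R)) e"
  shows "ell K D = e + ell K A"
proof -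
  have submodule_val: "submodule K (val_ge R m)" for m
    by (rule submodule_val_ge[OF R_place])
  have RR_D: "RR_space K D = RR_space_away K R A \<inter> val_ge R (- D R)"
    unfolding RR_space_eq_away_Int[OF R_place] by (simp add: RR_space_away_cong[of R D A] eq_off_R)
  have "has_dim K (RR_space K D) (RR_space K D \<inter> val_ge R (- A R)) e"
  proof (rule has_dim_Int[OF submodule_RR_space submodule_val _ _ has_dim_mod_val_ge])
    show "RR_space K D \<subseteq> val_ge R (- D R) \<inter> coboundaries K R A"
      unfolding RR_D using RR_space_away_subset_coboundaries[OF R_place] by blast
    fix z assume z_in_val_ge: "z \<in> val_ge R (- D R) \<inter> coboundaries K R A"
    then obtain u w where "z = u + w" "u \<in> RR_space_away K R A" and w_in_val_ge: "w \<in> val_ge R (- A R)"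
      unfolding coboundaries_def by (blast elim: set_plus_elim)
    moreover have "z - w \<in> val_ge R (- D R)"
      using z_in_val_ge w_in_val_ge A_le_D val_ge_mono[of "- D R" "- A R" R]
      by (intro submodule_diff[OF submodule_val]) auto
    ultimately show "\<exists>v\<in>RR_space K D. z - v \<in> val_ge R (- A R)"
      unfolding RR_D by (intro bexI[of _ u]) auto
  qed
  moreover have "RR_space K D \<inter> val_ge R (- A R) = RR_space K A"
    unfolding RR_D RR_space_eq_away_Int[OF R_place, of A] using A_le_D val_ge_mono[of "- D R" "- A R" R]
    by auto
  ultimately have "has_dim K (RR_space K D) {0} (e + ell K A)"
    using submodule_0[OF submodule_RR_space]
    by (intro has_dim_trans[OF submodule_RR_space[of A] _ _ _ has_dim_RR_space[OF divisor_A]]) auto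
  then show ?thesis
    by (rule ell_eqI)
qed

lemma has_dim_val_ge_mod_coboundaries:
  fixes m :: nat
  assumes rational: "rational_place K R" and divisor_A: "divisor K A"
  defines "F \<equiv> val_ge R (- A R - int m)"
  shows "\<exists>f. has_dim K F (F \<inter> coboundaries K R A) f \<and> int f \<le> genus K - 1 - div_deg K A + int (ell K A)"
proof -
  note R_place = rational_place_in_places[OF rational]
  let ?F0 = "val_ge R (- A R)" and ?X = "F \<inter> coboundaries K R A"
  define D where "D = A + int m \<cdot> place_div R"
  have divisor_D: "divisor K D" and div_deg_D_eq: "div_deg K D = div_deg K A + int m"
    using divisor_A place_degree_rational[OF rational]
    by (simp_all add: D_def divisor_add divisor_smult divisor_place_div[OF R_place]
      div_deg_add div_deg_smult div_deg_place_div)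
  have D_R: "D R = A R + int m" and D_off_R: "\<And>S. S \<noteq> R \<Longrightarrow> D S = A S"
    by (simp_all add: D_def place_div_def)
  have submodule_F: "submodule K F" and submodule_F0: "submodule K ?F0" and submodule_X: "submodule K ?X"
    unfolding F_def by (intro submodule_Int submodule_val_ge submodule_coboundaries R_place)+
  have "?F0 \<subseteq> ?X"
    unfolding F_def using val_ge_mono[of "- A R - int m" "- A R" R] val_ge_subset_coboundaries by auto
  have dim_F: "has_dim K F ?F0 m"
    using has_dim_val_ge[OF R_place, of "- A R - int m" "- A R"] place_degree_rational[OF rational]
    by (simp add: F_def)
  obtain e where has_dim_X: "has_dim K ?X ?F0 e"
    using has_dim_embed[OF submodule_X submodule_F0 submodule_F0 dim_F] by auto
  obtain f where has_dim_F: "has_dim K F ?X f"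
    using has_dim_embed[OF submodule_F submodule_X submodule_F0 dim_F] \<open>?F0 \<subseteq> ?X\<close> by blast
  have "m = f + e"
    using has_dim_unique[OF submodule_F0 dim_F
      has_dim_trans[OF submodule_X \<open>?F0 \<subseteq> ?X\<close> _ has_dim_F has_dim_X]] by blast
  moreover have "ell K D = e + ell K A"
    using has_dim_X D_R D_off_R
    by (intro ell_eq_add_if_eq_off_place[OF R_place divisor_A]) (auto simp: F_def)
  ultimately have "int f \<le> genus K - 1 - div_deg K A + int (ell K A)"
    using Riemann_inequality[OF divisor_D] div_deg_D_eq by simp
  then show ?thesis
    using has_dim_F by blast
qed

lemma has_dim_mod_coboundaries:
  assumes rational: "rational_place K R" and "divisor K A"
  shows "\<exists>d. has_dim K UNIV (coboundaries K R A) d \<and> int d \<le> genus K - 1 - div_deg K A + int (ell K A)"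
proof -
  note R_place = rational_place_in_places[OF rational]
  let ?bound = "genus K - 1 - div_deg K A + int (ell K A)"
  have card_le: "int d \<le> ?bound" if b_indep: "lin_indep_mod K (coboundaries K R A) {..<d} b" for d b
  proof -
    define m where "m = nat \<bar>A R\<bar> + (\<Sum>i<d. nat \<bar>ord R (b i)\<bar>)"
    let ?F = "val_ge R (- A R - int m)"
    have b_in: "b i \<in> ?F" if "i \<in> {..<d}" for i
    proof -
      have "nat \<bar>ord R (b i)\<bar> \<le> (\<Sum>i<d. nat \<bar>ord R (b i)\<bar>)"
        using that by (intro member_le_sum) auto
      then have "- A R - int m \<le> ord R (b i)"
        unfolding m_def by linarith
      then show ?thesis
        unfolding val_ge_def by simp
    qed
    obtain f where has_dim_F: "has_dim K ?F (?F \<inter> coboundaries K R A) f" and f_le_bound: "int f \<le> ?bound"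
      using has_dim_val_ge_mod_coboundaries[OF assms] by blast
    have "card {..<d} \<le> f"
      using b_in lin_indep_mod_mono[OF b_indep]
      by (intro card_lin_indep_le_dim[OF _ has_dim_F] submodule_Int submodule_val_ge
        submodule_coboundaries R_place) auto
    then show ?thesis
      using f_le_bound by simp
  qed
  have "\<exists>d\<le>nat ?bound. has_dim K UNIV (coboundaries K R A) d"
    using card_le by (intro has_dim_exists_if_bounded[OF submodule_coboundaries[OF R_place]]) fastforce
  then show ?thesis
    using card_le by (meson has_dimE)
qed

lemma coboundaries_neq_UNIV:
  assumes R_place: "R \<in> places K" and RR_space_add_eq: "RR_space K (A + place_div R) = RR_space K A"
  shows "coboundaries K R A \<noteq> UNIV"
proof
  define t where "t = unif R powi (- A R - 1)"
  have t_nonzero: "t \<noteq> 0" and ord_t: "ord R t = - A R - 1"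
    unfolding t_def using unif_nonzero[OF R_place] ord_unif_powi[OF R_place] by auto
  assume "coboundaries K R A = UNIV"
  then obtain u w where t_eq: "t = u + w" and u_in_RR_space_away: "u \<in> RR_space_away K R A"
    and w_in_val_ge: "w \<in> val_ge R (- A R)"
    unfolding coboundaries_def by (metis UNIV_I set_plus_elim)
  have "- w \<in> val_ge R (ord R t + 1)"
    using w_in_val_ge ord_t submodule_uminus[OF submodule_val_ge[OF R_place]] by simp
  then have ord_u: "ord R u = - A R - 1" and u_nonzero: "u \<noteq> 0"
    using ord_add_eq[OF R_place t_nonzero, of "- w"] t_eq ord_t by auto
  have "RR_space_away K R (A + place_div R) = RR_space_away K R A"
    by (rule RR_space_away_cong) (simp add: place_div_def)
  then have "u \<in> RR_space K (A + place_div R)"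
    unfolding RR_space_eq_away_Int[OF R_place] using u_in_RR_space_away ord_u
    by (simp add: val_ge_def place_div_def)
  then have "u \<in> val_ge R (- A R)"
    unfolding RR_space_add_eq using R_place by (simp add: mem_RR_space_iff)
  then show False
    using ord_u u_nonzero by (simp add: val_ge_def)
qed

lemma RR_space_times_coboundaries_0:
  assumes R_place: "R \<in> places K" and x_in_RR_space: "x \<in> RR_space K A"
    and w_in_coboundaries: "w \<in> coboundaries K R 0"
  shows "x * w \<in> coboundaries K R A"
proof -
  obtain u v where w_eq: "w = u + v" and u_in_RR_space_away: "u \<in> RR_space_away K R 0"
    and v_in_val_ge: "v \<in> val_ge R 0"
    using w_in_coboundaries unfolding coboundaries_def by (auto elim!: set_plus_elim)
  have x_val: "x \<in> val_ge S (- A S)" if "S \<in> places K" for S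
    using x_in_RR_space that by (simp add: mem_RR_space_iff)
  have "x * u \<in> RR_space_away K R A"
    using u_in_RR_space_away x_val val_ge_mult[of _ x _ u 0] by (fastforce simp: RR_space_away_def)
  moreover have "x * v \<in> val_ge R (- A R)"
    using val_ge_mult[OF R_place x_val[OF R_place] v_in_val_ge] by simp
  ultimately show ?thesis
    unfolding coboundaries_def w_eq distrib_left by (rule set_plus_intro)
qed

lemma times_mem_if_times_spanning_mem:
  assumes R_place: "R \<in> places K" and submodule_H: "submodule K H"
    and coboundaries_subset_H: "coboundaries K R A \<subseteq> H" and x_in_RR_space: "x \<in> RR_space K A"
    and y_spans: "spans_mod K UNIV (coboundaries K R 0) J y"
    and x_times_y_in_H: "\<And>j. j \<in> J \<Longrightarrow> x * y j \<in> H"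
  shows "x * z \<in> H"
proof -
  obtain c where c_in_K: "\<forall>j\<in>J. c j \<in> K"
    and remainder_in_coboundaries: "z - (\<Sum>j\<in>J. c j * y j) \<in> coboundaries K R 0"
    using y_spans unfolding spans_mod_def by blast
  have "x * (z - (\<Sum>j\<in>J. c j * y j)) + (\<Sum>j\<in>J. c j * (x * y j)) \<in> H"
    using RR_space_times_coboundaries_0[OF R_place x_in_RR_space remainder_in_coboundaries]
      coboundaries_subset_H c_in_K x_times_y_in_H
    by (intro submodule_add[OF submodule_H] submodule_lincomb[OF submodule_H]) auto
  then show ?thesis
    by (simp add: right_diff_distrib sum_distrib_left mult.left_commute)
qed

text \<open>Serre duality in disguise: if \<open>L(A) = L(A + R)\<close>, the coboundaries of \<open>A\<close> lie in a hyperplane \<open>H\<close>.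
  Multiplication maps \<open>L(A)\<close> into the functionals on the first cohomology of \<open>0\<close>, a space of dimension at
  most the genus, so that some \<open>x \<noteq> 0\<close> in \<open>L(A)\<close> would map the whole field into \<open>H\<close>.\<close>
theorem RR_space_add_rational_place_neq:
  assumes rational: "rational_place K R" and divisor_A: "divisor K A"
    and div_deg_ge: "2 * genus K - 1 \<le> div_deg K A"
  shows "RR_space K (A + place_div R) \<noteq> RR_space K A"
proof
  note R_place = rational_place_in_places[OF rational] and degree_1 = place_degree_rational[OF rational]
  assume RR_space_add_eq: "RR_space K (A + place_div R) = RR_space K A"
  then have "ell K (A + place_div R) = ell K A"
    by (simp add: ell_def)
  then have ell_A: "genus K < int (ell K A)"
    using Riemann_inequality[OF divisor_add[OF divisor_A divisor_place_div[OF R_place]]] div_deg_ge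
      degree_1
    by (simp add: div_deg_add[OF divisor_A divisor_place_div[OF R_place]] div_deg_place_div)
  obtain d where has_dim_mod_coboundaries_A: "has_dim K UNIV (coboundaries K R A) d"
    using has_dim_mod_coboundaries[OF rational divisor_A] by blast
  then have "d > 0"
    using has_dim_0D coboundaries_neq_UNIV[OF R_place RR_space_add_eq]
    by (metis gr0I top.extremum_uniqueI)
  then obtain H b where submodule_H: "submodule K H" and coboundaries_subset_H: "coboundaries K R A \<subseteq> H"
    and b_notin_H: "b \<notin> H" and H_complement: "\<And>z. \<exists>c\<in>K. z - c * b \<in> H"
    using hyperplane_exists[OF submodule_coboundaries[OF R_place] has_dim_mod_coboundaries_A]
    by (metis UNIV_I)
  obtain k where has_dim_mod_coboundaries_0: "has_dim K UNIV (coboundaries K R 0) k"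
    and k_le_genus: "int k \<le> genus K"
    using has_dim_mod_coboundaries[OF rational divisor_0] ell_0_le_place_degree[OF R_place] degree_1
      div_deg_0[of K]
    by fastforce
  obtain y where y_spans: "spans_mod K UNIV (coboundaries K R 0) {..<k} y"
    using has_dim_mod_coboundaries_0 unfolding has_dim_def by blast
  have "k < ell K A"
    using k_le_genus ell_A by simp
  then obtain x where x_in_RR_space: "x \<in> RR_space K A" and x_nonzero: "x \<noteq> 0"
    and x_times_y_in_H: "\<forall>j<k. x * y j \<in> H"
    using multiplier_into_hyperplane[OF submodule_H H_complement submodule_RR_space
      has_dim_RR_space[OF divisor_A]] by blast
  have "x * (inverse x * b) \<in> H"
    by (rule times_mem_if_times_spanning_mem[OF R_place submodule_H coboundaries_subset_H
      x_in_RR_space y_spans]) (use x_times_y_in_H in simp)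
  then show False
    using b_notin_H x_nonzero by (simp flip: mult.assoc)
qed

lemma rational_place_residue:
  assumes rational: "rational_place K R" and h_in_R: "h \<in> R"
  shows "\<exists>!a. a \<in> K \<and> h - a \<in> max_ideal R"
proof -
  note R_place = rational_place_in_places[OF rational]
  note submodule_max_ideal_R = submodule_max_ideal[OF R_place]
  have "has_dim K R (max_ideal R) 1"
    using has_dim_residue_field[OF R_place] place_degree_rational[OF rational] by simp
  then obtain b where "\<forall>z\<in>R. \<exists>c. (\<forall>i<1::nat. c i \<in> K) \<and> z - (\<Sum>i<1. c i * b i) \<in> max_ideal R"
    by (rule has_dimE)
  then have residue: "\<exists>c\<in>K. z - c * b 0 \<in> max_ideal R" if "z \<in> R" for z
    using that by fastforce
  obtain c where c_in_K: "c \<in> K" and one_minus_in_max_ideal: "1 - c * b 0 \<in> max_ideal R"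
    using residue place_1[OF R_place] by blast
  obtain e where e_in_K: "e \<in> K" and h_minus_in_max_ideal: "h - e * b 0 \<in> max_ideal R"
    using residue h_in_R by blast
  have "c \<noteq> 0"
    using one_minus_in_max_ideal one_notin_max_ideal[OF R_place] by auto
  have "(h - e * b 0) - (e / c) * (1 - c * b 0) \<in> max_ideal R"
    by (intro submodule_diff[OF submodule_max_ideal_R] submodule_smult[OF submodule_max_ideal_R] e_in_K
      h_minus_in_max_ideal c_in_K one_minus_in_max_ideal K_divide)
  then have "h - e / c \<in> max_ideal R"
    using \<open>c \<noteq> 0\<close> by (simp add: right_diff_distrib)
  moreover have "a = a'" if "a \<in> K" "a' \<in> K" "h - a \<in> max_ideal R" "h - a' \<in> max_ideal R" for a a'
    using submodule_diff[OF submodule_max_ideal_R that(4,3)]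
      max_ideal_Int_K[OF R_place K_diff[OF that(1,2)]] by simp
  ultimately show ?thesis
    using K_divide[OF e_in_K c_in_K] by blast
qed

lemma
  assumes "rational_place K R" "h \<in> R"
  shows eval_at_in_K: "eval_at K R h \<in> K"
    and minus_eval_at_in_max_ideal: "h - eval_at K R h \<in> max_ideal R"
  using theI'[OF rational_place_residue[OF assms]] unfolding eval_at_def by auto

lemma eval_at_eqI:
  assumes "rational_place K R" "h \<in> R" "a \<in> K" "h - a \<in> max_ideal R"
  shows "eval_at K R h = a"
  using rational_place_residue[OF assms(1,2)] eval_at_in_K[OF assms(1,2)]
    minus_eval_at_in_max_ideal[OF assms(1,2)] assms(3,4) by blast

lemma eval_at_lincomb:
  assumes rational: "rational_place K R" and h_in_R: "h \<in> R" and h'_in_R: "h' \<in> R" and c_in_K: "c \<in> K"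
  shows "eval_at K R (h + c * h') = eval_at K R h + c * eval_at K R h'"
proof (rule eval_at_eqI[OF rational])
  note R_place = rational_place_in_places[OF rational]
  show "h + c * h' \<in> R"
    using h_in_R h'_in_R c_in_K K_subset_place[OF R_place] by (intro place_add place_mult R_place) auto
  show "eval_at K R h + c * eval_at K R h' \<in> K"
    using h_in_R h'_in_R c_in_K rational by (intro K_add K_mult eval_at_in_K)
  have "(h - eval_at K R h) + c * (h' - eval_at K R h') \<in> max_ideal R"
    using h_in_R h'_in_R c_in_K rational
    by (intro submodule_add[OF submodule_max_ideal[OF R_place]]
      submodule_smult[OF submodule_max_ideal[OF R_place]]
        minus_eval_at_in_max_ideal)
  then show "h + c * h' - (eval_at K R h + c * eval_at K R h') \<in> max_ideal R"
    by (simp add: algebra_simps)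
qed

lemma eval_at_add:
  "rational_place K R \<Longrightarrow> h \<in> R \<Longrightarrow> h' \<in> R \<Longrightarrow> eval_at K R (h + h') = eval_at K R h + eval_at K R h'"
  using eval_at_lincomb[of R h h' 1] K_1 by simp

lemma eval_at_eq_0_iff:
  "rational_place K R \<Longrightarrow> h \<in> R \<Longrightarrow> eval_at K R h = 0 \<longleftrightarrow> h \<in> max_ideal R"
  using minus_eval_at_in_max_ideal[of R h] eval_at_eqI[of R h 0] K_0 by auto

lemma RR_space_subset_place: "R \<in> places K \<Longrightarrow> A R = 0 \<Longrightarrow> RR_space K A \<subseteq> R"
  by (metis add.inverse_neutral mem_RR_space_iff subsetI val_ge_0)

lemma
  assumes finite_T: "finite T" and rational_T: "\<And>R. R \<in> T \<Longrightarrow> rational_place K R"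
  shows divisor_sum_rational_places: "divisor K (\<Sum>R\<in>T. place_div R)"
    and div_deg_sum_rational_places: "div_deg K (\<Sum>R\<in>T. place_div R) = int (card T)"
  using rational_place_in_places[OF rational_T] place_degree_rational[OF rational_T]
  by (simp_all add: divisor_sum div_deg_sum divisor_place_div div_deg_place_div)

lemma RR_space_diff_places:
  assumes finite_T: "finite T" and rational_T: "\<And>R. R \<in> T \<Longrightarrow> rational_place K R \<and> A R = 0"
  shows "RR_space K (A - (\<Sum>R\<in>T. place_div R)) = {h \<in> RR_space K A. \<forall>R\<in>T. eval_at K R h = 0}"
proof -
  have apply_diff: "(A - (\<Sum>R\<in>T. place_div R)) R = (if R \<in> T then - 1 else A R)" for R
    using finite_T rational_T by (simp add: sum_fun_apply place_div_def)
  have "h \<in> RR_space K (A - (\<Sum>R\<in>T. place_div R)) \<longleftrightarrow> h \<in> RR_space K A \<and> (\<forall>R\<in>T. h \<in> max_ideal R)" for h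
  proof -
    have "(h \<in> val_ge R (- (if R \<in> T then - 1 else A R))) \<longleftrightarrow>
        h \<in> val_ge R (- A R) \<and> (R \<in> T \<longrightarrow> h \<in> max_ideal R)" if "R \<in> places K" for R
      using that rational_T[of R] val_ge_0[OF that] val_ge_1[OF that] max_ideal_subset[of R] by auto
    then show ?thesis
      using rational_T rational_place_in_places unfolding mem_RR_space_iff apply_diff by blast
  qed
  moreover have "eval_at K R h = 0 \<longleftrightarrow> h \<in> max_ideal R" if "h \<in> RR_space K A" "R \<in> T" for R h
    using that rational_T rational_place_in_places RR_space_subset_place eval_at_eq_0_iff by blast
  ultimately show ?thesis
    by blast
qed

lemma RR_space_eq_0_if_many_zeros:
  assumes divisor_A: "divisor K A" and finite_T: "finite T"
    and rational_T: "\<And>R. R \<in> T \<Longrightarrow> rational_place K R \<and> A R = 0"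
    and div_deg_less_card: "div_deg K A < int (card T)"
    and h_in_RR_space: "h \<in> RR_space K A" and eval_h_eq_0: "\<And>R. R \<in> T \<Longrightarrow> eval_at K R h = 0"
  shows "h = 0"
proof -
  let ?D = "\<Sum>R\<in>T. place_div R"
  have "divisor K ?D" "div_deg K ?D = int (card T)"
    using finite_T rational_T by (auto intro: divisor_sum_rational_places div_deg_sum_rational_places)
  then have "RR_space K (A - ?D) = {0}"
    using divisor_A div_deg_less_card
    by (intro RR_space_eq_0_if_deg_neg) (auto simp: divisor_diff div_deg_diff)
  then show ?thesis
    using RR_space_diff_places[OF finite_T rational_T] h_in_RR_space eval_h_eq_0 by blast
qed

lemma exists_eval_at_neq_0:
  assumes divisor_A: "divisor K A" and "finite T" "R \<notin> T"
    and rational_T: "\<And>S. S \<in> insert R T \<Longrightarrow> rational_place K S \<and> A S = 0"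
    and div_deg_ge: "2 * genus K - 1 \<le> div_deg K A - int (card (insert R T))"
  shows "\<exists>h\<in>RR_space K A. (\<forall>S\<in>T. eval_at K S h = 0) \<and> eval_at K R h \<noteq> 0"
proof -
  let ?T = "insert R T" and ?A = "A - (\<Sum>S\<in>insert R T. place_div S)"
  have "divisor K (\<Sum>S\<in>?T. place_div S)" "div_deg K (\<Sum>S\<in>?T. place_div S) = int (card ?T)"
    using \<open>finite T\<close> rational_T
    by (auto intro!: divisor_sum_rational_places div_deg_sum_rational_places simp del: sum.insert)
  then have "RR_space K (?A + place_div R) \<noteq> RR_space K ?A"
    using divisor_A div_deg_ge rational_T
    by (intro RR_space_add_rational_place_neq)
      (auto simp: divisor_diff div_deg_diff simp del: sum.insert)
  moreover have "?A + place_div R = A - (\<Sum>S\<in>T. place_div S)"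
    using \<open>finite T\<close> \<open>R \<notin> T\<close> by simp
  ultimately show ?thesis
    using RR_space_diff_places[of T A] RR_space_diff_places[of ?T A] \<open>finite T\<close> rational_T by auto
qed

theorem RR_space_interpolation:
  assumes divisor_A: "divisor K A" and finite_T: "finite T"
    and rational_T: "\<And>R. R \<in> T \<Longrightarrow> rational_place K R \<and> A R = 0"
    and div_deg_ge: "2 * genus K - 1 \<le> div_deg K A - int (card T)"
    and r_in_K: "\<And>R. R \<in> T \<Longrightarrow> r R \<in> K"
  shows "\<exists>h\<in>RR_space K A. \<forall>R\<in>T. eval_at K R h = r R"
  using finite_T rational_T div_deg_ge r_in_K
proof (induction T rule: finite_induct)
  case empty
  then show ?case
    using submodule_0[OF submodule_RR_space] by blast
next
  case (insert R T)
  have rational_R: "rational_place K R"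
    using insert.prems(1) by auto
  obtain h where h_in_RR_space: "h \<in> RR_space K A" and eval_h: "\<forall>S\<in>T. eval_at K S h = r S"
    using insert by force
  obtain e where e_in_RR_space: "e \<in> RR_space K A" and eval_e_eq_0: "\<forall>S\<in>T. eval_at K S e = 0"
    and eval_e_nonzero: "eval_at K R e \<noteq> 0"
    using exists_eval_at_neq_0[OF divisor_A insert.hyps insert.prems(1,2)] by blast
  have in_place: "h \<in> S" "e \<in> S" if "S \<in> insert R T" for S
    using RR_space_subset_place[of S A] h_in_RR_space e_in_RR_space that insert.prems(1)
      rational_place_in_places by auto
  define c where "c = (r R - eval_at K R h) / eval_at K R e"
  have "c \<in> K"
    unfolding c_def using insert.prems(3) rational_R in_place
    by (intro K_divide K_diff eval_at_in_K) auto
  then have "eval_at K S (h + c * e) = r S" if "S \<in> insert R T" for S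
    using eval_at_lincomb[of S h e c] that in_place[OF that] insert.prems(1) eval_h eval_e_eq_0
      eval_e_nonzero
    by (auto simp: c_def)
  moreover have "h + c * e \<in> RR_space K A"
    using h_in_RR_space e_in_RR_space \<open>c \<in> K\<close>
    by (intro submodule_add[OF submodule_RR_space] submodule_smult[OF submodule_RR_space])
  ultimately show ?case
    by blast
qed

end

section \<open>Strong security of evaluation encodings\<close>

locale evaluation_code =
  fixes K :: "'f::field set" and H :: "'h::ab_group_add set"
    and secret share :: "nat \<Rightarrow> 'h \<Rightarrow> 'f" and L n :: nat
  assumes finite_K: "finite K" and finite_H: "finite H"
    and H_add: "h \<in> H \<Longrightarrow> h' \<in> H \<Longrightarrow> h + h' \<in> H"
    and H_diff: "h \<in> H \<Longrightarrow> h' \<in> H \<Longrightarrow> h - h' \<in> H"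
    and secret_in_K: "i \<in> {1..L} \<Longrightarrow> h \<in> H \<Longrightarrow> secret i h \<in> K"
    and secret_add: "i \<in> {1..L} \<Longrightarrow> h \<in> H \<Longrightarrow> h' \<in> H \<Longrightarrow> secret i (h + h') = secret i h + secret i h'"
    and share_in_K: "j \<in> {1..n} \<Longrightarrow> h \<in> H \<Longrightarrow> share j h \<in> K"
    and share_add: "j \<in> {1..n} \<Longrightarrow> h \<in> H \<Longrightarrow> h' \<in> H \<Longrightarrow> share j (h + h') = share j h + share j h'"
begin

definition amplitude :: "complex \<Rightarrow> (nat \<Rightarrow> 'f) \<Rightarrow> (nat \<Rightarrow> 'f) \<Rightarrow> complex" where
  "amplitude c s y =
     c * of_nat (card {h \<in> H. (\<forall>i\<in>{1..L}. secret i h = s i) \<and> (\<forall>j\<in>{1..n}. share j h = y j)})"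

definition encode :: "complex \<Rightarrow> ((nat \<Rightarrow> 'f) \<Rightarrow> (nat \<Rightarrow> 'f) \<Rightarrow> complex) \<Rightarrow> (nat \<Rightarrow> 'f) \<Rightarrow> (nat \<Rightarrow> 'f) \<Rightarrow> complex"
  where "encode c \<rho> y y' =
     (\<Sum>s\<in>PiE {1..L} (\<lambda>_. K). \<Sum>s'\<in>PiE {1..L} (\<lambda>_. K). amplitude c s y * \<rho> s s' * cnj (amplitude c s' y'))"

definition secrets :: "nat set \<Rightarrow> 'h \<Rightarrow> nat \<Rightarrow> 'f" where
  "secrets I h = (\<lambda>i\<in>I. secret i h)"

definition words_with_shares :: "nat set \<Rightarrow> (nat \<Rightarrow> 'f) \<Rightarrow> 'h set" where
  "words_with_shares J a = {h \<in> H. \<forall>j\<in>J. share j h = a j}"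

definition words_agreeing_off :: "nat set \<Rightarrow> 'h \<Rightarrow> (nat \<Rightarrow> 'f) \<Rightarrow> 'h set" where
  "words_agreeing_off J h b = {h' \<in> words_with_shares J b. \<forall>j\<in>{1..n} - J. share j h' = share j h}"

lemma finite_words_with_shares: "finite (words_with_shares J a)"
  unfolding words_with_shares_def using finite_H by simp

lemma secrets_in_PiE: "I \<subseteq> {1..L} \<Longrightarrow> h \<in> H \<Longrightarrow> secrets I h \<in> PiE I (\<lambda>_. K)"
  unfolding secrets_def using secret_in_K by auto

lemma sum_words_by_secrets:
  assumes "I \<subseteq> {1..L}"
  shows "(\<Sum>h\<in>words_with_shares J a. f h) =
    (\<Sum>r\<in>PiE I (\<lambda>_. K). \<Sum>h\<in>{h \<in> words_with_shares J a. secrets I h = r}. f h)"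
proof (rule sum.group[symmetric])
  show "finite (PiE I (\<lambda>_. K))"
    using finite_subset[OF assms] finite_K by (intro finite_PiE) auto
  show "secrets I ` words_with_shares J a \<subseteq> PiE I (\<lambda>_. K)"
    using secrets_in_PiE[OF assms] by (auto simp: words_with_shares_def)
qed (rule finite_words_with_shares)

lemma amplitude_eq_card:
  assumes "s \<in> PiE {1..L} (\<lambda>_. K)"
  shows "amplitude c s y = c * of_nat (card {h \<in> words_with_shares {1..n} y. secrets {1..L} h = s})"
proof -
  have "secrets {1..L} h = s \<longleftrightarrow> (\<forall>i\<in>{1..L}. secret i h = s i)" for h
    using assms by (auto simp: secrets_def PiE_iff fun_eq_iff restrict_def extensional_def)
  then show ?thesis
    unfolding amplitude_def words_with_shares_def by (simp add: conj_ac)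
qed

lemma encode_eq_sum_words:
  "encode c \<rho> y y' = c * cnj c * (\<Sum>h\<in>words_with_shares {1..n} y. \<Sum>h'\<in>words_with_shares {1..n} y'.
     \<rho> (secrets {1..L} h) (secrets {1..L} h'))"
proof -
  let ?S = "PiE {1..L} (\<lambda>_. K)" and ?H = "words_with_shares {1..n}"
  let ?W = "\<lambda>y s. {h \<in> ?H y. secrets {1..L} h = s}"
    and ?\<rho> = "\<lambda>h h'. \<rho> (secrets {1..L} h) (secrets {1..L} h')"
  have "(\<Sum>h\<in>?H y. \<Sum>h'\<in>?H y'. ?\<rho> h h') =
      (\<Sum>s\<in>?S. \<Sum>h\<in>?W y s. \<Sum>s'\<in>?S. \<Sum>h'\<in>?W y' s'. \<rho> s s')"
    unfolding sum_words_by_secrets[OF order_refl] by (intro sum.cong refl) auto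
  also have "\<dots> = (\<Sum>s\<in>?S. \<Sum>s'\<in>?S. of_nat (card (?W y s)) * \<rho> s s' * of_nat (card (?W y' s')))"
    by (simp add: sum_distrib_left mult_ac)
  finally show ?thesis
    unfolding encode_def by (simp add: amplitude_eq_card sum_distrib_left mult_ac)
qed

lemma reduced_state_encode:
  assumes J_subset: "J \<subseteq> {1..n}"
  shows "reduced_state K n J (encode c \<rho>) a b = c * cnj c *
    (\<Sum>h\<in>words_with_shares J a. \<Sum>h'\<in>words_agreeing_off J h b. \<rho> (secrets {1..L} h) (secrets {1..L} h'))"
proof -
  let ?Z = "PiE ({1..n} - J) (\<lambda>_. K)" and ?rest = "\<lambda>h. \<lambda>j\<in>{1..n} - J. share j h"
  let ?W = "\<lambda>a z. {h \<in> words_with_shares J a. ?rest h = z}"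
    and ?\<rho> = "\<lambda>h h'. \<rho> (secrets {1..L} h) (secrets {1..L} h')"
  have words_split: "words_with_shares {1..n} (\<lambda>j. if j \<in> J then a j else z j) = ?W a z"
    if "z \<in> ?Z" for a z
  proof -
    have "?rest h = z \<longleftrightarrow> (\<forall>j\<in>{1..n} - J. share j h = z j)" for h
      using that by (auto simp: PiE_iff fun_eq_iff restrict_def extensional_def)
    then show ?thesis
      unfolding words_with_shares_def using J_subset by auto
  qed
  have "reduced_state K n J (encode c \<rho>) a b = c * cnj c *
      (\<Sum>z\<in>?Z. \<Sum>h\<in>?W a z. \<Sum>h'\<in>?W b z. ?\<rho> h h')"
    unfolding reduced_state_def encode_eq_sum_words sum_distrib_left[symmetric]
    by (simp add: words_split del: One_nat_def)
  also have "(\<Sum>z\<in>?Z. \<Sum>h\<in>?W a z. \<Sum>h'\<in>?W b z. ?\<rho> h h') =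
      (\<Sum>z\<in>?Z. \<Sum>h\<in>?W a z. \<Sum>h'\<in>words_agreeing_off J h b. ?\<rho> h h')"
  proof (intro sum.cong refl)
    fix z h assume "h \<in> ?W a z"
    then show "?W b z = words_agreeing_off J h b"
      by (auto simp: words_agreeing_off_def fun_eq_iff restrict_def) metis+
  qed
  also have "\<dots> = (\<Sum>h\<in>words_with_shares J a. \<Sum>h'\<in>words_agreeing_off J h b. ?\<rho> h h')"
  proof (rule sum.group[OF finite_words_with_shares])
    show "finite ?Z"
      using finite_K by (intro finite_PiE) auto
    show "?rest ` words_with_shares J a \<subseteq> ?Z"
      using share_in_K unfolding words_with_shares_def
      by (intro image_subsetI restrict_PiE_iff[THEN iffD2]) auto
  qed
  finally show ?thesis .
qed

lemma secret_diff: "i \<in> {1..L} \<Longrightarrow> h \<in> H \<Longrightarrow> h' \<in> H \<Longrightarrow> secret i (h - h') = secret i h - secret i h'"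
  using secret_add[OF _ H_diff, of i h h' h'] by simp

lemma share_diff: "j \<in> {1..n} \<Longrightarrow> h \<in> H \<Longrightarrow> h' \<in> H \<Longrightarrow> share j (h - h') = share j h - share j h'"
  using share_add[OF _ H_diff, of j h h' h'] by simp

lemma words_with_shares_disjoint:
  assumes "a \<in> PiE J (\<lambda>_. K)" "b \<in> PiE J (\<lambda>_. K)" "h \<in> words_with_shares J a" "h \<in> words_with_shares J b"
  shows "a = b"
  using assms by (intro PiE_ext[OF assms(1,2)]) (auto simp: words_with_shares_def)

lemma reduced_state_encode_tensor_mixed:
  assumes I_subset: "I \<subseteq> {1..L}" and J_subset: "J \<subseteq> {1..n}"
    and injective: "\<And>h. h \<in> H \<Longrightarrow> (\<And>i. i \<in> {1..L} - I \<Longrightarrow> secret i h = 0) \<Longrightarrow>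
      (\<And>j. j \<in> {1..n} - J \<Longrightarrow> share j h = 0) \<Longrightarrow> h = 0"
    and a_in_PiE: "a \<in> PiE J (\<lambda>_. K)" and b_in_PiE: "b \<in> PiE J (\<lambda>_. K)"
  shows "reduced_state K n J (encode c (tensor_mixed K L I \<rho>)) a b =
    (if a = b then c * cnj c / of_nat (card K ^ card ({1..L} - I)) *
      (\<Sum>h\<in>words_with_shares J a. \<rho> (secrets I h) (secrets I h)) else 0)"
proof -
  let ?\<tau> = "\<lambda>h h'. tensor_mixed K L I \<rho> (secrets {1..L} h) (secrets {1..L} h')"
  let ?\<kappa> = "of_nat (card K ^ card ({1..L} - I)) :: complex"
  have "(\<Sum>h'\<in>words_agreeing_off J h b. ?\<tau> h h') =
      (if a = b then \<rho> (secrets I h) (secrets I h) / ?\<kappa> else 0)"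
    if h_in_words_with_shares: "h \<in> words_with_shares J a" for h
  proof -
    have restrict_I: "restrict (secrets {1..L} h) I = secrets I h" for h
      using I_subset by (auto simp: secrets_def fun_eq_iff restrict_def)
    have off_diagonal: "?\<tau> h h' = 0"
      if agrees: "h' \<in> words_agreeing_off J h b" and h'_neq_h: "h' \<noteq> h" for h'
    proof (rule ccontr)
      assume "?\<tau> h h' \<noteq> 0"
      then have "\<forall>i\<in>{1..L} - I. secret i h = secret i h'"
        by (auto simp: tensor_mixed_def secrets_def split: if_splits)
      moreover have "h \<in> H" "h' \<in> H" "\<forall>j\<in>{1..n} - J. share j h = share j h'"
        using h_in_words_with_shares agrees by (auto simp: words_agreeing_off_def words_with_shares_def)
      ultimately have "h - h' = 0"
        by (intro injective H_diff) (simp_all add: secret_diff share_diff)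
      then show False
        using h'_neq_h by simp
    qed
    have "(\<Sum>h'\<in>words_agreeing_off J h b. ?\<tau> h h') =
        (\<Sum>h'\<in>words_agreeing_off J h b \<inter> {h}. ?\<tau> h h')"
      using off_diagonal finite_words_with_shares[of J b]
      by (intro sum.mono_neutral_right) (auto simp: words_agreeing_off_def)
    moreover have "words_agreeing_off J h b \<inter> {h} = (if a = b then {h} else {})"
      using h_in_words_with_shares
        words_with_shares_disjoint[OF a_in_PiE b_in_PiE h_in_words_with_shares]
      by (auto simp: words_agreeing_off_def)
    moreover have "?\<tau> h h = \<rho> (secrets I h) (secrets I h) / ?\<kappa>"
      by (simp add: tensor_mixed_def restrict_I del: One_nat_def)
    ultimately show ?thesis
      by simp
  qed
  then show ?thesis
    unfolding reduced_state_encode[OF J_subset] by (simp flip: sum_divide_distrib)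
qed

lemma card_words_with_shares_secrets_eq:
  assumes I_subset: "I \<subseteq> {1..L}" and J_subset: "J \<subseteq> {1..n}" and r_in_PiE: "r \<in> PiE I (\<lambda>_. K)"
    and d_in_H: "d \<in> H" and share_d_eq_0: "\<And>j. j \<in> J \<Longrightarrow> share j d = 0"
    and secret_d: "\<And>i. i \<in> I \<Longrightarrow> secret i d = r i"
  shows "card {h \<in> words_with_shares J a. secrets I h = r} =
    card {h \<in> words_with_shares J a. \<forall>i\<in>I. secret i h = 0}"
proof -
  have r_iff: "secrets I h = r \<longleftrightarrow> (\<forall>i\<in>I. secret i h = r i)" for h
    using r_in_PiE by (auto simp: secrets_def PiE_iff fun_eq_iff restrict_def extensional_def)
  have sums: "secret i (h + d) = secret i h + r i" "secret i (h - d) = secret i h - r i"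
    if "i \<in> I" "h \<in> H" for i h
    using that I_subset d_in_H share_d_eq_0 secret_d by (auto simp: secret_add secret_diff)
  have shares: "share j (h + d) = share j h" "share j (h - d) = share j h" if "j \<in> J" "h \<in> H" for j h
    using that J_subset d_in_H share_d_eq_0 secret_d by (auto simp: share_add share_diff)
  have "bij_betw (\<lambda>h. h - d) {h \<in> words_with_shares J a. secrets I h = r}
      {h \<in> words_with_shares J a. \<forall>i\<in>I. secret i h = 0}"
    unfolding r_iff using d_in_H H_add H_diff
    by (intro bij_betw_byWitness[of _ "\<lambda>h. h + d"]) (auto simp: words_with_shares_def sums shares)
  then show ?thesis
    by (rule bij_betw_same_card)
qed

theorem strongly_secure_encode:
  assumes I_subset: "I \<subseteq> {1..L}" and J_subset: "J \<subseteq> {1..n}"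
    and injective: "\<And>h. h \<in> H \<Longrightarrow> (\<And>i. i \<in> {1..L} - I \<Longrightarrow> secret i h = 0) \<Longrightarrow>
      (\<And>j. j \<in> {1..n} - J \<Longrightarrow> share j h = 0) \<Longrightarrow> h = 0"
    and surj: "\<And>r. r \<in> PiE I (\<lambda>_. K) \<Longrightarrow> \<exists>d\<in>H. (\<forall>j\<in>J. share j d = 0) \<and> (\<forall>i\<in>I. secret i d = r i)"
  shows "strongly_secure K L n (encode c) I J"
proof -
  let ?R = "PiE I (\<lambda>_. K)" and ?W = "\<lambda>a r. {h \<in> words_with_shares J a. secrets I h = r}"
  let ?Z = "\<lambda>a. {h \<in> words_with_shares J a. \<forall>i\<in>I. secret i h = 0}"
  have "(\<Sum>h\<in>words_with_shares J a. \<rho> (secrets I h) (secrets I h)) = of_nat (card (?Z a))"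
    if density_op_rho: "density_op ?R \<rho>" for \<rho> a
  proof -
    have "(\<Sum>h\<in>words_with_shares J a. \<rho> (secrets I h) (secrets I h)) =
        (\<Sum>r\<in>?R. of_nat (card (?W a r)) * \<rho> r r)"
      unfolding sum_words_by_secrets[OF I_subset] by (intro sum.cong refl) simp
    also have "\<dots> = (\<Sum>r\<in>?R. of_nat (card (?Z a)) * \<rho> r r)"
    proof (rule sum.cong[OF refl])
      fix r assume r_in_PiE: "r \<in> ?R"
      then obtain d where "d \<in> H" "\<forall>j\<in>J. share j d = 0" "\<forall>i\<in>I. secret i d = r i"
        using surj by blast
      then have "card (?W a r) = card (?Z a)"
        by (intro card_words_with_shares_secrets_eq[OF I_subset J_subset r_in_PiE]) auto
      then show "of_nat (card (?W a r)) * \<rho> r r = of_nat (card (?Z a)) * \<rho> r r"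
        by simp
    qed
    also have "\<dots> = of_nat (card (?Z a)) * (\<Sum>r\<in>?R. \<rho> r r)"
      by (rule sum_distrib_left[symmetric])
    also have "(\<Sum>r\<in>?R. \<rho> r r) = 1"
      using density_op_rho unfolding density_op_def by (elim conjE)
    finally show ?thesis
      by simp
  qed
  then show ?thesis
    unfolding strongly_secure_def using reduced_state_encode_tensor_mixed[OF I_subset J_subset injective]
    by (simp del: One_nat_def)
qed

end

locale ramp_scheme = alg_function_field K for K :: "'f::field set" +
  fixes G :: "'f set \<Rightarrow> int" and P Q :: "nat \<Rightarrow> 'f set" and n L :: nat
  assumes finite_K: "finite K" and divisor_G: "divisor K G"
    and rational_P: "j \<in> {1..n} \<Longrightarrow> rational_place K (P j)" and G_P: "j \<in> {1..n} \<Longrightarrow> G (P j) = 0"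
    and rational_Q: "i \<in> {1..L} \<Longrightarrow> rational_place K (Q i)" and G_Q: "i \<in> {1..L} \<Longrightarrow> G (Q i) = 0"
    and inj_P: "inj_on P {1..n}" and inj_Q: "inj_on Q {1..L}"
    and disjoint_P_Q: "P ` {1..n} \<inter> Q ` {1..L} = {}"
begin

sublocale code: evaluation_code K "RR_space K G" "\<lambda>i. eval_at K (Q i)" "\<lambda>j. eval_at K (P j)" L n
proof
  show "finite (RR_space K G)"
    by (rule finite_if_has_dim[OF finite_K has_dim_RR_space[OF divisor_G]])
  have RR_space_subset: "RR_space K G \<subseteq> R" if "rational_place K R" "G R = 0" for R
    using RR_space_subset_place rational_place_in_places that by blast
  show "eval_at K (Q i) h \<in> K" if "i \<in> {1..L}" "h \<in> RR_space K G" for i h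
    using eval_at_in_K[OF rational_Q] RR_space_subset[OF rational_Q G_Q] that by blast
  show "eval_at K (P j) h \<in> K" if "j \<in> {1..n}" "h \<in> RR_space K G" for j h
    using eval_at_in_K[OF rational_P] RR_space_subset[OF rational_P G_P] that by blast
  show "eval_at K (Q i) (h + h') = eval_at K (Q i) h + eval_at K (Q i) h'"
    if "i \<in> {1..L}" "h \<in> RR_space K G" "h' \<in> RR_space K G" for i h h'
    using eval_at_add[OF rational_Q] RR_space_subset[OF rational_Q G_Q] that by blast
  show "eval_at K (P j) (h + h') = eval_at K (P j) h + eval_at K (P j) h'"
    if "j \<in> {1..n}" "h \<in> RR_space K G" "h' \<in> RR_space K G" for j h h'
    using eval_at_add[OF rational_P] RR_space_subset[OF rational_P G_P] that by blast
qed (use finite_K submodule_add[OF submodule_RR_space] submodule_diff[OF submodule_RR_space] in auto)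

lemma qrss_encode_eq:
  "qrss_encode K G P Q n L =
    code.encode (complex_of_real (1 / sqrt (real (card K ^ ell K (G - places_sum Q {1..L})))))"
  by (simp add: fun_eq_iff qrss_encode_def qrss_amp_def code.encode_def code.amplitude_def)

context
  fixes I J :: "nat set"
  assumes I_subset: "I \<subseteq> {1..L}" and J_subset: "J \<subseteq> {1..n}"
begin

lemma finite_P_Un_Q: "finite (P ` J \<union> Q ` I)"
  using finite_subset[OF I_subset] finite_subset[OF J_subset] by simp

lemma card_P_Un_Q: "card (P ` J \<union> Q ` I) = card J + card I"
proof -
  have "P ` J \<inter> Q ` I = {}"
    using disjoint_P_Q I_subset J_subset by blast
  then show ?thesis
    using finite_P_Un_Q inj_on_subset[OF inj_P J_subset] inj_on_subset[OF inj_Q I_subset]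
    by (simp add: card_Un_disjoint card_image)
qed

lemma rational_P_Un_Q: "R \<in> P ` J \<union> Q ` I \<Longrightarrow> rational_place K R \<and> G R = 0"
  using rational_P rational_Q G_P G_Q I_subset J_subset by blast

lemma evaluation_eq_0_imp_eq_0:
  assumes "div_deg K G < int (card J + card I)" and "h \<in> RR_space K G"
    and "\<And>j. j \<in> J \<Longrightarrow> eval_at K (P j) h = 0" and "\<And>i. i \<in> I \<Longrightarrow> eval_at K (Q i) h = 0"
  shows "h = 0"
  using assms rational_P_Un_Q card_P_Un_Q
  by (intro RR_space_eq_0_if_many_zeros[OF divisor_G finite_P_Un_Q _ _ assms(2)]) auto

lemma evaluation_interpolation:
  assumes "2 * genus K - 1 \<le> div_deg K G - int (card J + card I)" and r_in_K: "r \<in> PiE I (\<lambda>_. K)"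
  shows "\<exists>h\<in>RR_space K G. (\<forall>j\<in>J. eval_at K (P j) h = 0) \<and> (\<forall>i\<in>I. eval_at K (Q i) h = r i)"
proof -
  define target where "target R = (if R \<in> Q ` I then r (the_inv_into I Q R) else 0)" for R
  have target_Q: "target (Q i) = r i" if "i \<in> I" for i
    using the_inv_into_f_f[OF inj_on_subset[OF inj_Q I_subset] that] that by (simp add: target_def)
  have target_P: "target (P j) = 0" if "j \<in> J" for j
    using disjoint_P_Q I_subset J_subset that by (auto simp: target_def)
  have "target R \<in> K" if "R \<in> P ` J \<union> Q ` I" for R
    using that r_in_K target_P target_Q K_0 by auto
  then obtain h where "h \<in> RR_space K G" "\<And>R. R \<in> P ` J \<union> Q ` I \<Longrightarrow> eval_at K R h = target R"
    using RR_space_interpolation[OF divisor_G finite_P_Un_Q rational_P_Un_Q, of target] assms(1)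
      card_P_Un_Q by auto
  then show ?thesis
    using target_P target_Q by (intro bexI[of _ h]) simp_all
qed

end

theorem strongly_secure_qrss_encode:
  assumes I_subset: "I \<subseteq> {1..L}" and J_subset: "J \<subseteq> {1..n}"
    and "div_deg K G < int (card ({1..n} - J) + card ({1..L} - I))"
    and "2 * genus K - 1 \<le> div_deg K G - int (card J + card I)"
  shows "strongly_secure K L n (qrss_encode K G P Q n L) I J"
  unfolding qrss_encode_eq
proof (rule code.strongly_secure_encode[OF I_subset J_subset])
  show "h = 0"
    if "h \<in> RR_space K G" "\<And>i. i \<in> {1..L} - I \<Longrightarrow> eval_at K (Q i) h = 0"
      "\<And>j. j \<in> {1..n} - J \<Longrightarrow> eval_at K (P j) h = 0" for h
    using that(3,2) by (rule evaluation_eq_0_imp_eq_0[OF Diff_subset Diff_subset assms(3) that(1)])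
qed (rule evaluation_interpolation[OF I_subset J_subset assms(4)])

end

theorem theorem1:
  fixes K :: "'f::field set" and G :: "'f set \<Rightarrow> int"
    and P Q :: "nat \<Rightarrow> 'f set" and n L :: nat and I J :: "nat set"
  assumes "function_field K" and "finite K"
    and "\<forall>j\<in>{1..n}. rational_place K (P j)"
    and "\<forall>i\<in>{1..L}. rational_place K (Q i)"
    and "inj_on P {1..n}" and "inj_on Q {1..L}" and "P ` {1..n} \<inter> Q ` {1..L} = {}"
    and "divisor K G"
    and "\<forall>j\<in>{1..n}. G (P j) = 0" and "\<forall>i\<in>{1..L}. G (Q i) = 0"
    and "int L = int (ell K G) - int (ell K (G - places_sum Q {1..L}))"
    and "ell K (G - places_sum P {1..n}) = 0"
    and "I \<subseteq> {1..L}" and "J \<subseteq> {1..n}"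
    and "int (card J) \<le> int (card ({1..L} - I)) +
           min (div_deg K G - int L - 2 * genus K + 1) (int n - 1 - div_deg K G)"
  shows "strongly_secure K L n (qrss_encode K G P Q n L) I J"
proof -
  interpret ramp_scheme K G P Q n L
    using assms(1-10) by unfold_locales auto
  have "int (card ({1..m} - A)) = int m - int (card A)" if "A \<subseteq> {1..m}" for A and m :: nat
    using card_Diff_subset[OF finite_subset[OF that] that] card_mono[OF _ that]
    by (simp add: of_nat_diff)
  note card_complements = this[OF assms(13)] this[OF assms(14)]
  show ?thesis
    using assms(15) card_complements by (intro strongly_secure_qrss_encode[OF assms(13,14)]) auto
qed

end
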